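(* Let $\mu$ be a self-similar measure of finite type satisfying the positive row property (setting described in the context). Then the set $$\{\dim_{loc}\mu(y): y \text{ an interior essential, positive, periodic point}\}$$ (at periodic points the local dimension exists, so upper, lower and local dimensions coincide) is dense in the set of local dimensions $\{\dim_{loc}\mu(x): x\text{ truly essential and the local dimension at } x \text{ exists}\}$; it is also dense in the set of lower local dimensions $\{\underline{\dim}_{loc}\mu(x):x\text{ truly essential}\}$ and in the set of upper local dimensions $\{\overline{\dim}_{loc}\mu(x):x\text{ truly essential}\}$.
   Context: Setting. Let $m\ge 1$ be an integer, $0<\varrho<1$, $0=d_0<d_1<\dots<d_m$, $S_j(x)=\varrho x+d_j$ for $j\in\mathcal A=\{0,\dots,m\}$. Let $K$ be the unique non-empty compact set with $K=\bigcup_j S_j(K)$; the $d_j$ are scaled so that the convex hull of $K$ is $[0,1]$ ($K$ need not be an interval). For $\sigma=(j_1,\dots,j_n)\in\mathcal A^n$ put $S_\sigma=S_{j_1}\circ\cdots\circ S_{j_n}$. The IFS is of finite type if there is a finite set $F\subseteq\mathbb R$ such that for every $n\ge1$ and all $\sigma,\sigma'\in\mathcal A^n$, either $\varrho^{-n}|S_\sigma(0)-S_{\sigma'}(0)|>1$ or $\varrho^{-n}(S_\sigma(0)-S_{\sigma'}(0))\in F$. Given $p_j>0$ with $\sum_j p_j=1$, $\mu$ is the unique Borel probability measure with $\mu=\sum_j p_j\,\mu\circ S_j^{-1}$; its support is $K$; $\mu$ is called of finite type if the IFS is. Local dimensions. $\overline{\dim}_{loc}\mu(x)=\limsup_{r\to0^+}\frac{\log\mu([x-r,x+r])}{\log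 r}$, $\underline{\dim}_{loc}\mu(x)$ is the corresponding $\liminf$, and $\dim_{loc}\mu(x)$ is the common value when the limit exists. Net intervals. Let $h_1<\dots<h_{s_n}$ be the elements of $\{S_\sigma(0),S_\sigma(1):\sigma\in\mathcal A^n\}$; $\mathcal F_n$ (net intervals of level $n$) is the set of $[h_j,h_{j+1}]$ with $(h_j,h_{j+1})\cap K\ne\emptyset$; $\mathcal F_0=\{[0,1]\}$. Each $\Delta\in\mathcal F_n$, $n\ge1$, is contained in a unique $\widehat\Delta\in\mathcal F_{n-1}$, its parent ($\Delta$ is a child of $\widehat\Delta$). For $\Delta=[a,b]\in\mathcal F_n$: normalized length $\ell_n(\Delta)=\varrho^{-n}(b-a)$; neighbour set $V_n(\Delta)$ = the increasingly ordered tuple of the distinct elements of $\{\varrho^{-n}(a-S_\sigma(0)):\sigma\in\mathcal A^n,\ \Delta\subseteq S_\sigma[0,1]\}$; $r_n(\Delta)$ = position of $\Delta$, from left to right, among the level $n$ net intervals with the same parent and the same normalized length. The characteristic vector is $\mathcal C_n(\Delta)=(\ell_n(\Delta),V_n(\Delta),r_n(\Delta))$. Under finite type the set $\Omega$ of characteristic vectors is finite, and the characteristic vectors of the children of $\Delta$ depend only on that of $\Delta$, so one may speak of children of characteristic vectors. An admissible path is a finite sequence of characteristic vectors, each being the parent of the next. A loop class is a non-empty $\Omega'\subseteq\Omega$ such that any $\alpha,\beta\in\Omega'$ are joined by an admissible path from $\alpha$ to $\beta$ inside $\Omega'$; it is an essential class if in addition all children of elements of $\Omega'$ are in $\Omega'$.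 There is exactly one essential class $\Omega_0$ (known). A net interval is essential if its characteristic vector is in $\Omega_0$. A symbolic representation of $x\in K$ is a sequence $[x]=(\mathcal C_0(\Delta_0),\mathcal C_1(\Delta_1),\dots)$ with $x\in\Delta_n\in\mathcal F_n$ and $\Delta_n$ the parent of $\Delta_{n+1}$ for all $n$. Truly essential points. $x\in K$ is a boundary point if it is an endpoint of a net interval of some level. If $x$ is an endpoint of $\Delta_n(x)\in\mathcal F_n$, the other net interval $\Delta_n'(x)$ is the level $n$ net interval on the other side of $x$ having $x$ as an endpoint (the empty set if there is none). $x$ is a boundary essential point if for some $n$ it is an endpoint of $\Delta_n(x)\in\mathcal F_n$ and both $\Delta_n(x)$ and $\Delta_n'(x)$ are essential (the empty set counting as essential). $x$ is an interior essential point if it is not a boundary point and it lies in the interior of some essential net interval. $x$ is truly essential if it is boundary essential or interior essential. Transition matrices. For a level $n$ net interval $\Delta=[a,b]$ with parent $\widehat\Delta=[c,d]$, $V_n(\Delta)=(a_1,\dots,a_N)$, $V_{n-1}(\widehat\Delta)=(c_1,\dots,c_M)$, the primitive transition matrix $T(\mathcal C_{n-1}(\widehat\Delta),\mathcal C_n(\Delta))$ is the $M\times N$ matrix whose $jk$ entry is $p_\ell$ if there are $\ell\in\mathcal A$ and $\sigma\in\mathcal A^{n-1}$ with $S_\sigma(0)=c-\varrho^{n-1}c_j$ and $S_{\sigma\ell}(0)=a-\varrho^n a_k$, and $0$ otherwise (it depends only on the two characteristic vectors). For an admissible path, $T(\gamma_1,\dots,\gamma_n)=T(\gamma_1,\gamma_2)\cdots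 T(\gamma_{n-1},\gamma_n)$. The positive row property: every primitive transition matrix $T(\alpha,\beta)$ with $\alpha,\beta\in\Omega_0$ has a non-zero entry in each row. Periodic points. $x\in K$ is periodic if it has a symbolic representation $(\gamma_0,\dots,\gamma_J,\theta^-,\theta^-,\dots)$, where $\theta$ is an admissible cycle (a non-trivial admissible path with equal first and last letters) and $\theta^-$ is $\theta$ with its last letter deleted; $\theta$ is called a period. $x$ is a positive periodic point if a period $\theta$ can be chosen with all entries of $T(\theta)$ strictly positive. *)

theory Defs
  imports "HOL-Probability.Probability" "Jordan_Normal_Form.Matrix"
begin

text \<open>
  A net interval \<open>[a, b]\<close> is represented by the pair \<open>(a, b)\<close> of its endpoints. The same interval
  may be a net interval of several levels, so the level is always carried along.

  A characteristic vector is a triple (normalized length, neighbour set, position), where the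
  neighbour set is an increasing list.
\<close>

type_synonym ivl = "real \<times> real"
type_synonym char_vec = "real \<times> real list \<times> nat"

abbreviation ivl_set :: "ivl \<Rightarrow> real set" where
  "ivl_set \<Delta> \<equiv> {fst \<Delta>..snd \<Delta>}"

locale ifs =
  fixes m :: nat and \<rho> :: real and d :: "nat \<Rightarrow> real" and K :: "real set"
  assumes m_pos: "m \<ge> 1"
    and ratio: "0 < \<rho>" "\<rho> < 1"
    and d_0: "d 0 = 0"
    and d_mono: "strict_mono_on {..m} d"
    and K_compact: "compact K"
    and K_nonempty: "K \<noteq> {}"
    and K_invariant: "K = (\<Union>j\<le>m. (\<lambda>x. \<rho> * x + d j) ` K)"
    and K_hull: "convex hull K = {0..1}"
begin

definition S :: "nat \<Rightarrow> real \<Rightarrow> real" where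
  "S j x = \<rho> * x + d j"

definition words :: "nat \<Rightarrow> nat list set" where
  "words n = {\<sigma>. length \<sigma> = n \<and> set \<sigma> \<subseteq> {..m}}"

definition S_word :: "nat list \<Rightarrow> real \<Rightarrow> real" where
  "S_word \<sigma> = foldr S \<sigma>"

definition finite_type :: bool where
  "finite_type \<longleftrightarrow>
    (\<exists>F. finite F \<and> (\<forall>n\<ge>1. \<forall>\<sigma>\<in>words n. \<forall>\<sigma>'\<in>words n.
      \<bar>S_word \<sigma> 0 - S_word \<sigma>' 0\<bar> / \<rho> ^ n > 1 \<or>
      (S_word \<sigma> 0 - S_word \<sigma>' 0) / \<rho> ^ n \<in> F))"

subsection \<open>Net intervals and characteristic vectors\<close>

definition endpoints :: "nat \<Rightarrow> real set" where
  "endpoints n = (\<Union>\<sigma>\<in>words n. {S_word \<sigma> 0, S_word \<sigma> 1})"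

definition net_intervals :: "nat \<Rightarrow> ivl set" where
  "net_intervals n =
    (if n = 0 then {(0, 1)}
     else {(a, b). a \<in> endpoints n \<and> b \<in> endpoints n \<and> a < b \<and>
             {a<..<b} \<inter> endpoints n = {} \<and> {a<..<b} \<inter> K \<noteq> {}})"

text \<open>\<open>parent n \<Delta>' \<Delta>\<close>: the level \<open>n\<close> net interval \<open>\<Delta>'\<close> is the parent of the level \<open>n + 1\<close>
  net interval \<open>\<Delta>\<close>.\<close>

definition parent :: "nat \<Rightarrow> ivl \<Rightarrow> ivl \<Rightarrow> bool" where
  "parent n \<Delta>' \<Delta> \<longleftrightarrow>
    \<Delta>' \<in> net_intervals n \<and> \<Delta> \<in> net_intervals (Suc n) \<and> ivl_set \<Delta> \<subseteq> ivl_set \<Delta>'"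

definition norm_length :: "nat \<Rightarrow> ivl \<Rightarrow> real" where
  "norm_length n \<Delta> = (snd \<Delta> - fst \<Delta>) / \<rho> ^ n"

definition neighbours :: "nat \<Rightarrow> ivl \<Rightarrow> real list" where
  "neighbours n \<Delta> = sorted_list_of_set
     {(fst \<Delta> - S_word \<sigma> 0) / \<rho> ^ n | \<sigma>. \<sigma> \<in> words n \<and> ivl_set \<Delta> \<subseteq> S_word \<sigma> ` {0..1}}"

text \<open>Positions are counted from 1; the single net interval of level 0 has position 1.\<close>

definition position :: "nat \<Rightarrow> ivl \<Rightarrow> nat" where
  "position n \<Delta> =
    (case n of
       0 \<Rightarrow> 1
     | Suc k \<Rightarrow> card {\<Delta>'. (\<exists>\<Delta>''. parent k \<Delta>'' \<Delta> \<and> parent k \<Delta>'' \<Delta>') \<and>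
                        norm_length n \<Delta>' = norm_length n \<Delta> \<and> fst \<Delta>' \<le> fst \<Delta>})"

definition char_vec :: "nat \<Rightarrow> ivl \<Rightarrow> char_vec" where
  "char_vec n \<Delta> = (norm_length n \<Delta>, neighbours n \<Delta>, position n \<Delta>)"

definition char_vecs :: "char_vec set" where
  "char_vecs = {char_vec n \<Delta> | n \<Delta>. \<Delta> \<in> net_intervals n}"

definition child :: "char_vec \<Rightarrow> char_vec \<Rightarrow> bool" where
  "child \<alpha> \<beta> \<longleftrightarrow>
    (\<exists>n \<Delta>' \<Delta>. parent n \<Delta>' \<Delta> \<and> char_vec n \<Delta>' = \<alpha> \<and> char_vec (Suc n) \<Delta> = \<beta>)"

definition admissible_path :: "char_vec list \<Rightarrow> bool" where
  "admissible_path \<gamma> \<longleftrightarrow> \<gamma> \<noteq> [] \<and> set \<gamma> \<subseteq> char_vecs \<and> successively child \<gamma>"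

definition loop_class :: "char_vec set \<Rightarrow> bool" where
  "loop_class \<Omega>' \<longleftrightarrow> \<Omega>' \<noteq> {} \<and> \<Omega>' \<subseteq> char_vecs \<and>
    (\<forall>\<alpha>\<in>\<Omega>'. \<forall>\<beta>\<in>\<Omega>'. \<exists>\<gamma>. admissible_path \<gamma> \<and> hd \<gamma> = \<alpha> \<and> last \<gamma> = \<beta> \<and> set \<gamma> \<subseteq> \<Omega>')"

definition is_essential_class :: "char_vec set \<Rightarrow> bool" where
  "is_essential_class \<Omega>' \<longleftrightarrow> loop_class \<Omega>' \<and> (\<forall>\<alpha>\<in>\<Omega>'. \<forall>\<beta>. child \<alpha> \<beta> \<longrightarrow> \<beta> \<in> \<Omega>')"

text \<open>Under finite type there is exactly one essential class.\<close>

definition essential_class :: "char_vec set" where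
  "essential_class = (THE \<Omega>'. is_essential_class \<Omega>')"

definition essential :: "nat \<Rightarrow> ivl \<Rightarrow> bool" where
  "essential n \<Delta> \<longleftrightarrow> \<Delta> \<in> net_intervals n \<and> char_vec n \<Delta> \<in> essential_class"

definition symbolic_rep :: "real \<Rightarrow> (nat \<Rightarrow> char_vec) \<Rightarrow> bool" where
  "symbolic_rep x \<gamma> \<longleftrightarrow>
    (\<exists>\<Delta>. \<forall>n. \<Delta> n \<in> net_intervals n \<and> x \<in> ivl_set (\<Delta> n) \<and>
             parent n (\<Delta> n) (\<Delta> (Suc n)) \<and> \<gamma> n = char_vec n (\<Delta> n))"

subsection \<open>Truly essential points\<close>

definition boundary_point :: "real \<Rightarrow> bool" where
  "boundary_point x \<longleftrightarrow> x \<in> K \<and> (\<exists>n. \<exists>\<Delta>\<in>net_intervals n. x = fst \<Delta> \<or> x = snd \<Delta>)"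

text \<open>\<open>other_side n x \<Delta> \<Delta>'\<close>: \<open>x\<close> is an endpoint of \<open>\<Delta>\<close>, and \<open>\<Delta>'\<close> is the other net interval of
  level \<open>n\<close> at \<open>x\<close>. There is at most one such \<open>\<Delta>'\<close>; if there is none, the condition imposed on it in
  \<open>boundary_essential\<close> is void, i.e. the empty set counts as essential.\<close>

definition other_side :: "nat \<Rightarrow> real \<Rightarrow> ivl \<Rightarrow> ivl \<Rightarrow> bool" where
  "other_side n x \<Delta> \<Delta>' \<longleftrightarrow> \<Delta>' \<in> net_intervals n \<and>
    (x = fst \<Delta> \<and> x = snd \<Delta>' \<or> x = snd \<Delta> \<and> x = fst \<Delta>')"

definition boundary_essential :: "real \<Rightarrow> bool" where
  "boundary_essential x \<longleftrightarrow> x \<in> K \<and>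
    (\<exists>n \<Delta>. \<Delta> \<in> net_intervals n \<and> (x = fst \<Delta> \<or> x = snd \<Delta>) \<and> essential n \<Delta> \<and>
       (\<forall>\<Delta>'. other_side n x \<Delta> \<Delta>' \<longrightarrow> essential n \<Delta>'))"

definition interior_essential :: "real \<Rightarrow> bool" where
  "interior_essential x \<longleftrightarrow> x \<in> K \<and> \<not> boundary_point x \<and>
    (\<exists>n \<Delta>. essential n \<Delta> \<and> fst \<Delta> < x \<and> x < snd \<Delta>)"

definition truly_essential :: "real \<Rightarrow> bool" where
  "truly_essential x \<longleftrightarrow> boundary_essential x \<or> interior_essential x"

subsection \<open>Periodic points\<close>

text \<open>Non-trivial means at least one step, i.e. at least two letters.\<close>

definition admissible_cycle :: "char_vec list \<Rightarrow> bool" where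
  "admissible_cycle \<theta> \<longleftrightarrow> admissible_path \<theta> \<and> length \<theta> \<ge> 2 \<and> hd \<theta> = last \<theta>"

text \<open>\<open>x\<close> has a symbolic representation \<open>(\<gamma>\<^sub>0, \<dots>, \<gamma>\<^sub>J, \<theta>\<^sup>-, \<theta>\<^sup>-, \<dots>)\<close>, where \<open>\<theta>\<^sup>-\<close> is \<open>butlast \<theta>\<close>.\<close>

definition period_of :: "real \<Rightarrow> char_vec list \<Rightarrow> bool" where
  "period_of x \<theta> \<longleftrightarrow> admissible_cycle \<theta> \<and>
    (\<exists>\<gamma> J. symbolic_rep x \<gamma> \<and>
       (\<forall>k. \<gamma> (Suc J + k) = butlast \<theta> ! (k mod length (butlast \<theta>))))"

definition periodic_point :: "real \<Rightarrow> bool" where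
  "periodic_point x \<longleftrightarrow> x \<in> K \<and> (\<exists>\<theta>. period_of x \<theta>)"

end

subsection \<open>Self-similar measures\<close>

locale self_similar_measure = ifs m \<rho> d K
  for m :: nat and \<rho> :: real and d :: "nat \<Rightarrow> real" and K :: "real set" +
  fixes p :: "nat \<Rightarrow> real" and \<mu> :: "real measure"
  assumes p_pos: "\<And>j. j \<le> m \<Longrightarrow> p j > 0"
    and p_sum: "(\<Sum>j\<le>m. p j) = 1"
    and mu_prob: "prob_space \<mu>"
    and mu_sets: "sets \<mu> = sets borel"
    and mu_invariant:
      "\<And>A. A \<in> sets borel \<Longrightarrow> measure \<mu> A = (\<Sum>j\<le>m. p j * measure \<mu> (S j -` A))"
begin

text \<open>The transition matrix of a net interval \<open>\<Delta>'\<close> of level \<open>n\<close> and its child \<open>\<Delta>\<close>. The letter \<open>l\<close>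
  is determined by the two net intervals and by \<open>j\<close> and \<open>k\<close>, as the \<open>d\<^sub>l\<close> are distinct.
  Indices start at 0.\<close>

definition interval_matrix :: "nat \<Rightarrow> ivl \<Rightarrow> ivl \<Rightarrow> real Matrix.mat" where
  "interval_matrix n \<Delta>' \<Delta> =
    Matrix.mat (length (neighbours n \<Delta>')) (length (neighbours (Suc n) \<Delta>)) (\<lambda>(j, k).
      let Q = (\<lambda>l. l \<le> m \<and> (\<exists>\<sigma>\<in>words n.
                 S_word \<sigma> 0 = fst \<Delta>' - \<rho> ^ n * neighbours n \<Delta>' ! j \<and>
                 S_word (\<sigma> @ [l]) 0 = fst \<Delta> - \<rho> ^ Suc n * neighbours (Suc n) \<Delta> ! k))
      in if \<exists>l. Q l then p (THE l. Q l) else 0)"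

text \<open>\<open>interval_matrix\<close> depends only on the characteristic vectors of the two net intervals, so any
  pair of net intervals realizing \<open>(\<alpha>, \<beta>)\<close> may be chosen.\<close>

definition primitive_matrix :: "char_vec \<Rightarrow> char_vec \<Rightarrow> real Matrix.mat" where
  "primitive_matrix \<alpha> \<beta> =
    (SOME A. \<exists>n \<Delta>' \<Delta>. parent n \<Delta>' \<Delta> \<and> char_vec n \<Delta>' = \<alpha> \<and> char_vec (Suc n) \<Delta> = \<beta> \<and>
                       A = interval_matrix n \<Delta>' \<Delta>)"

text \<open>On a one-letter path this is the identity matrix, so that on longer paths it is the product of
  the primitive matrices of the steps. The empty list is not an admissible path.\<close>

fun path_matrix :: "char_vec list \<Rightarrow> real Matrix.mat" where
  "path_matrix [] = 1\<^sub>m 0"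
| "path_matrix [\<alpha>] = 1\<^sub>m (length (fst (snd \<alpha>)))"
| "path_matrix (\<alpha> # \<beta> # \<gamma>) = primitive_matrix \<alpha> \<beta> * path_matrix (\<beta> # \<gamma>)"

definition positive_row_property :: bool where
  "positive_row_property \<longleftrightarrow>
    (\<forall>\<alpha>\<in>essential_class. \<forall>\<beta>\<in>essential_class. child \<alpha> \<beta> \<longrightarrow>
       (\<forall>j<dim_row (primitive_matrix \<alpha> \<beta>). \<exists>k<dim_col (primitive_matrix \<alpha> \<beta>).
          primitive_matrix \<alpha> \<beta> $$ (j, k) \<noteq> 0))"

definition positive_periodic_point :: "real \<Rightarrow> bool" where
  "positive_periodic_point x \<longleftrightarrow> x \<in> K \<and>
    (\<exists>\<theta>. period_of x \<theta> \<and>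
       (\<forall>j<dim_row (path_matrix \<theta>). \<forall>k<dim_col (path_matrix \<theta>). path_matrix \<theta> $$ (j, k) > 0))"

end

subsection \<open>Local dimensions\<close>

text \<open>Only used at points \<open>x\<close> of the support of \<open>\<mu>\<close>, where the measure inside the logarithm is
  positive. (In HOL, \<open>ln 0 = 0\<close>, so the values at other points are meaningless.)\<close>

definition dim_ratio :: "real measure \<Rightarrow> real \<Rightarrow> real \<Rightarrow> ereal" where
  "dim_ratio \<mu> x r = ereal (ln (measure \<mu> {x - r..x + r}) / ln r)"

definition upper_local_dim :: "real measure \<Rightarrow> real \<Rightarrow> ereal" where
  "upper_local_dim \<mu> x = Limsup (at_right 0) (dim_ratio \<mu> x)"

definition lower_local_dim :: "real measure \<Rightarrow> real \<Rightarrow> ereal" where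
  "lower_local_dim \<mu> x = Liminf (at_right 0) (dim_ratio \<mu> x)"

definition local_dim_exists :: "real measure \<Rightarrow> real \<Rightarrow> bool" where
  "local_dim_exists \<mu> x \<longleftrightarrow> (\<exists>L. (dim_ratio \<mu> x \<longlongrightarrow> L) (at_right 0))"

definition local_dim :: "real measure \<Rightarrow> real \<Rightarrow> ereal" where
  "local_dim \<mu> x = Lim (at_right 0) (dim_ratio \<mu> x)"

text \<open>\<open>A\<close> is a dense subset of \<open>B\<close>.\<close>

definition dense_subset :: "'a::topological_space set \<Rightarrow> 'a set \<Rightarrow> bool" where
  "dense_subset A B \<longleftrightarrow> A \<subseteq> B \<and> B \<subseteq> closure A"

end

theory Submission
  imports Defs
begin

text \<open>
  Let \<open>G n z\<close> be the total weight of the level \<open>n\<close> cylinders \<open>S\<^sub>\<sigma>[0, 1]\<close> that contain \<open>z\<close>. It is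
  non-increasing in \<open>n\<close> and satisfies \<open>G (n + k) z = (\<Sum>\<sigma>. p\<^sub>\<sigma> G k (S\<^sub>\<sigma>\<^sup>-\<^sup>1 z))\<close>, so it replaces the norms
  of transition matrices. If the orbit of \<open>z\<close> under the inverse maps is finite, which is the case for
  periodic points, then the distance from \<open>z\<close> to the level \<open>n\<close> cylinders not containing it is at least
  \<open>c \<rho>\<^sup>n\<close>, hence \<open>G n z\<close> is comparable to the measure of the ball of radius \<open>\<rho>\<^sup>n\<close> around \<open>z\<close>, and by
  Fekete's lemma the local dimension exists.

  For the density, fix a truly essential point \<open>x\<close> and a scale \<open>n\<close>. One of the boundedly many level \<open>n\<close>
  cylinders near \<open>x\<close> carries a fixed proportion of the mass of the ball around \<open>x\<close>; a net interval \<open>D\<close> in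
  it is essential, with an ancestor \<open>E\<close> of a level \<open>J\<close> that depends on \<open>x\<close> only. By the positive row
  property there is a copy of \<open>E\<close> strictly inside \<open>D\<close>, boundedly many levels below, such that every neighbour
  of \<open>D\<close> is connected to every neighbour of the copy. The fixed point of the affine map from \<open>E\<close> to its
  copy is a positive periodic point whose local dimension is \<open>log (G n) / (n log \<rho>)\<close> up to an error
  of order \<open>1 / n\<close>.
\<close>

subsection \<open>Growth rates of sequences\<close>

text \<open>The period of the approximating point has length \<open>L = k + l\<close>, where
  \<open>n = J + k\<close> is the scale, so it grows with \<open>n\<close>; the errors must stay
  bounded meanwhile. Let \<open>Y\<close> be the finite set of normalized positions of
  \<open>y\<close> in the cylinders over \<open>E\<close>, and \<open>H\<close> the maximum of
  \<open>G k\<close> on \<open>Y\<close>. Over one period \<open>G\<close> shrinks by a factor of at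
  most \<open>H\<close>, and for a maximizer in \<open>Y\<close> by at least
  \<open>pmin ^ l * H\<close>: since \<open>D\<close> is fully connected to the copy of
  \<open>E\<close>, every word of length \<open>k\<close> has a continuation of weight at least
  \<open>pmin ^ l\<close> that returns to the same element of \<open>Y\<close>. Hence the rate
  \<Lambda> of \<open>y\<close> satisfies \<open>L * \<Lambda> = ln H\<close> up to
  \<open>l * ln pmin\<close>, while \<open>G n y\<close> is \<open>H\<close> up to a factor
  \<open>pmin ^ J\<close>. Both errors are independent of \<open>n\<close>: \<open>J\<close> belongs
  to \<open>x\<close>, and \<open>l\<close> is bounded because there are finitely many choices of
  \<open>E\<close> and finitely many types of \<open>D\<close>. True essentiality enters because a
  heavy cylinder need not contain \<open>x\<close>, so all level \<open>J\<close> net intervals near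
  \<open>x\<close> have to be essential. Full connections come from a cylinder overlapping a maximal
  number of cylinders of its level: whatever overlaps a copy of it inside the cylinder of \<sigma>
  descends from \<sigma>.\<close>

lemma fekete:
  fixes a :: "nat \<Rightarrow> real"
  assumes sub: "\<And>n k. a (n + k) \<le> a n + a k" and lower: "\<And>n. - C * real n \<le> a n"
  shows "\<exists>L. (\<lambda>n. a n / real n) \<longlonglongrightarrow> L"
proof -
  define L where "L = Inf {a n / real n | n. n \<ge> 1}"
  have bdd: "bdd_below {a n / real n | n. n \<ge> 1}"
    using lower by (intro bdd_belowI[of _ "- C"]) (auto simp: field_simps)
  have lo: "L \<le> a n / real n" if "n \<ge> 1" for n
    unfolding L_def using bdd that by (intro cInf_lower) auto
  have mult: "a (q * N + r) \<le> real q * a N + a r" for q N r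
  proof (induction q)
    case (Suc q)
    have "a (Suc q * N + r) \<le> a N + a (q * N + r)" using sub[of N "q * N + r"] by (simp add: add_ac)
    thus ?case using Suc by (simp add: algebra_simps)
  qed simp
  have "(\<lambda>n. a n / real n) \<longlonglongrightarrow> L"
  proof (rule LIMSEQ_I)
    fix e :: real assume e: "e > 0"
    have "\<exists>x\<in>{a n / real n | n. n \<ge> 1}. x < L + e / 2"
    proof (rule ccontr)
      assume "\<not> ?thesis"
      hence "L + e / 2 \<le> L" unfolding L_def[symmetric] by (subst (2) L_def) (intro cInf_greatest, auto simp: not_less)
      thus False using e by simp
    qed
    then obtain N where N: "N \<ge> 1" "a N / real N < L + e / 2" by auto
    \<comment> \<open>Dividing \<open>n\<close> by \<open>N\<close> with remainder leaves two
      errors: the value of \<open>a\<close> at the remainder, and the rounding of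
      \<open>n div N\<close>, which costs at most one \<open>\<bar>a N\<bar>\<close>.\<close>
    define B where "B = \<bar>a N\<bar> + Max ((\<lambda>r. \<bar>a r\<bar>) ` {..<N})"
    have up: "a n / real n \<le> a N / real N + B / real n" if n: "n \<ge> 1" for n
    proof -
      have "a n \<le> real (n div N) * a N + a (n mod N)" using mult[of "n div N" N "n mod N"] by simp
      moreover have "a (n mod N) \<le> Max ((\<lambda>r. \<bar>a r\<bar>) ` {..<N})"
        using N by (intro order.trans[OF abs_ge_self Max_ge]) auto
      moreover have "real (n div N) * a N = real n * (a N / real N) - (real (n mod N) / real N) * a N"
      proof -
        have "real n = real (n div N) * real N + real (n mod N)"
          by (metis div_mult_mod_eq of_nat_add of_nat_mult)
        thus ?thesis using N by (simp add: algebra_simps add_divide_distrib)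
      qed
      moreover have "\<bar>(real (n mod N) / real N) * a N\<bar> \<le> 1 * \<bar>a N\<bar>"
        unfolding abs_mult using N by (intro mult_right_mono) auto
      ultimately have "a n \<le> real n * (a N / real N) + B" unfolding B_def by linarith
      hence "a n / real n \<le> (real n * (a N / real N) + B) / real n" by (intro divide_right_mono) auto
      thus ?thesis using n by (simp add: add_divide_distrib)
    qed
    have "(\<lambda>n. B / real n) \<longlonglongrightarrow> 0" by (rule lim_const_over_n)
    then obtain M where "\<forall>n\<ge>M. norm (B / real n - 0) < e / 2"
      using LIMSEQ_D[of "\<lambda>n. B / real n" 0 "e / 2"] e by (meson half_gt_zero)
    hence M: "\<bar>B / real n\<bar> < e / 2" if "n \<ge> M" for n using that by simp
    show "\<exists>no. \<forall>n\<ge>no. norm (a n / real n - L) < e"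
    proof (intro exI[of _ "max M 1"] allI impI)
      fix n assume n: "n \<ge> max M 1"
      have "a n / real n \<le> a N / real N + B / real n" "L \<le> a n / real n" "\<bar>B / real n\<bar> < e / 2"
        using up[of n] lo[of n] M[of n] n by auto
      thus "norm (a n / real n - L) < e" using N(2) unfolding real_norm_def by linarith
    qed
  qed
  thus ?thesis by blast
qed

text \<open>Eventual properties along \<open>B\<close> pull back along \<phi>, so the composition
  sees only part of the values of \<open>u\<close>. It is applied in both directions between
  exponents and radii: to the powers of \<open>r\<close> as sample radii, and to the exponent as a
  function of the radius.\<close>

lemma Limsup_compose_le:
  fixes u :: "'b \<Rightarrow> 'c::complete_lattice"
  assumes "filterlim \<phi> B A"
  shows "Limsup A (\<lambda>x. u (\<phi> x)) \<le> Limsup B u" "Liminf B u \<le> Liminf A (\<lambda>x. u (\<phi> x))"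
proof -
  show "Limsup A (\<lambda>x. u (\<phi> x)) \<le> Limsup B u"
    unfolding Limsup_def
  proof (rule INF_mono)
    fix P assume "P \<in> {P. eventually P B}"
    hence "eventually (\<lambda>x. P (\<phi> x)) A" using assms by (auto simp: filterlim_iff)
    thus "\<exists>Q\<in>{P. eventually P A}. (SUP x\<in>{x. Q x}. u (\<phi> x)) \<le> (SUP x\<in>{x. P x}. u x)"
      by (intro bexI[of _ "\<lambda>x. P (\<phi> x)"] SUP_least SUP_upper) auto
  qed
  show "Liminf B u \<le> Liminf A (\<lambda>x. u (\<phi> x))"
    unfolding Liminf_def
  proof (rule SUP_mono)
    fix P assume "P \<in> {P. eventually P B}"
    hence "eventually (\<lambda>x. P (\<phi> x)) A" using assms by (auto simp: filterlim_iff)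
    thus "\<exists>Q\<in>{P. eventually P A}. (INF x\<in>{x. P x}. u x) \<le> (INF x\<in>{x. Q x}. u (\<phi> x))"
      by (intro bexI[of _ "\<lambda>x. P (\<phi> x)"] INF_greatest INF_lower) auto
  qed
qed

lemma limsup_vanishing_le:
  fixes e :: "nat \<Rightarrow> real" and u v :: "nat \<Rightarrow> ereal"
  assumes "e \<longlonglongrightarrow> 0" "eventually (\<lambda>n. u n \<le> ereal (e n) + v n) sequentially"
  shows "limsup u \<le> limsup v" "liminf u \<le> liminf v"
proof -
  have "(\<lambda>n. ereal (e n)) \<longlonglongrightarrow> 0" using assms(1) by (simp add: zero_ereal_def)
  note e = ereal_limsup_lim_add[OF this, of v] ereal_liminf_lim_add[OF this, of v]
  show "limsup u \<le> limsup v" using Limsup_mono[OF assms(2)] e by simp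
  show "liminf u \<le> liminf v" using Liminf_mono[OF assms(2)] e by simp
qed

text \<open>After division by \<open>n\<close> an additive constant vanishes, and so does an index
  shift: \<open>B (n + q) / n\<close> and \<open>B (n + q) / (n + q)\<close> differ by the second
  quotient times \<open>q / n\<close>, and the linear bound keeps that quotient bounded
  above.\<close>

lemma limsup_rate_le:
  fixes A B :: "nat \<Rightarrow> real"
  assumes AB: "eventually (\<lambda>n. A n \<le> B (n + q) + c) sequentially"
    and B: "eventually (\<lambda>n. B n \<le> \<beta> * (real n + 1)) sequentially"
  shows "limsup (\<lambda>n. ereal (A n / real n)) \<le> limsup (\<lambda>n. ereal (B n / real n))"
    "liminf (\<lambda>n. ereal (A n / real n)) \<le> liminf (\<lambda>n. ereal (B n / real n))"
proof -
  define e where "e n = (2 * \<bar>\<beta>\<bar> * real q + \<bar>c\<bar>) / real n" for n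
  have e: "e \<longlonglongrightarrow> 0" unfolding e_def by (rule lim_const_over_n)
  have B': "eventually (\<lambda>n. B (n + q) \<le> \<beta> * (real (n + q) + 1)) sequentially"
    using B by (subst eventually_sequentially_seg)
  have "eventually (\<lambda>n. ereal (A n / real n) \<le> ereal (e n) + ereal (B (n + q) / real (n + q))) sequentially"
    using AB B' eventually_ge_at_top[of 1]
  proof eventually_elim
    case (elim n)
    have n: "real n > 0" "real (n + q) > 0" using elim by auto
    have "B (n + q) \<le> \<bar>\<beta>\<bar> * (real (n + q) + 1)"
      using elim(2) by (rule order.trans) (intro mult_right_mono, auto)
    also have "\<dots> \<le> \<bar>\<beta>\<bar> * (2 * real (n + q))" using elim by (intro mult_left_mono) auto
    finally have b: "B (n + q) / real (n + q) \<le> 2 * \<bar>\<beta>\<bar>" using n by (simp add: field_simps)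
    have "A n / real n \<le> (B (n + q) + c) / real n" using elim n by (intro divide_right_mono) auto
    also have "B (n + q) / real n = B (n + q) / real (n + q) + (B (n + q) / real (n + q)) * (real q / real n)"
    proof -
      have "B (n + q) / real n = B (n + q) / real (n + q) * (real (n + q) / real n)" using n by simp
      also have "real (n + q) / real n = 1 + real q / real n" using n by (simp add: add_divide_distrib)
      finally show ?thesis by (simp only: distrib_left mult_1_right)
    qed
    hence "(B (n + q) + c) / real n = B (n + q) / real (n + q) + (B (n + q) / real (n + q)) * (real q / real n) + c / real n"
      by (simp add: add_divide_distrib)
    also have "(B (n + q) / real (n + q)) * (real q / real n) \<le> 2 * \<bar>\<beta>\<bar> * (real q / real n)"
      using b n by (intro mult_right_mono) auto
    also have "c / real n \<le> \<bar>c\<bar> / real n" using n by (intro divide_right_mono) auto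
    finally show ?case by (simp add: e_def add_divide_distrib)
  qed
  note * = limsup_vanishing_le[OF e this]
  show "limsup (\<lambda>n. ereal (A n / real n)) \<le> limsup (\<lambda>n. ereal (B n / real n))"
    using *(1) limsup_shift_k[of "\<lambda>n. ereal (B n / real n)" q] by simp
  show "liminf (\<lambda>n. ereal (A n / real n)) \<le> liminf (\<lambda>n. ereal (B n / real n))"
    using *(2) liminf_shift_k[of "\<lambda>n. ereal (B n / real n)" q] by simp
qed

text \<open>A radius between \<open>r ^ Suc n\<close> and \<open>r ^ n\<close> has, by monotonicity
  of \<open>H\<close>, a quotient between \<open>X n / (n + 1)\<close> and
  \<open>X (Suc n) / n\<close>. The linear bound on \<open>X\<close> makes both comparable with
  \<open>X n / n\<close> in the limit.\<close>

lemma radial_limits: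
  fixes r \<beta> :: real and H :: "real \<Rightarrow> real"
  assumes r: "0 < r" "r < 1" and pos: "\<And>x. x > 0 \<Longrightarrow> 0 < H x" and le1: "\<And>x. H x \<le> 1"
    and mono: "\<And>x y. x \<le> y \<Longrightarrow> H x \<le> H y" and lower: "\<And>n. ln (H (r ^ n)) / ln r \<le> \<beta> * real n"
  shows "Limsup (at_right 0) (\<lambda>x. ereal (ln (H x) / ln x)) = limsup (\<lambda>n. ereal (ln (H (r ^ n)) / ln r / real n))"
    "Liminf (at_right 0) (\<lambda>x. ereal (ln (H x) / ln x)) = liminf (\<lambda>n. ereal (ln (H (r ^ n)) / ln r / real n))"
proof -
  define f where "f = (\<lambda>x. ereal (ln (H x) / ln x))"
  define X where "X n = ln (H (r ^ n)) / ln r" for n :: nat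
  have l: "ln r < 0" using r by simp
  have X: "0 \<le> X n" "X n \<le> \<beta> * real n" for n
    using lower[of n] l pos[of "r ^ n"] le1[of "r ^ n"] r by (auto simp: X_def divide_nonpos_neg)
  have \<beta>: "0 \<le> \<beta>" using X[of 1] by simp
  have fX: "f (r ^ n) = ereal (X n / real n)" for n
    using r by (simp add: f_def X_def ln_realpow mult.commute)
  have pw: "filterlim (\<lambda>n. r ^ n) (at_right 0) sequentially"
    using r by (intro tendsto_imp_filterlim_at_right LIMSEQ_realpow_zero always_eventually) auto
  \<comment> \<open>The exponent of the largest scale:
    \<open>r ^ Suc (\<phi> x) \<le> x \<le> r ^ \<phi> x\<close> for small \<open>x\<close>.\<close>
  define \<phi> where "\<phi> x = nat \<lfloor>ln x / ln r\<rfloor>" for x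
  have "filterlim (\<lambda>x. (- 1 / ln r) * (- ln x)) at_top (at_right 0)"
    using l by (intro filterlim_tendsto_pos_mult_at_top[OF tendsto_const]
      filterlim_compose[OF filterlim_uminus_at_top_at_bot] ln_at_0) (auto simp: divide_neg_neg)
  hence "filterlim (\<lambda>x. ln x / ln r) at_top (at_right 0)" by simp
  hence \<phi>: "filterlim \<phi> sequentially (at_right 0)"
    unfolding \<phi>_def by (intro filterlim_compose[OF filterlim_nat_sequentially] filterlim_compose[OF filterlim_floor_sequentially])
  have "eventually (\<lambda>x. \<phi> x \<ge> 1) (at_right 0)" using \<phi> by (auto simp: filterlim_at_top)
  moreover have "eventually (\<lambda>x. x \<in> {0<..<1}) (at_right (0::real))" by (rule eventually_at_right_real) simp
  ultimately have ev: "eventually (\<lambda>x. \<phi> x \<ge> 1 \<and> x \<in> {0<..<1}) (at_right 0)" by eventually_elim simp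
  have key: "X (\<phi> x) / (real (\<phi> x) + 1) \<le> ln (H x) / ln x \<and> ln (H x) / ln x \<le> X (Suc (\<phi> x)) / real (\<phi> x)"
    if x: "\<phi> x \<ge> 1" "x \<in> {0<..<1}" for x
  proof -
    define n where "n = \<phi> x"
    define y where "y = ln x / ln r"
    have "0 \<le> y" using x l by (auto simp: y_def divide_nonpos_neg)
    hence y: "real n \<le> y" "y \<le> real n + 1" unfolding n_def \<phi>_def y_def[symmetric] by linarith+
    have lx: "ln x = y * ln r" using l by (simp add: y_def)
    have "(real n + 1) * ln r \<le> ln x" "ln x \<le> real n * ln r" using y l by (auto simp: lx)
    hence "ln (r ^ Suc n) \<le> ln x" "ln x \<le> ln (r ^ n)" using r by (simp_all only: ln_realpow of_nat_Suc add.commute)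
    hence "r ^ Suc n \<le> x" "x \<le> r ^ n" using r x by (simp_all only: ln_le_cancel_iff greaterThanLessThan_iff zero_less_power)
    hence "H (r ^ Suc n) \<le> H x" "H x \<le> H (r ^ n)" by (intro mono; simp)+
    hence "ln (H (r ^ Suc n)) \<le> ln (H x)" "ln (H x) \<le> ln (H (r ^ n))" using pos[of x] pos[of "r ^ Suc n"] r x by auto
    hence Y: "X n \<le> ln (H x) / ln r" "ln (H x) / ln r \<le> X (Suc n)" using l by (auto simp: X_def divide_right_mono_neg)
    have e: "ln (H x) / ln x = (ln (H x) / ln r) / y" using l by (simp add: lx)
    have n1: "real n \<ge> 1" using x by (simp add: n_def)
    have "X n / (real n + 1) \<le> (ln (H x) / ln r) / y" using X[of n] Y y n1 by (intro frac_le) auto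
    moreover have "(ln (H x) / ln r) / y \<le> X (Suc n) / real n" using X[of n] X[of "Suc n"] Y y n1 by (intro frac_le) auto
    ultimately show ?thesis unfolding e n_def by simp
  qed
  define U where "U n = ereal (X (Suc n) / real n)" for n
  define V where "V n = ereal (X n / (real n + 1))" for n
  have XU: "limsup U \<le> limsup (\<lambda>n. ereal (X n / real n))" "liminf U \<le> liminf (\<lambda>n. ereal (X n / real n))"
  proof -
    have "X n \<le> \<beta> * (real n + 1)" for n
      using X(2)[of n] \<beta> by (simp add: distrib_left)
    hence "eventually (\<lambda>n. X n \<le> \<beta> * (real n + 1)) sequentially" by simp
    thus "limsup U \<le> limsup (\<lambda>n. ereal (X n / real n))" "liminf U \<le> liminf (\<lambda>n. ereal (X n / real n))"
      unfolding U_def using limsup_rate_le[of "\<lambda>n. X (Suc n)" X 1 0 \<beta>] by simp_all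
  qed
  have "(\<lambda>n. \<beta> / real (Suc n)) \<longlonglongrightarrow> 0" using lim_const_over_n[of \<beta>] by (rule LIMSEQ_Suc)
  moreover have "eventually (\<lambda>n. ereal (X n / real n) \<le> ereal (\<beta> / real (Suc n)) + V n) sequentially"
    using eventually_ge_at_top[of 1]
  proof eventually_elim
    case (elim n)
    have "X n / real n - X n / (real n + 1) = (X n / real n) / (real n + 1)" using elim by (simp add: field_simps)
    also have "\<dots> \<le> \<beta> / (real n + 1)" using X(2)[of n] elim by (intro divide_right_mono) (auto simp: field_simps)
    finally show ?case by (simp add: V_def add.commute)
  qed
  ultimately have XV: "limsup (\<lambda>n. ereal (X n / real n)) \<le> limsup V" "liminf (\<lambda>n. ereal (X n / real n)) \<le> liminf V"
    by (rule limsup_vanishing_le)+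
  have fU: "eventually (\<lambda>x. f x \<le> U (\<phi> x)) (at_right 0)" and fV: "eventually (\<lambda>x. V (\<phi> x) \<le> f x) (at_right 0)"
    using ev by (eventually_elim, use key in \<open>auto simp: f_def U_def V_def\<close>)+
  \<comment> \<open>One inequality is the squeeze by \<open>U\<close>, the other only uses that the
    powers of \<open>r\<close> are particular radii. The same happens for the liminf with
    \<open>V\<close>.\<close>
  have "Limsup (at_right 0) f = limsup (\<lambda>n. ereal (X n / real n))"
  proof (rule antisym)
    show "Limsup (at_right 0) f \<le> limsup (\<lambda>n. ereal (X n / real n))"
      using Limsup_mono[OF fU] Limsup_compose_le(1)[OF \<phi>, of U] XU(1) by simp
    show "limsup (\<lambda>n. ereal (X n / real n)) \<le> Limsup (at_right 0) f"
      using Limsup_compose_le(1)[OF pw, of f] unfolding fX .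
  qed
  moreover have "Liminf (at_right 0) f = liminf (\<lambda>n. ereal (X n / real n))"
  proof (rule antisym)
    show "Liminf (at_right 0) f \<le> liminf (\<lambda>n. ereal (X n / real n))"
      using Limsup_compose_le(2)[OF pw, of f] unfolding fX .
    show "liminf (\<lambda>n. ereal (X n / real n)) \<le> Liminf (at_right 0) f"
      using Liminf_mono[OF fV] Limsup_compose_le(2)[OF \<phi>, of V] XV(2) by simp
  qed
  ultimately show "Limsup (at_right 0) (\<lambda>x. ereal (ln (H x) / ln x)) = limsup (\<lambda>n. ereal (ln (H (r ^ n)) / ln r / real n))"
    "Liminf (at_right 0) (\<lambda>x. ereal (ln (H x) / ln x)) = liminf (\<lambda>n. ereal (ln (H (r ^ n)) / ln r / real n))"
    unfolding f_def X_def by auto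
qed

section \<open>The attractor and the translations\<close>

context ifs
begin

lemma K_subset: "K \<subseteq> {0..1}"
  using hull_subset[of K convex] K_hull by simp

lemma zero_in_K: "0 \<in> K" and one_in_K: "1 \<in> K"
proof -
  obtain a where a: "a \<in> K" "\<And>t. t \<in> K \<Longrightarrow> a \<le> t"
    using compact_attains_inf[OF K_compact K_nonempty] by blast
  obtain b where b: "b \<in> K" "\<And>t. t \<in> K \<Longrightarrow> t \<le> b"
    using compact_attains_sup[OF K_compact K_nonempty] by blast
  have "convex hull K \<subseteq> {a..b}"
    using a b by (intro hull_minimal) auto
  hence "{0..1} \<subseteq> {a..b}" using K_hull by simp
  hence "a \<le> 0" "1 \<le> b" by auto
  with K_subset a b have "a = 0" "b = 1" by fastforce+
  with a b show "0 \<in> K" "1 \<in> K" by auto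
qed

lemma rho_pos [simp]: "0 < \<rho>" "0 \<le> \<rho>" "\<rho> \<noteq> 0" "0 < \<rho> ^ n" "0 \<le> \<rho> ^ n" "\<rho> ^ n \<noteq> 0"
  using ratio by auto

lemma S_in_K: "x \<in> K \<Longrightarrow> j \<le> m \<Longrightarrow> \<rho> * x + d j \<in> K"
  using K_invariant by blast

lemma d_le: "j \<le> m \<Longrightarrow> 0 \<le> d j" "j \<le> m \<Longrightarrow> d j \<le> d m"
proof -
  have mono: "d i \<le> d j" if "i \<le> j" "j \<le> m" for i j
    using strict_mono_onD[OF d_mono, of i j] that by (cases "i = j") auto
  show "j \<le> m \<Longrightarrow> 0 \<le> d j" using mono[of 0 j] d_0 by simp
  show "j \<le> m \<Longrightarrow> d j \<le> d m" using mono[of j m] by simp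
qed

lemma d_inj: "i \<le> m \<Longrightarrow> j \<le> m \<Longrightarrow> d i = d j \<Longrightarrow> i = j"
  using strict_mono_onD[OF d_mono, of i j] strict_mono_onD[OF d_mono, of j i]
  by (cases i j rule: linorder_cases) auto

text \<open>The normalization of the hull enters here: 1 lies in some image of \<open>K\<close>, and
  no image reaches beyond \<open>\<rho> + d m\<close>. So the last map fixes 1, as the first one
  fixes 0.\<close>

lemma d_last: "d m = 1 - \<rho>"
proof (rule antisym)
  have "\<rho> * 1 + d m \<in> K" using S_in_K[OF one_in_K, of m] by simp
  thus "d m \<le> 1 - \<rho>" using K_subset by auto
  have "1 \<in> (\<Union>j\<le>m. (\<lambda>x. \<rho> * x + d j) ` K)" using one_in_K K_invariant by simp
  then obtain j x where "j \<le> m" "x \<in> K" "1 = \<rho> * x + d j" by blast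
  moreover have "\<rho> * x \<le> \<rho> * 1" using \<open>x \<in> K\<close> K_subset by (intro mult_left_mono) auto
  ultimately show "1 - \<rho> \<le> d m" using d_le(2)[of j] by linarith
qed

subsection \<open>Words and cylinders\<close>

lemma S_word_Nil [simp]: "S_word [] x = x"
  and S_word_Cons [simp]: "S_word (j # \<sigma>) x = \<rho> * S_word \<sigma> x + d j"
  by (simp_all add: S_word_def S_def)

lemma S_word_append: "S_word (\<sigma> @ \<tau>) x = S_word \<sigma> (S_word \<tau> x)"
  by (induction \<sigma>) auto

lemma S_word_affine: "S_word \<sigma> x = S_word \<sigma> 0 + \<rho> ^ length \<sigma> * x"
  by (induction \<sigma>) (auto simp: algebra_simps)

lemma S_word_append_0: "S_word (\<sigma> @ \<tau>) 0 = S_word \<sigma> 0 + \<rho> ^ length \<sigma> * S_word \<tau> 0"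
  by (metis S_word_append S_word_affine)

lemma length_words: "\<sigma> \<in> words n \<Longrightarrow> length \<sigma> = n"
  by (simp add: words_def)

lemma words_0 [simp]: "words 0 = {[]}"
  by (auto simp: words_def)

lemma finite_words [simp]: "finite (words n)"
  using finite_lists_length_eq[of "{..m}" n] by (simp add: words_def conj_commute)

lemma words_append: "words (n + k) = (\<lambda>(\<sigma>, \<tau>). \<sigma> @ \<tau>) ` (words n \<times> words k)"
proof (intro equalityI subsetI)
  fix \<sigma> assume "\<sigma> \<in> words (n + k)"
  hence "take n \<sigma> \<in> words n" "drop n \<sigma> \<in> words k"
    using set_take_subset[of n \<sigma>] set_drop_subset[of n \<sigma>] by (auto simp: words_def)
  thus "\<sigma> \<in> (\<lambda>(\<sigma>, \<tau>). \<sigma> @ \<tau>) ` (words n \<times> words k)"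
    by (intro image_eqI[of _ _ "(take n \<sigma>, drop n \<sigma>)"]) auto
qed (auto simp: words_def)

lemma words_append_inj: "inj_on (\<lambda>(\<sigma>, \<tau>). \<sigma> @ \<tau>) (words n \<times> words k)"
  by (auto simp: inj_on_def words_def)

lemma words_1: "words (Suc 0) = (\<lambda>j. [j]) ` {..m}"
  by (auto simp: words_def length_Suc_conv)

text \<open>The cylinder \<open>S\<^sub>\<sigma>[0, 1]\<close> of a word of length \<open>n\<close> is \<open>[t, t + \<rho>\<^sup>n]\<close> with \<open>t = S\<^sub>\<sigma>(0)\<close>.\<close>

definition pts :: "nat \<Rightarrow> real set" where
  "pts n = (\<lambda>\<sigma>. S_word \<sigma> 0) ` words n"

lemma finite_pts [simp]: "finite (pts n)"
  by (simp add: pts_def)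

lemma pts_0 [simp]: "pts 0 = {0}"
  by (simp add: pts_def)

lemma pts_1: "pts (Suc 0) = d ` {..m}"
  by (auto simp: pts_def words_1 image_iff)

lemma pts_add: "pts (n + k) = {s + \<rho> ^ n * t | s t. s \<in> pts n \<and> t \<in> pts k}"
  unfolding pts_def words_append
  by (auto simp: S_word_append_0 length_words image_iff) blast+

lemma pts_addI: "s \<in> pts n \<Longrightarrow> t \<in> pts k \<Longrightarrow> s + \<rho> ^ n * t \<in> pts (n + k)"
  by (auto simp: pts_add)

lemma pts_addE:
  assumes "u \<in> pts (n + k)"
  obtains s t where "s \<in> pts n" "t \<in> pts k" "u = s + \<rho> ^ n * t"
  using assms by (auto simp: pts_add)

lemma pts_SucE:
  assumes "u \<in> pts (Suc n)"
  obtains s j where "s \<in> pts n" "j \<le> m" "u = s + \<rho> ^ n * d j"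
proof -
  have "u \<in> pts (n + Suc 0)" using assms by simp
  then obtain s t where "s \<in> pts n" "t \<in> pts (Suc 0)" "u = s + \<rho> ^ n * t" by (rule pts_addE)
  thus ?thesis using that by (auto simp: pts_1)
qed

lemma cylinder_subset_K: "t \<in> pts n \<Longrightarrow> x \<in> K \<Longrightarrow> t + \<rho> ^ n * x \<in> K"
proof (induction n arbitrary: t x)
  case (Suc n)
  from Suc.prems obtain s j where s: "s \<in> pts n" "j \<le> m" "t = s + \<rho> ^ n * d j"
    by (auto elim: pts_SucE)
  have "s + \<rho> ^ n * (\<rho> * x + d j) \<in> K" using s Suc S_in_K by blast
  thus ?case by (simp add: s algebra_simps)
qed auto

lemma K_in_cylinder: "x \<in> K \<Longrightarrow> \<exists>t\<in>pts n. \<exists>y\<in>K. x = t + \<rho> ^ n * y"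
proof (induction n)
  case (Suc n)
  then obtain t y where t: "t \<in> pts n" "y \<in> K" "x = t + \<rho> ^ n * y" by blast
  obtain j z where j: "j \<le> m" "z \<in> K" "y = \<rho> * z + d j" using t(2) K_invariant by blast
  have "t + \<rho> ^ n * d j \<in> pts (n + Suc 0)" using t j by (intro pts_addI) (auto simp: pts_1)
  moreover have "x = (t + \<rho> ^ n * d j) + \<rho> ^ Suc n * z" using t j by (simp add: algebra_simps)
  ultimately show ?case using j by auto
qed auto

lemma zero_in_pts: "0 \<in> pts n"
proof (induction n)
  case (Suc n)
  have "0 + \<rho> ^ n * 0 \<in> pts (n + Suc 0)" using Suc d_0 by (intro pts_addI) (auto simp: pts_1 image_iff intro!: bexI[of _ 0])
  thus ?case by simp
qed auto

lemma last_in_pts: "1 - \<rho> ^ n \<in> pts n"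
proof (induction n)
  case (Suc n)
  have "1 - \<rho> ^ n + \<rho> ^ n * d m \<in> pts (n + Suc 0)" using Suc by (intro pts_addI) (auto simp: pts_1)
  thus ?case by (simp add: d_last algebra_simps)
qed auto

lemma pts_in_K: "t \<in> pts n \<Longrightarrow> t \<in> K" "t \<in> pts n \<Longrightarrow> t + \<rho> ^ n \<in> K"
  using cylinder_subset_K[of t n 0] cylinder_subset_K[of t n 1] zero_in_K one_in_K by auto

lemma pts_bounds: "t \<in> pts n \<Longrightarrow> 0 \<le> t" "t \<in> pts n \<Longrightarrow> t + \<rho> ^ n \<le> 1"
  using pts_in_K[of t n] K_subset by auto

lemma pts_left: "t \<in> pts n \<Longrightarrow> t \<in> pts (n + k)"
  using pts_addI[of t n 0 k] zero_in_pts by simp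

lemma pts_right: "t \<in> pts n \<Longrightarrow> t + \<rho> ^ n - \<rho> ^ (n + k) \<in> pts (n + k)"
  using pts_addI[of t n "1 - \<rho> ^ k" k] last_in_pts by (simp add: algebra_simps power_add)

lemma cylinder_nested:
  assumes "t \<in> pts k" shows "s \<le> s + \<rho> ^ n * t" "s + \<rho> ^ n * t + \<rho> ^ (n + k) \<le> s + \<rho> ^ n"
proof -
  show "s \<le> s + \<rho> ^ n * t" using pts_bounds(1)[OF assms] by simp
  have "\<rho> ^ n * (t + \<rho> ^ k) \<le> \<rho> ^ n * 1" using pts_bounds(2)[OF assms] by (intro mult_left_mono) auto
  thus "s + \<rho> ^ n * t + \<rho> ^ (n + k) \<le> s + \<rho> ^ n" by (simp add: algebra_simps power_add)
qed

lemma endpoints_eq: "endpoints n = pts n \<union> (\<lambda>t. t + \<rho> ^ n) ` pts n"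
  unfolding endpoints_def pts_def
  by (auto simp: length_words S_word_affine[of _ 1])

lemma finite_endpoints [simp]: "finite (endpoints n)"
  by (simp add: endpoints_eq)

lemma endpoints_mono: "endpoints n \<subseteq> endpoints (n + k)"
proof
  fix x assume "x \<in> endpoints n"
  then consider "x \<in> pts n" | t where "t \<in> pts n" "x = t + \<rho> ^ n" by (auto simp: endpoints_eq)
  thus "x \<in> endpoints (n + k)"
  proof cases
    case 2
    \<comment> \<open>Since the last map fixes 1, the rightmost subcylinder of depth
      \<open>k\<close> ends at the same point.\<close>
    hence "x = (t + \<rho> ^ n - \<rho> ^ (n + k)) + \<rho> ^ (n + k)" "t + \<rho> ^ n - \<rho> ^ (n + k) \<in> pts (n + k)"
      using pts_right by auto
    thus ?thesis unfolding endpoints_eq by blast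
  qed (auto simp: endpoints_eq intro: pts_left)
qed

lemma endpoints_mono_le: "n \<le> n' \<Longrightarrow> endpoints n \<subseteq> endpoints n'"
  using endpoints_mono[of n "n' - n"] by simp

lemma zero_one_endpoints: "0 \<in> endpoints n" "1 \<in> endpoints n"
  using zero_in_pts last_in_pts[of n] by (auto simp: endpoints_eq image_iff intro!: bexI[of _ "1 - \<rho> ^ n"])

subsection \<open>Net intervals\<close>

text \<open>Level 0 is defined separately; the general description holds for it too, which lets the
  later arguments treat all levels alike.\<close>

lemma net_iff:
  "\<Delta> \<in> net_intervals n \<longleftrightarrow>
    fst \<Delta> \<in> endpoints n \<and> snd \<Delta> \<in> endpoints n \<and> fst \<Delta> < snd \<Delta> \<and>
    {fst \<Delta><..<snd \<Delta>} \<inter> endpoints n = {} \<and> {fst \<Delta><..<snd \<Delta>} \<inter> K \<noteq> {}"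
proof (cases "n = 0")
  case True
  have e: "endpoints 0 = {0, 1}" by (auto simp: endpoints_eq)
  \<comment> \<open>The image of 1 under the first map is a point of \<open>K\<close> strictly
    between 0 and 1.\<close>
  have "\<rho> \<in> K" using S_in_K[OF one_in_K, of 0] d_0 by simp
  hence "\<rho> \<in> {0<..<1} \<inter> K" using ratio by auto
  hence ne: "{0<..<1} \<inter> K \<noteq> {}" by blast
  show ?thesis
  proof
    assume "\<Delta> \<in> net_intervals n"
    hence "\<Delta> = (0, 1)" using True by (simp add: net_intervals_def)
    thus "fst \<Delta> \<in> endpoints n \<and> snd \<Delta> \<in> endpoints n \<and> fst \<Delta> < snd \<Delta> \<and>
      {fst \<Delta><..<snd \<Delta>} \<inter> endpoints n = {} \<and> {fst \<Delta><..<snd \<Delta>} \<inter> K \<noteq> {}"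
      using ne by (simp add: True e)
  qed (use True e in \<open>auto simp: net_intervals_def prod_eq_iff\<close>)
qed (auto simp: net_intervals_def)

lemma net_less: "\<Delta> \<in> net_intervals n \<Longrightarrow> fst \<Delta> < snd \<Delta>"
  by (simp add: net_iff)

lemma finite_net [simp]: "finite (net_intervals n)"
  by (rule finite_subset[of _ "endpoints n \<times> endpoints n"]) (auto simp: net_iff mem_Times_iff)

definition inside :: "ivl \<Rightarrow> ivl \<Rightarrow> bool" where
  "inside \<Delta>' \<Delta> \<longleftrightarrow> fst \<Delta> \<le> fst \<Delta>' \<and> snd \<Delta>' \<le> snd \<Delta>"

lemma inside_refl [simp]: "inside \<Delta> \<Delta>"
  by (simp add: inside_def)

lemma inside_trans: "inside \<Delta>1 \<Delta>2 \<Longrightarrow> inside \<Delta>2 \<Delta>3 \<Longrightarrow> inside \<Delta>1 \<Delta>3"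
  by (auto simp: inside_def)

lemma ivl_set_subset_iff: "fst \<Delta>' < snd \<Delta>' \<Longrightarrow> ivl_set \<Delta>' \<subseteq> ivl_set \<Delta> \<longleftrightarrow> inside \<Delta>' \<Delta>"
  by (auto simp: inside_def)

lemma parent_iff:
  "parent n \<Delta>' \<Delta> \<longleftrightarrow> \<Delta>' \<in> net_intervals n \<and> \<Delta> \<in> net_intervals (Suc n) \<and> inside \<Delta> \<Delta>'"
  using ivl_set_subset_iff net_less unfolding parent_def by blast

lemma net_around:
  assumes "z \<in> K" "z \<notin> endpoints n"
  obtains \<Delta> where "\<Delta> \<in> net_intervals n" "fst \<Delta> < z" "z < snd \<Delta>"
proof -
  have z: "0 < z" "z < 1"
    using assms zero_one_endpoints[of n] K_subset
    by (metis atLeastAtMost_iff less_eq_real_def subsetD)+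
  define A where "A = {x \<in> endpoints n. x < z}"
  define B where "B = {x \<in> endpoints n. z < x}"
  have A: "finite A" "A \<noteq> {}" and B: "finite B" "B \<noteq> {}"
    using zero_one_endpoints[of n] z by (auto simp: A_def B_def)
  have a: "Max A \<in> A" and b: "Min B \<in> B" using A B by auto
  have "x \<notin> endpoints n" if "Max A < x" "x < Min B" for x
  proof
    assume x: "x \<in> endpoints n"
    show False
    proof (cases x z rule: linorder_cases)
      case less
      hence "x \<in> A" using x by (simp add: A_def)
      thus False using that A(1) Max_ge[of A x] by linarith
    next
      case equal thus False using x assms by simp
    next
      case greater
      hence "x \<in> B" using x by (simp add: B_def)
      thus False using that B(1) Min_le[of B x] by linarith
    qed
  qed
  moreover have "Max A < z" "z < Min B" "Max A \<in> endpoints n" "Min B \<in> endpoints n" using a b by (auto simp: A_def B_def)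
  ultimately have "(Max A, Min B) \<in> net_intervals n" using assms
    unfolding net_iff fst_conv snd_conv by force
  thus ?thesis using that[of "(Max A, Min B)"] \<open>Max A < z\<close> \<open>z < Min B\<close> by simp
qed

lemma net_unique:
  assumes "\<Delta> \<in> net_intervals n" "\<Delta>' \<in> net_intervals n"
    and "fst \<Delta> < z" "z < snd \<Delta>" "fst \<Delta>' < z" "z < snd \<Delta>'"
  shows "\<Delta> = \<Delta>'"
proof -
  have "fst \<Delta> \<notin> {fst \<Delta>'<..<snd \<Delta>'}" "fst \<Delta>' \<notin> {fst \<Delta><..<snd \<Delta>}"
    "snd \<Delta> \<notin> {fst \<Delta>'<..<snd \<Delta>'}" "snd \<Delta>' \<notin> {fst \<Delta><..<snd \<Delta>}"
    using assms(1,2) unfolding net_iff by blast+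
  thus ?thesis using assms by (auto simp: prod_eq_iff)
qed

text \<open>Both ends of the cylinder are endpoints of its level, hence outside the open net
  interval; a cylinder that meets this interior must cover it.\<close>

lemma net_cover:
  assumes "\<Delta> \<in> net_intervals n" "t \<in> pts n" "fst \<Delta> < t + \<rho> ^ n" "t < snd \<Delta>"
  shows "t \<le> fst \<Delta>" "snd \<Delta> \<le> t + \<rho> ^ n"
proof -
  have "t \<in> endpoints n" "t + \<rho> ^ n \<in> endpoints n" using assms by (auto simp: endpoints_eq)
  hence "t \<notin> {fst \<Delta><..<snd \<Delta>}" "t + \<rho> ^ n \<notin> {fst \<Delta><..<snd \<Delta>}" using assms unfolding net_iff by blast+
  thus "t \<le> fst \<Delta>" "snd \<Delta> \<le> t + \<rho> ^ n" using assms by auto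
qed

lemma net_point:
  assumes "\<Delta> \<in> net_intervals n"
  obtains z where "z \<in> K" "fst \<Delta> < z" "z < snd \<Delta>" "z \<notin> endpoints n"
proof -
  obtain z where z: "z \<in> {fst \<Delta><..<snd \<Delta>}" "z \<in> K" using assms unfolding net_iff by blast
  moreover from z(1) have "z \<notin> endpoints n" using assms unfolding net_iff by blast
  ultimately show ?thesis using that by auto
qed

text \<open>The points \<open>t + \<rho> ^ n * \<rho> ^ k\<close> belong to \<open>K\<close> and
  decrease to \<open>t\<close>, so no gap of \<open>K\<close> begins at \<open>t\<close>. Thus every
  cylinder contains a net interval starting at its left end.\<close>

lemma net_left:
  assumes "t \<in> pts n"
  obtains b where "(t, b) \<in> net_intervals n" "b \<le> t + \<rho> ^ n"
proof -
  define B where "B = {x \<in> endpoints n. t < x}"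
  have "t + \<rho> ^ n \<in> B" using assms by (auto simp: B_def endpoints_eq)
  hence B: "finite B" "B \<noteq> {}" by (auto simp: B_def)
  define b where "b = Min B"
  have b: "b \<in> B" "b \<le> t + \<rho> ^ n" using B \<open>t + \<rho> ^ n \<in> B\<close> by (auto simp: b_def)
  have none: "x \<notin> endpoints n" if "t < x" "x < b" for x
    using that B Min_le[of B x] by (force simp: B_def b_def)
  have "(\<lambda>k. t + \<rho> ^ n * \<rho> ^ k) \<longlonglongrightarrow> t + \<rho> ^ n * 0"
    using ratio by (intro tendsto_intros LIMSEQ_realpow_zero) auto
  hence "eventually (\<lambda>k. t + \<rho> ^ n * \<rho> ^ k < b) sequentially"
    using b by (intro order_tendstoD(2)) (auto simp: B_def)
  then obtain k where k: "t + \<rho> ^ n * \<rho> ^ k < b" by (auto simp: eventually_sequentially)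
  have "0 + \<rho> ^ k \<in> K" using pts_in_K(2)[OF zero_in_pts] by blast
  hence "t + \<rho> ^ n * \<rho> ^ k \<in> K" using cylinder_subset_K assms by simp
  moreover have "t + \<rho> ^ n * \<rho> ^ k \<in> {t<..<b}" using k by simp
  ultimately have "{t<..<b} \<inter> K \<noteq> {}" by blast
  moreover have "t \<in> endpoints n" "b \<in> endpoints n" "t < b"
    using b assms by (auto simp: B_def endpoints_eq)
  moreover have "{t<..<b} \<inter> endpoints n = {}" using none by auto
  ultimately have "(t, b) \<in> net_intervals n" by (simp add: net_iff)
  thus ?thesis using b that by blast
qed

lemma net_inside_if_meet:
  assumes "\<Delta>' \<in> net_intervals (n + k)" "\<Delta> \<in> net_intervals n"
    and "fst \<Delta> < z" "z < snd \<Delta>" "fst \<Delta>' < z" "z < snd \<Delta>'"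
  shows "inside \<Delta>' \<Delta>"
proof -
  have "fst \<Delta> \<in> endpoints (n + k)" "snd \<Delta> \<in> endpoints (n + k)"
    using assms(2) endpoints_mono[of n k] by (auto simp: net_iff)
  hence "fst \<Delta> \<notin> {fst \<Delta>'<..<snd \<Delta>'}" "snd \<Delta> \<notin> {fst \<Delta>'<..<snd \<Delta>'}"
    using assms(1) unfolding net_iff by blast+
  thus ?thesis using assms by (auto simp: inside_def)
qed

lemma ancestor:
  assumes "\<Delta>' \<in> net_intervals (n + k)"
  obtains \<Delta> where "\<Delta> \<in> net_intervals n" "inside \<Delta>' \<Delta>"
proof -
  obtain z where z: "z \<in> K" "fst \<Delta>' < z" "z < snd \<Delta>'" "z \<notin> endpoints (n + k)"
    using net_point[OF assms] .
  moreover from z have "z \<notin> endpoints n" using endpoints_mono by blast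
  then obtain \<Delta> where "\<Delta> \<in> net_intervals n" "fst \<Delta> < z" "z < snd \<Delta>" using net_around z(1) by metis
  ultimately show ?thesis using that net_inside_if_meet assms by blast
qed

lemma ancestor_unique:
  assumes "\<Delta>' \<in> net_intervals k" "\<Delta>1 \<in> net_intervals n" "\<Delta>2 \<in> net_intervals n"
    and "inside \<Delta>' \<Delta>1" "inside \<Delta>' \<Delta>2"
  shows "\<Delta>1 = \<Delta>2"
proof -
  have "fst \<Delta>' < (fst \<Delta>' + snd \<Delta>') / 2" "(fst \<Delta>' + snd \<Delta>') / 2 < snd \<Delta>'" using net_less[OF assms(1)] by auto
  thus ?thesis using assms by (intro net_unique[of \<Delta>1 n \<Delta>2 "(fst \<Delta>' + snd \<Delta>') / 2"]) (auto simp: inside_def)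
qed

text \<open>The neighbours of \<open>\<Delta>\<close> are the normalized distances from the points of \<open>nb n \<Delta>\<close> to the left
  endpoint of \<open>\<Delta>\<close>.\<close>

definition nb :: "nat \<Rightarrow> ivl \<Rightarrow> real set" where
  "nb n \<Delta> = {t \<in> pts n. t \<le> fst \<Delta> \<and> snd \<Delta> \<le> t + \<rho> ^ n}"

lemma finite_nb [simp]: "finite (nb n \<Delta>)"
  by (simp add: nb_def)

lemma S_word_image: "\<sigma> \<in> words n \<Longrightarrow> S_word \<sigma> ` {0..1} = {S_word \<sigma> 0..S_word \<sigma> 0 + \<rho> ^ n}"
proof -
  assume "\<sigma> \<in> words n"
  hence *: "S_word \<sigma> x = \<rho> ^ n * x + S_word \<sigma> 0" for x
    using S_word_affine[of \<sigma> x] by (simp add: length_words)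
  have "S_word \<sigma> ` {0..1} = (\<lambda>x. \<rho> ^ n * x + S_word \<sigma> 0) ` {0..1}"
    by (rule image_cong[OF refl], rule *)
  also have "\<dots> = {S_word \<sigma> 0..S_word \<sigma> 0 + \<rho> ^ n}"
    by (subst image_affinity_atLeastAtMost) (auto simp: add.commute)
  finally show ?thesis .
qed

lemma neighbours_eq:
  assumes "fst \<Delta> < snd \<Delta>"
  shows "neighbours n \<Delta> = sorted_list_of_set ((\<lambda>t. (fst \<Delta> - t) / \<rho> ^ n) ` nb n \<Delta>)"
proof -
  have "\<sigma> \<in> words n \<and> ivl_set \<Delta> \<subseteq> S_word \<sigma> ` {0..1} \<longleftrightarrow>
      \<sigma> \<in> words n \<and> S_word \<sigma> 0 \<le> fst \<Delta> \<and> snd \<Delta> \<le> S_word \<sigma> 0 + \<rho> ^ n" for \<sigma>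
    using assms by (auto simp: S_word_image)
  hence "{(fst \<Delta> - S_word \<sigma> 0) / \<rho> ^ n | \<sigma>. \<sigma> \<in> words n \<and> ivl_set \<Delta> \<subseteq> S_word \<sigma> ` {0..1}} =
    {(fst \<Delta> - S_word \<sigma> 0) / \<rho> ^ n | \<sigma>.
      \<sigma> \<in> words n \<and> S_word \<sigma> 0 \<le> fst \<Delta> \<and> snd \<Delta> \<le> S_word \<sigma> 0 + \<rho> ^ n}"
    by presburger
  also have "\<dots> = (\<lambda>t. (fst \<Delta> - t) / \<rho> ^ n) ` nb n \<Delta>"
    unfolding nb_def pts_def by blast
  finally show ?thesis by (simp add: neighbours_def)
qed

lemma set_neighbours: "fst \<Delta> < snd \<Delta> \<Longrightarrow> set (neighbours n \<Delta>) = (\<lambda>t. (fst \<Delta> - t) / \<rho> ^ n) ` nb n \<Delta>"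
  by (simp add: neighbours_eq)

lemma distinct_neighbours: "fst \<Delta> < snd \<Delta> \<Longrightarrow> distinct (neighbours n \<Delta>)"
  by (simp add: neighbours_eq)

lemma nb_nonempty:
  assumes "\<Delta> \<in> net_intervals n" shows "nb n \<Delta> \<noteq> {}"
proof -
  obtain z where z: "z \<in> K" "fst \<Delta> < z" "z < snd \<Delta>" using net_point[OF assms] .
  obtain t y where t: "t \<in> pts n" "y \<in> K" "z = t + \<rho> ^ n * y" using K_in_cylinder[OF z(1)] by blast
  have "0 \<le> \<rho> ^ n * y" "\<rho> ^ n * y \<le> \<rho> ^ n * 1" using t K_subset by (auto intro!: mult_left_mono)
  hence "t \<le> z" "z \<le> t + \<rho> ^ n" using t(3) by linarith+
  hence "fst \<Delta> < t + \<rho> ^ n" "t < snd \<Delta>" using z by linarith+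
  hence "t \<in> nb n \<Delta>" using net_cover[OF assms t(1)] t(1) by (auto simp: nb_def)
  thus ?thesis by blast
qed

text \<open>The prefix cylinder is larger, so it still covers the descendant; it therefore meets the
  interior of the ancestor and covers it by \<open>net_cover\<close>.\<close>

lemma nb_parent:
  assumes "\<Delta> \<in> net_intervals n" "\<Delta>' \<in> net_intervals (n + k)" "inside \<Delta>' \<Delta>"
    and "s \<in> pts n" "t \<in> pts k" "s + \<rho> ^ n * t \<in> nb (n + k) \<Delta>'"
  shows "s \<in> nb n \<Delta>"
proof -
  have "s \<le> fst \<Delta>'" "snd \<Delta>' \<le> s + \<rho> ^ n"
    using assms cylinder_nested[OF assms(5), of s n] by (auto simp: nb_def)
  hence "fst \<Delta> < s + \<rho> ^ n" "s < snd \<Delta>"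
    using assms net_less[OF assms(2)] by (auto simp: inside_def)
  thus ?thesis using net_cover[OF assms(1,4)] assms(4) by (simp add: nb_def)
qed

subsection \<open>Net intervals of the same type\<close>

text \<open>The position is left out on purpose: length and neighbours already determine the
  cylinders, endpoints and points of \<open>K\<close> inside the interval up to scaling. The
  position only distinguishes siblings.\<close>

definition same_type :: "nat \<Rightarrow> ivl \<Rightarrow> nat \<Rightarrow> ivl \<Rightarrow> bool" where
  "same_type n \<Delta> n' \<Delta>' \<longleftrightarrow> \<Delta> \<in> net_intervals n \<and> \<Delta>' \<in> net_intervals n' \<and>
     norm_length n \<Delta> = norm_length n' \<Delta>' \<and> neighbours n \<Delta> = neighbours n' \<Delta>'"

text \<open>The affine map that carries \<open>\<Delta>\<close> to \<open>\<Delta>'\<close> if they have the same type.\<close>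

definition tr :: "nat \<Rightarrow> ivl \<Rightarrow> nat \<Rightarrow> ivl \<Rightarrow> real \<Rightarrow> real" where
  "tr n \<Delta> n' \<Delta>' x = fst \<Delta>' + \<rho> ^ n' * ((x - fst \<Delta>) / \<rho> ^ n)"

definition tri :: "nat \<Rightarrow> ivl \<Rightarrow> nat \<Rightarrow> ivl \<Rightarrow> ivl \<Rightarrow> ivl" where
  "tri n \<Delta> n' \<Delta>' \<Delta>1 = (tr n \<Delta> n' \<Delta>' (fst \<Delta>1), tr n \<Delta> n' \<Delta>' (snd \<Delta>1))"

lemma same_type_sym: "same_type n \<Delta> n' \<Delta>' \<Longrightarrow> same_type n' \<Delta>' n \<Delta>"
  by (simp add: same_type_def)

lemma same_type_char:
  "\<Delta> \<in> net_intervals n \<Longrightarrow> \<Delta>' \<in> net_intervals n' \<Longrightarrow> char_vec n \<Delta> = char_vec n' \<Delta>' \<Longrightarrow>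
    same_type n \<Delta> n' \<Delta>'"
  by (simp add: same_type_def char_vec_def)

lemma tr_inverse [simp]: "tr n' \<Delta>' n \<Delta> (tr n \<Delta> n' \<Delta>' x) = x"
  by (simp add: tr_def)

lemma tri_inverse [simp]: "tri n' \<Delta>' n \<Delta> (tri n \<Delta> n' \<Delta>' \<Delta>1) = \<Delta>1"
  by (simp add: tri_def)

lemma tr_less_iff [simp]: "tr n \<Delta> n' \<Delta>' x < tr n \<Delta> n' \<Delta>' y \<longleftrightarrow> x < y"
  unfolding tr_def add_less_cancel_left mult_less_cancel_left_pos[OF rho_pos(4)]
    divide_less_cancel using rho_pos(4)[of n] by linarith

lemma tr_le_iff [simp]: "tr n \<Delta> n' \<Delta>' x \<le> tr n \<Delta> n' \<Delta>' y \<longleftrightarrow> x \<le> y"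
  using tr_less_iff[of n \<Delta> n' \<Delta>' y x] by linarith

lemma tr_fst: "tr n \<Delta> n' \<Delta>' (fst \<Delta>) = fst \<Delta>'"
  by (simp add: tr_def)

lemma tr_snd: "same_type n \<Delta> n' \<Delta>' \<Longrightarrow> tr n \<Delta> n' \<Delta>' (snd \<Delta>) = snd \<Delta>'"
  by (simp add: tr_def same_type_def norm_length_def)

lemma fst_tri [simp]: "fst (tri n \<Delta> n' \<Delta>' \<Delta>1) = tr n \<Delta> n' \<Delta>' (fst \<Delta>1)"
  and snd_tri [simp]: "snd (tri n \<Delta> n' \<Delta>' \<Delta>1) = tr n \<Delta> n' \<Delta>' (snd \<Delta>1)"
  by (simp_all add: tri_def)

lemma tri_self: "same_type n \<Delta> n' \<Delta>' \<Longrightarrow> tri n \<Delta> n' \<Delta>' \<Delta> = \<Delta>'"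
  by (simp add: tri_def tr_fst tr_snd)

lemma tr_diff: "tr n \<Delta> n' \<Delta>' y - tr n \<Delta> n' \<Delta>' x = \<rho> ^ n' * ((y - x) / \<rho> ^ n)"
  by (simp add: tr_def diff_divide_distrib right_diff_distrib)

lemma tr_add_power: "tr n \<Delta> n' \<Delta>' (x + \<rho> ^ (n + k)) = tr n \<Delta> n' \<Delta>' x + \<rho> ^ (n' + k)"
  using tr_diff[of n \<Delta> n' \<Delta>' "x + \<rho> ^ (n + k)" x] by (simp add: power_add)

lemma tr_norm_diff:
  "(tr n \<Delta> n' \<Delta>' y - tr n \<Delta> n' \<Delta>' x) / \<rho> ^ (n' + k) = (y - x) / \<rho> ^ (n + k)"
  by (simp add: tr_diff power_add)

lemma tr_tri: "tr (n + k) \<Delta>1 (n' + k) (tri n \<Delta> n' \<Delta>' \<Delta>1) = tr n \<Delta> n' \<Delta>'"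
proof
  fix x
  have "tr n \<Delta> n' \<Delta>' x - tr n \<Delta> n' \<Delta>' (fst \<Delta>1) = \<rho> ^ (n' + k) * ((x - fst \<Delta>1) / \<rho> ^ (n + k))"
    by (simp add: tr_diff power_add)
  thus "tr (n + k) \<Delta>1 (n' + k) (tri n \<Delta> n' \<Delta>' \<Delta>1) x = tr n \<Delta> n' \<Delta>' x"
    by (simp add: tr_def[of "n + k"])
qed

lemma tri_inside: "same_type n \<Delta> n' \<Delta>' \<Longrightarrow> inside \<Delta>1 \<Delta> \<Longrightarrow> inside (tri n \<Delta> n' \<Delta>' \<Delta>1) \<Delta>'"
  using tr_fst[of n \<Delta> n' \<Delta>'] tr_snd[of n \<Delta> n' \<Delta>'] unfolding inside_def
  by (metis fst_tri snd_tri tr_le_iff)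

lemma tr_nb:
  assumes "same_type n \<Delta> n' \<Delta>'" "s \<in> nb n \<Delta>" shows "tr n \<Delta> n' \<Delta>' s \<in> nb n' \<Delta>'"
proof -
  have l: "fst \<Delta> < snd \<Delta>" "fst \<Delta>' < snd \<Delta>'" using assms(1) net_less by (auto simp: same_type_def)
  have "(fst \<Delta> - s) / \<rho> ^ n \<in> (\<lambda>t. (fst \<Delta> - t) / \<rho> ^ n) ` nb n \<Delta>" using assms by blast
  also have "\<dots> = (\<lambda>t. (fst \<Delta>' - t) / \<rho> ^ n') ` nb n' \<Delta>'"
    using assms(1) set_neighbours[OF l(1), of n] set_neighbours[OF l(2), of n'] by (simp add: same_type_def)
  finally obtain s' where s': "s' \<in> nb n' \<Delta>'" "(fst \<Delta> - s) / \<rho> ^ n = (fst \<Delta>' - s') / \<rho> ^ n'" by blast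
  have "tr n \<Delta> n' \<Delta>' s = fst \<Delta>' - \<rho> ^ n' * ((fst \<Delta> - s) / \<rho> ^ n)"
    by (simp add: tr_def diff_divide_distrib algebra_simps)
  also have "\<dots> = s'" using s' by simp
  finally show ?thesis using s' by simp
qed

lemma tr_affine: "tr n \<Delta> n' \<Delta>' (s + \<rho> ^ n * u) = tr n \<Delta> n' \<Delta>' s + \<rho> ^ n' * u"
  by (simp add: tr_def add_divide_distrib diff_divide_distrib algebra_simps)

lemma pts_over_nb:
  assumes "\<Delta> \<in> net_intervals n" "t \<in> pts (n + k)" "t < snd \<Delta>" "fst \<Delta> < t + \<rho> ^ (n + k)"
  obtains s u where "s \<in> nb n \<Delta>" "u \<in> pts k" "t = s + \<rho> ^ n * u"
proof -
  obtain s u where s: "s \<in> pts n" "u \<in> pts k" "t = s + \<rho> ^ n * u" using pts_addE[OF assms(2)] .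
  have "s \<le> t" "t + \<rho> ^ (n + k) \<le> s + \<rho> ^ n" using cylinder_nested[OF s(2)] s(3) by auto
  hence "s \<in> nb n \<Delta>" using net_cover[OF assms(1) s(1)] s(1) assms by (auto simp: nb_def)
  thus ?thesis using s that by blast
qed

text \<open>A deeper cylinder meeting the interior of \<Delta> is a neighbour of \<Delta> followed
  by a word of length \<open>k\<close>. The neighbour goes to a neighbour of the other interval, and
  the word is kept.\<close>

lemma tr_pts:
  assumes "same_type n \<Delta> n' \<Delta>'" "t \<in> pts (n + k)" "t < snd \<Delta>" "fst \<Delta> < t + \<rho> ^ (n + k)"
  shows "tr n \<Delta> n' \<Delta>' t \<in> pts (n' + k)"
proof -
  obtain s u where s: "s \<in> nb n \<Delta>" "u \<in> pts k" "t = s + \<rho> ^ n * u"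
    using pts_over_nb[of \<Delta> n t k] assms by (auto simp: same_type_def)
  have "tr n \<Delta> n' \<Delta>' s \<in> pts n'" using tr_nb[OF assms(1) s(1)] by (simp add: nb_def)
  thus ?thesis using s by (simp add: tr_affine pts_addI)
qed

lemma tr_K:
  assumes "same_type n \<Delta> n' \<Delta>'" "x \<in> K" "fst \<Delta> < x" "x < snd \<Delta>"
  shows "tr n \<Delta> n' \<Delta>' x \<in> K"
proof -
  obtain s y where s: "s \<in> pts n" "y \<in> K" "x = s + \<rho> ^ n * y" using K_in_cylinder[OF assms(2)] by blast
  have "0 \<le> \<rho> ^ n * y" "\<rho> ^ n * y \<le> \<rho> ^ n * 1" using s K_subset by (auto intro!: mult_left_mono)
  hence "s \<le> x" "x \<le> s + \<rho> ^ n" using s by auto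
  hence "s \<in> nb n \<Delta>" using net_cover[of \<Delta> n s] s(1) assms by (auto simp: nb_def same_type_def)
  from tr_nb[OF assms(1) this] have "tr n \<Delta> n' \<Delta>' s \<in> pts n'" by (simp add: nb_def)
  thus ?thesis using cylinder_subset_K s by (simp add: tr_affine)
qed

lemma tr_endpoints:
  assumes "same_type n \<Delta> n' \<Delta>'" "x \<in> endpoints (n + k)" "fst \<Delta> \<le> x" "x \<le> snd \<Delta>"
  shows "tr n \<Delta> n' \<Delta>' x \<in> endpoints (n' + k)"
proof -
  have e: "fst \<Delta>' \<in> endpoints (n' + k)" "snd \<Delta>' \<in> endpoints (n' + k)"
    using assms(1) endpoints_mono[of n' k] by (auto simp: same_type_def net_iff)
  consider "x = fst \<Delta>" | "x = snd \<Delta>" | "fst \<Delta> < x" "x < snd \<Delta>" using assms by linarith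
  thus ?thesis
  proof cases
    case 3
    from assms(2) consider "x \<in> pts (n + k)" | t where "t \<in> pts (n + k)" "x = t + \<rho> ^ (n + k)"
      by (auto simp: endpoints_eq)
    thus ?thesis
    proof cases
      case 1
      have "fst \<Delta> < x + \<rho> ^ (n + k)" using 3 rho_pos(4)[of "n + k"] by linarith
      thus ?thesis using tr_pts[OF assms(1) 1] 3 by (auto simp: endpoints_eq)
    next
      case 2
      have "t < snd \<Delta>" using 3 2 rho_pos(4)[of "n + k"] by linarith
      thus ?thesis using tr_pts[OF assms(1) 2(1)] 3 2 by (auto simp: endpoints_eq tr_add_power)
    qed
  qed (use e tr_fst tr_snd[OF assms(1)] in auto)
qed

text \<open>Transport forwards shows that the ends are endpoints and that \<open>K\<close> is met in
  between. That no endpoint appears in between is seen by transporting it back.\<close>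

lemma tri_net:
  assumes st: "same_type n \<Delta> n' \<Delta>'" and "\<Delta>1 \<in> net_intervals (n + k)" "inside \<Delta>1 \<Delta>"
  shows "tri n \<Delta> n' \<Delta>' \<Delta>1 \<in> net_intervals (n' + k)"
proof -
  have b: "fst \<Delta> \<le> fst \<Delta>1" "snd \<Delta>1 \<le> snd \<Delta>" "fst \<Delta>1 < snd \<Delta>1" using assms net_less by (auto simp: inside_def)
  have e: "tr n \<Delta> n' \<Delta>' (fst \<Delta>1) \<in> endpoints (n' + k)" "tr n \<Delta> n' \<Delta>' (snd \<Delta>1) \<in> endpoints (n' + k)"
    using assms(2) b by (auto intro!: tr_endpoints[OF st] simp: net_iff)
  have no: "x \<notin> endpoints (n' + k)"
    if "tr n \<Delta> n' \<Delta>' (fst \<Delta>1) < x" "x < tr n \<Delta> n' \<Delta>' (snd \<Delta>1)" for x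
  proof
    assume x: "x \<in> endpoints (n' + k)"
    define y where "y = tr n' \<Delta>' n \<Delta> x"
    have xy: "x = tr n \<Delta> n' \<Delta>' y" by (simp add: y_def)
    have y: "fst \<Delta>1 < y" "y < snd \<Delta>1" using that unfolding xy by simp_all
    have "fst \<Delta>' \<le> tr n \<Delta> n' \<Delta>' (fst \<Delta>1)" "tr n \<Delta> n' \<Delta>' (snd \<Delta>1) \<le> snd \<Delta>'"
      using tri_inside[OF st assms(3)] by (simp_all add: inside_def)
    hence "y \<in> endpoints (n + k)" unfolding y_def
      using x that by (intro tr_endpoints[OF same_type_sym[OF st]]) auto
    moreover have "y \<in> {fst \<Delta>1<..<snd \<Delta>1}" using y by simp
    ultimately show False using assms(2) unfolding net_iff by blast
  qed
  obtain z where z: "z \<in> K" "fst \<Delta>1 < z" "z < snd \<Delta>1" using net_point[OF assms(2)] .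
  have "tr n \<Delta> n' \<Delta>' z \<in> K" using z b by (intro tr_K[OF st]) auto
  moreover have "tr n \<Delta> n' \<Delta>' z \<in> {tr n \<Delta> n' \<Delta>' (fst \<Delta>1)<..<tr n \<Delta> n' \<Delta>' (snd \<Delta>1)}" using z by simp
  ultimately have "{tr n \<Delta> n' \<Delta>' (fst \<Delta>1)<..<tr n \<Delta> n' \<Delta>' (snd \<Delta>1)} \<inter> K \<noteq> {}" by blast
  moreover have "{tr n \<Delta> n' \<Delta>' (fst \<Delta>1)<..<tr n \<Delta> n' \<Delta>' (snd \<Delta>1)} \<inter> endpoints (n' + k) = {}"
    using no by auto
  ultimately show ?thesis unfolding net_iff fst_tri snd_tri using e b by simp
qed

lemma tr_nb_sub:
  assumes st: "same_type n \<Delta> n' \<Delta>'" and "\<Delta>1 \<in> net_intervals (n + k)" "inside \<Delta>1 \<Delta>" "t \<in> nb (n + k) \<Delta>1"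
  shows "tr n \<Delta> n' \<Delta>' t \<in> nb (n' + k) (tri n \<Delta> n' \<Delta>' \<Delta>1)"
proof -
  have "fst \<Delta>1 < snd \<Delta>1" using net_less assms by blast
  hence "t < snd \<Delta>" "fst \<Delta> < t + \<rho> ^ (n + k)" using assms(3,4) by (auto simp: nb_def inside_def)
  hence "tr n \<Delta> n' \<Delta>' t \<in> pts (n' + k)" using assms(4) by (intro tr_pts[OF st]) (auto simp: nb_def)
  moreover have "tr n \<Delta> n' \<Delta>' (snd \<Delta>1) \<le> tr n \<Delta> n' \<Delta>' (t + \<rho> ^ (n + k))"
    using assms(4) by (simp only: tr_le_iff) (simp add: nb_def)
  ultimately show ?thesis using assms(4) by (simp add: nb_def tr_add_power)
qed

lemma nb_tri:
  assumes st: "same_type n \<Delta> n' \<Delta>'" and "\<Delta>1 \<in> net_intervals (n + k)" "inside \<Delta>1 \<Delta>"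
  shows "nb (n' + k) (tri n \<Delta> n' \<Delta>' \<Delta>1) = tr n \<Delta> n' \<Delta>' ` nb (n + k) \<Delta>1"
proof (intro equalityI subsetI)
  fix t assume t: "t \<in> nb (n' + k) (tri n \<Delta> n' \<Delta>' \<Delta>1)"
  have "tr n' \<Delta>' n \<Delta> t \<in> nb (n + k) (tri n' \<Delta>' n \<Delta> (tri n \<Delta> n' \<Delta>' \<Delta>1))"
    using tr_nb_sub[OF same_type_sym[OF st] tri_net[OF assms] tri_inside[OF st assms(3)] t] .
  thus "t \<in> tr n \<Delta> n' \<Delta>' ` nb (n + k) \<Delta>1" by (intro image_eqI[of _ _ "tr n' \<Delta>' n \<Delta> t"]) auto
qed (use tr_nb_sub assms in blast)

lemma same_type_tri:
  assumes st: "same_type n \<Delta> n' \<Delta>'" and "\<Delta>1 \<in> net_intervals (n + k)" "inside \<Delta>1 \<Delta>"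
  shows "same_type (n + k) \<Delta>1 (n' + k) (tri n \<Delta> n' \<Delta>' \<Delta>1)"
proof -
  have l: "fst \<Delta>1 < snd \<Delta>1" using net_less assms by blast
  have "(\<lambda>t. (fst (tri n \<Delta> n' \<Delta>' \<Delta>1) - t) / \<rho> ^ (n' + k)) ` nb (n' + k) (tri n \<Delta> n' \<Delta>' \<Delta>1)
      = (\<lambda>t. (fst \<Delta>1 - t) / \<rho> ^ (n + k)) ` nb (n + k) \<Delta>1"
    unfolding nb_tri[OF assms] image_image by (simp add: tr_norm_diff)
  thus ?thesis using tri_net[OF assms] assms(2) l
    by (simp add: same_type_def norm_length_def neighbours_eq tr_norm_diff)
qed

lemma parent_unique: "parent n \<Delta>1 \<Delta> \<Longrightarrow> parent n \<Delta>2 \<Delta> \<Longrightarrow> \<Delta>1 = \<Delta>2"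
  using ancestor_unique unfolding parent_iff by blast

lemma position_eq:
  assumes "parent n \<Delta> \<Delta>1"
  shows "position (Suc n) \<Delta>1 =
    card {\<Delta>2. parent n \<Delta> \<Delta>2 \<and> norm_length (Suc n) \<Delta>2 = norm_length (Suc n) \<Delta>1 \<and> fst \<Delta>2 \<le> fst \<Delta>1}"
proof -
  have "(\<exists>\<Delta>''. parent n \<Delta>'' \<Delta>1 \<and> parent n \<Delta>'' \<Delta>2) \<longleftrightarrow> parent n \<Delta> \<Delta>2" for \<Delta>2
    using assms parent_unique by blast
  thus ?thesis by (simp add: position_def)
qed

lemma parent_tri:
  assumes "same_type n \<Delta> n' \<Delta>'" "parent n \<Delta> \<Delta>1"
  shows "parent n' \<Delta>' (tri n \<Delta> n' \<Delta>' \<Delta>1)"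
  using tri_net[OF assms(1), of \<Delta>1 1] tri_inside[OF assms(1)] assms by (auto simp: parent_iff same_type_def)

lemma norm_length_tri:
  "norm_length (n' + k) (tri n \<Delta> n' \<Delta>' \<Delta>1) = norm_length (n + k) \<Delta>1"
  by (simp add: norm_length_def tr_norm_diff)

text \<open>The transport is an increasing bijection between the children of both intervals and
  preserves normalized lengths, so it preserves the rank among siblings of equal length.\<close>

lemma position_tri:
  assumes "same_type n \<Delta> n' \<Delta>'" "parent n \<Delta> \<Delta>1"
  shows "position (Suc n') (tri n \<Delta> n' \<Delta>' \<Delta>1) = position (Suc n) \<Delta>1"
proof -
  let ?A = "\<lambda>n \<Delta> \<Delta>1. {\<Delta>2. parent n \<Delta> \<Delta>2 \<and> norm_length (Suc n) \<Delta>2 = norm_length (Suc n) \<Delta>1 \<and> fst \<Delta>2 \<le> fst \<Delta>1}"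
  have sub: "tri n \<Delta> n' \<Delta>' ` ?A n \<Delta> \<Delta>1 \<subseteq> ?A n' \<Delta>' (tri n \<Delta> n' \<Delta>' \<Delta>1)"
    if "same_type n \<Delta> n' \<Delta>'" "parent n \<Delta> \<Delta>1" for n \<Delta> n' \<Delta>' \<Delta>1
  proof -
    have "norm_length (Suc n') (tri n \<Delta> n' \<Delta>' \<Delta>2) = norm_length (Suc n) \<Delta>2" for \<Delta>2
      using norm_length_tri[of n' 1 n \<Delta> \<Delta>' \<Delta>2] by simp
    thus ?thesis using parent_tri[OF that(1)] by (auto simp del: split_paired_All)
  qed
  have "card (?A n \<Delta> \<Delta>1) = card (?A n' \<Delta>' (tri n \<Delta> n' \<Delta>' \<Delta>1))"
  proof (rule bij_betw_same_card[of "tri n \<Delta> n' \<Delta>'"], rule bij_betwI[of _ _ _ "tri n' \<Delta>' n \<Delta>"])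
    show "tri n \<Delta> n' \<Delta>' \<in> ?A n \<Delta> \<Delta>1 \<rightarrow> ?A n' \<Delta>' (tri n \<Delta> n' \<Delta>' \<Delta>1)"
      using sub[OF assms] by blast
    show "tri n' \<Delta>' n \<Delta> \<in> ?A n' \<Delta>' (tri n \<Delta> n' \<Delta>' \<Delta>1) \<rightarrow> ?A n \<Delta> \<Delta>1"
      using sub[OF same_type_sym[OF assms(1)] parent_tri[OF assms]] unfolding tri_inverse by blast
  qed auto
  thus ?thesis using position_eq[OF assms(2)] position_eq[OF parent_tri[OF assms]] by simp
qed

lemma net_inside_parent:
  assumes "\<Delta>1 \<in> net_intervals (n + Suc k)" "\<Delta> \<in> net_intervals n" "inside \<Delta>1 \<Delta>"
  obtains \<Delta>0 where "\<Delta>0 \<in> net_intervals (n + k)" "inside \<Delta>0 \<Delta>" "parent (n + k) \<Delta>0 \<Delta>1"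
proof -
  obtain \<Delta>0 where d: "\<Delta>0 \<in> net_intervals (n + k)" "inside \<Delta>1 \<Delta>0"
    using ancestor[of \<Delta>1 "n + k" 1] assms(1) by auto
  obtain \<Delta>2 where e: "\<Delta>2 \<in> net_intervals n" "inside \<Delta>0 \<Delta>2" using ancestor[OF d(1)] by blast
  have "\<Delta>2 = \<Delta>" using ancestor_unique[OF assms(1) e(1) assms(2)] inside_trans[OF d(2) e(2)] assms(3) by blast
  thus ?thesis using d e that assms(1) by (auto simp: parent_iff)
qed

text \<open>This is why descendants depend only on the type of the ancestor. Positive depth is
  essential: the positions of \<Delta> and its counterpart may differ, whereas below them positions
  are counted inside corresponding parents.\<close>

lemma char_vec_tri:
  assumes st: "same_type n \<Delta> n' \<Delta>'" and "\<Delta>1 \<in> net_intervals (n + Suc k)" "inside \<Delta>1 \<Delta>"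
  shows "char_vec (n' + Suc k) (tri n \<Delta> n' \<Delta>' \<Delta>1) = char_vec (n + Suc k) \<Delta>1"
proof -
  have "\<Delta> \<in> net_intervals n" using st by (simp add: same_type_def)
  then obtain \<Delta>0 where d: "\<Delta>0 \<in> net_intervals (n + k)" "inside \<Delta>0 \<Delta>" "parent (n + k) \<Delta>0 \<Delta>1"
    using net_inside_parent assms by blast
  have "tri (n + k) \<Delta>0 (n' + k) (tri n \<Delta> n' \<Delta>' \<Delta>0) \<Delta>1 = tri n \<Delta> n' \<Delta>' \<Delta>1"
    by (simp add: tri_def[of "n + k"] tr_tri) (simp add: tri_def)
  hence "position (Suc (n' + k)) (tri n \<Delta> n' \<Delta>' \<Delta>1) = position (Suc (n + k)) \<Delta>1"
    using position_tri[OF same_type_tri[OF st d(1,2)] d(3)] by simp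
  thus ?thesis using same_type_tri[OF assms] by (simp add: char_vec_def same_type_def)
qed

text \<open>Among siblings of equal normalized length the position strictly increases with the left
  endpoint. Hence a characteristic vector singles out one child of a given parent, which makes
  \<open>child_eq_tri\<close> possible.\<close>

lemma position_inj:
  assumes "parent n \<Delta> \<Delta>1" "parent n \<Delta> \<Delta>2" "char_vec (Suc n) \<Delta>1 = char_vec (Suc n) \<Delta>2"
  shows "\<Delta>1 = \<Delta>2"
proof -
  let ?A = "\<lambda>\<Delta>1. {\<Delta>2. parent n \<Delta> \<Delta>2 \<and> norm_length (Suc n) \<Delta>2 = norm_length (Suc n) \<Delta>1 \<and> fst \<Delta>2 \<le> fst \<Delta>1}"
  have le: "\<not> fst \<Delta>1 < fst \<Delta>2" if "parent n \<Delta> \<Delta>1" "parent n \<Delta> \<Delta>2" "char_vec (Suc n) \<Delta>1 = char_vec (Suc n) \<Delta>2" for \<Delta>1 \<Delta>2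
  proof
    assume l: "fst \<Delta>1 < fst \<Delta>2"
    have nl: "norm_length (Suc n) \<Delta>1 = norm_length (Suc n) \<Delta>2" "position (Suc n) \<Delta>1 = position (Suc n) \<Delta>2"
      using that(3) by (auto simp: char_vec_def)
    have "finite (?A \<Delta>2)" by (rule finite_subset[of _ "net_intervals (Suc n)"]) (auto simp: parent_iff)
    moreover have "?A \<Delta>1 \<subseteq> ?A \<Delta>2" using l nl by auto
    moreover have "\<Delta>2 \<in> ?A \<Delta>2" "\<Delta>2 \<notin> ?A \<Delta>1" using that l by auto
    ultimately have "card (?A \<Delta>1) < card (?A \<Delta>2)" by (intro psubset_card_mono psubsetI) auto
    thus False using nl that position_eq by simp
  qed
  have "fst \<Delta>1 = fst \<Delta>2" using le[of \<Delta>1 \<Delta>2] le[of \<Delta>2 \<Delta>1] assms by auto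
  moreover have "snd \<Delta>1 - fst \<Delta>1 = snd \<Delta>2 - fst \<Delta>2" using assms(3) by (simp add: char_vec_def norm_length_def)
  ultimately show ?thesis by (simp add: prod_eq_iff)
qed

lemma child_eq_tri:
  assumes "same_type n \<Delta> n' \<Delta>'" "parent n \<Delta> \<Delta>1" "parent n' \<Delta>' \<Delta>1'"
    and "char_vec (Suc n) \<Delta>1 = char_vec (Suc n') \<Delta>1'"
  shows "\<Delta>1' = tri n \<Delta> n' \<Delta>' \<Delta>1"
proof (rule position_inj[OF assms(3) parent_tri[OF assms(1,2)]])
  show "char_vec (Suc n') \<Delta>1' = char_vec (Suc n') (tri n \<Delta> n' \<Delta>' \<Delta>1)"
    using char_vec_tri[OF assms(1), of \<Delta>1 0] assms by (simp add: parent_iff)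
qed

section \<open>Realizing admissible paths by nested net intervals\<close>

lemma child_realize:
  assumes "child \<alpha> \<beta>" "\<Delta> \<in> net_intervals n" "char_vec n \<Delta> = \<alpha>"
  obtains \<Delta>1 where "parent n \<Delta> \<Delta>1" "char_vec (Suc n) \<Delta>1 = \<beta>"
proof -
  obtain n' \<Delta>' \<Delta>1' where c: "parent n' \<Delta>' \<Delta>1'" "char_vec n' \<Delta>' = \<alpha>" "char_vec (Suc n') \<Delta>1' = \<beta>"
    using assms(1) by (auto simp: child_def)
  have st: "same_type n' \<Delta>' n \<Delta>" using assms c by (intro same_type_char) (auto simp: parent_iff)
  show ?thesis using that[OF parent_tri[OF st c(1)]] char_vec_tri[OF st, of \<Delta>1' 0] c by (simp add: parent_iff)
qed

lemma path_realize:
  assumes "admissible_path \<gamma>" "\<Delta> \<in> net_intervals n" "hd \<gamma> = char_vec n \<Delta>"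
  shows "\<exists>k. \<exists>E\<in>net_intervals (n + k). inside E \<Delta> \<and> char_vec (n + k) E = last \<gamma>"
  using assms
proof (induction \<gamma> arbitrary: n \<Delta>)
  case (Cons \<alpha> \<gamma>)
  show ?case
  proof (cases \<gamma>)
    case Nil
    thus ?thesis using Cons.prems by (intro exI[of _ 0] bexI[of _ \<Delta>]) auto
  next
    case (Cons \<beta> \<gamma>')
    have "child \<alpha> \<beta>" "admissible_path \<gamma>" using Cons Cons.prems(1) by (auto simp: admissible_path_def)
    then obtain \<Delta>1 where d: "parent n \<Delta> \<Delta>1" "char_vec (Suc n) \<Delta>1 = \<beta>"
      using child_realize Cons.prems by (metis list.sel(1))
    then obtain k E where "E \<in> net_intervals (Suc n + k)" "inside E \<Delta>1" "char_vec (Suc n + k) E = last \<gamma>"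
      using Cons.IH[OF \<open>admissible_path \<gamma>\<close>, of \<Delta>1 "Suc n"] Cons by (auto simp: parent_iff)
    thus ?thesis using d Cons inside_trans by (intro exI[of _ "Suc k"] bexI[of _ E]) (auto simp: parent_iff)
  qed
qed (simp add: admissible_path_def)

lemma chain_exists:
  assumes "\<Delta>1 \<in> net_intervals (n + k)" "\<Delta> \<in> net_intervals n" "inside \<Delta>1 \<Delta>"
  shows "\<exists>E. E 0 = \<Delta> \<and> E k = \<Delta>1 \<and> (\<forall>i<k. parent (n + i) (E i) (E (Suc i)))"
  using assms
proof (induction k arbitrary: \<Delta>1)
  case 0
  hence "\<Delta>1 = \<Delta>" using ancestor_unique[of \<Delta>1 n \<Delta>1 n \<Delta>] by simp
  thus ?case by auto
next
  case (Suc k)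
  obtain \<Delta>0 where d: "\<Delta>0 \<in> net_intervals (n + k)" "inside \<Delta>0 \<Delta>" "parent (n + k) \<Delta>0 \<Delta>1"
    using net_inside_parent[OF Suc.prems] .
  obtain E where "E 0 = \<Delta>" "E k = \<Delta>0" "\<forall>i<k. parent (n + i) (E i) (E (Suc i))"
    using Suc.IH[OF d(1) Suc.prems(2) d(2)] by blast
  thus ?case using d by (intro exI[of _ "E(Suc k := \<Delta>1)"]) (auto simp: less_Suc_eq)
qed

lemma childI: "parent n \<Delta> \<Delta>1 \<Longrightarrow> child (char_vec n \<Delta>) (char_vec (Suc n) \<Delta>1)"
  unfolding child_def by blast

lemma char_vec_in_char_vecs: "\<Delta> \<in> net_intervals n \<Longrightarrow> char_vec n \<Delta> \<in> char_vecs"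
  unfolding char_vecs_def by blast

lemma child_closed:
  assumes "\<forall>\<alpha>\<in>\<Omega>'. \<forall>\<beta>. child \<alpha> \<beta> \<longrightarrow> \<beta> \<in> \<Omega>'"
    and "\<Delta> \<in> net_intervals n" "char_vec n \<Delta> \<in> \<Omega>'" "\<Delta>1 \<in> net_intervals (n + k)" "inside \<Delta>1 \<Delta>"
  shows "char_vec (n + k) \<Delta>1 \<in> \<Omega>'"
proof -
  obtain E where E: "E 0 = \<Delta>" "E k = \<Delta>1" "\<And>i. i < k \<Longrightarrow> parent (n + i) (E i) (E (Suc i))"
    using chain_exists[OF assms(4,2,5)] by blast
  have "i \<le> k \<Longrightarrow> char_vec (n + i) (E i) \<in> \<Omega>'" for i
  proof (induction i)
    case (Suc i)
    hence "child (char_vec (n + i) (E i)) (char_vec (n + Suc i) (E (Suc i)))"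
      using childI[OF E(3)[of i]] Suc.prems by simp
    thus ?case using Suc assms(1) by (meson Suc_leD)
  qed (use E assms in simp)
  thus ?thesis using E by blast
qed

lemma chain_path:
  assumes "\<And>i. i < k \<Longrightarrow> parent (n + i) (E i) (E (Suc i))" "E 0 \<in> net_intervals n"
  shows "admissible_path (map (\<lambda>i. char_vec (n + i) (E i)) [0..<Suc k])"
proof -
  have "E i \<in> net_intervals (n + i)" if "i \<le> k" for i
    using that assms(1)[of "i - 1"] assms(2) by (cases i) (auto simp: parent_iff)
  hence "set (map (\<lambda>i. char_vec (n + i) (E i)) [0..<Suc k]) \<subseteq> char_vecs"
    unfolding set_map by (intro image_subsetI char_vec_in_char_vecs) auto
  moreover have "child (char_vec (n + i) (E i)) (char_vec (n + Suc i) (E (Suc i)))" if "i < k" for i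
    using childI[OF assms(1)[OF that]] by simp
  hence "successively child (map (\<lambda>i. char_vec (n + i) (E i)) [0..<Suc k])"
    by (simp add: successively_conv_nth del: upt_Suc)
  ultimately show ?thesis by (simp add: admissible_path_def)
qed

lemma char_vec_tri':
  assumes "\<Delta> \<in> net_intervals n" "\<Delta>' \<in> net_intervals n'" "char_vec n \<Delta> = char_vec n' \<Delta>'"
    and "\<Delta>1 \<in> net_intervals (n + k)" "inside \<Delta>1 \<Delta>"
  shows "char_vec (n' + k) (tri n \<Delta> n' \<Delta>' \<Delta>1) = char_vec (n + k) \<Delta>1"
proof (cases k)
  case 0
  hence "\<Delta>1 = \<Delta>" using ancestor_unique[of \<Delta>1 n \<Delta>1 n \<Delta>] assms by simp
  thus ?thesis using 0 assms tri_self[OF same_type_char] by simp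
next
  case (Suc k')
  thus ?thesis using char_vec_tri[OF same_type_char] assms by blast
qed

section \<open>Small net intervals well inside a given one\<close>

lemma small_scale:
  assumes "\<Delta> \<in> net_intervals n"
  obtains k z where "k \<ge> 1" "z \<in> K" "fst \<Delta> + 3 * \<rho> ^ (n + k) < z" "z + 3 * \<rho> ^ (n + k) < snd \<Delta>"
proof -
  obtain z where z: "z \<in> K" "fst \<Delta> < z" "z < snd \<Delta>" using net_point[OF assms] .
  define e where "e = min (z - fst \<Delta>) (snd \<Delta> - z)"
  have "(\<lambda>k. 3 * \<rho> ^ n * \<rho> ^ k) \<longlonglongrightarrow> 3 * \<rho> ^ n * 0"
    using ratio by (intro tendsto_intros LIMSEQ_realpow_zero) auto
  from order_tendstoD(2)[OF this, of e] have "eventually (\<lambda>k. 3 * \<rho> ^ n * \<rho> ^ k < e) sequentially"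
    using z by (simp add: e_def)
  hence "eventually (\<lambda>k. 3 * \<rho> ^ n * \<rho> ^ k < e \<and> k \<ge> 1) sequentially"
    using eventually_ge_at_top[of 1] by eventually_elim simp
  then obtain k where "3 * \<rho> ^ n * \<rho> ^ k < e" "k \<ge> 1" by (auto simp: eventually_sequentially)
  thus ?thesis using that[of k z] z by (simp add: e_def power_add)
qed

lemma cylinder_around:
  assumes "z \<in> K"
  obtains t where "t \<in> pts n" "t \<le> z" "z \<le> t + \<rho> ^ n"
proof -
  obtain t y where t: "t \<in> pts n" "y \<in> K" "z = t + \<rho> ^ n * y" using K_in_cylinder[OF assms] by blast
  have "0 \<le> \<rho> ^ n * y" "\<rho> ^ n * y \<le> \<rho> ^ n * 1" using t K_subset by (auto intro!: mult_left_mono)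
  thus ?thesis using t that[of t] by auto
qed

text \<open>The margins guarantee more than inclusion of \<open>(t, b)\<close>: every cylinder of
  that level covering it stays strictly inside \<Delta>. This is how \<open>spread_one\<close> uses
  them.\<close>

lemma net_strictly_inside:
  assumes "\<Delta> \<in> net_intervals n"
  obtains k t b where "k \<ge> 1" "t \<in> pts (n + k)" "(t, b) \<in> net_intervals (n + k)" "b \<le> t + \<rho> ^ (n + k)"
    "fst \<Delta> + \<rho> ^ (n + k) < t" "t + 2 * \<rho> ^ (n + k) < snd \<Delta>"
proof -
  obtain k z where k: "k \<ge> 1" "z \<in> K" "fst \<Delta> + 3 * \<rho> ^ (n + k) < z" "z + 3 * \<rho> ^ (n + k) < snd \<Delta>"
    using small_scale[OF assms] .
  obtain t where t: "t \<in> pts (n + k)" "t \<le> z" "z \<le> t + \<rho> ^ (n + k)" using cylinder_around k(2) by blast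
  obtain b where b: "(t, b) \<in> net_intervals (n + k)" "b \<le> t + \<rho> ^ (n + k)" using net_left[OF t(1)] .
  show ?thesis using that[OF k(1) t(1) b] k t rho_pos(4)[of "n + k"] by linarith
qed

lemma child_exists:
  assumes "\<Delta> \<in> net_intervals n"
  obtains \<Delta>1 where "parent n \<Delta> \<Delta>1"
proof -
  obtain k t b where k: "k \<ge> 1" "(t, b) \<in> net_intervals (n + k)" "b \<le> t + \<rho> ^ (n + k)"
    "fst \<Delta> + \<rho> ^ (n + k) < t" "t + 2 * \<rho> ^ (n + k) < snd \<Delta>" using net_strictly_inside[OF assms] .
  have tb: "t < b" using net_less[OF k(2)] by simp
  obtain \<Delta>1 where d: "\<Delta>1 \<in> net_intervals (Suc n)" "inside (t, b) \<Delta>1"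
    using ancestor[of "(t, b)" "Suc n" "k - 1"] k by auto
  have "fst \<Delta> < (t + b) / 2" "(t + b) / 2 < snd \<Delta>" "fst \<Delta>1 < (t + b) / 2" "(t + b) / 2 < snd \<Delta>1"
    using k d tb rho_pos(4)[of "n + k"] by (auto simp: inside_def)
  hence "inside \<Delta>1 \<Delta>" using net_inside_if_meet[of \<Delta>1 n 1 \<Delta> "(t + b) / 2"] d assms by simp
  thus ?thesis using d assms that by (auto simp: parent_iff)
qed

lemma is_essential_classD:
  assumes "is_essential_class \<Omega>'"
  shows "\<Omega>' \<noteq> {}" "\<Omega>' \<subseteq> char_vecs"
    "\<forall>\<alpha>\<in>\<Omega>'. \<forall>\<beta>. child \<alpha> \<beta> \<longrightarrow> \<beta> \<in> \<Omega>'"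
    "\<And>\<alpha> \<beta>. \<alpha> \<in> \<Omega>' \<Longrightarrow> \<beta> \<in> \<Omega>' \<Longrightarrow>
       \<exists>\<gamma>. admissible_path \<gamma> \<and> hd \<gamma> = \<alpha> \<and> last \<gamma> = \<beta> \<and> set \<gamma> \<subseteq> \<Omega>'"
  using assms unfolding is_essential_class_def loop_class_def by blast+

end

text \<open>Finite type in terms of left endpoints of cylinders, with level 0 included.\<close>

locale finite_type_ifs = ifs +
  fixes F :: "real set"
  assumes F_finite: "finite F"
    and F_diff: "\<And>n s t. s \<in> pts n \<Longrightarrow> t \<in> pts n \<Longrightarrow> \<bar>s - t\<bar> \<le> \<rho> ^ n \<Longrightarrow> (s - t) / \<rho> ^ n \<in> F"
begin

subsection \<open>Finiteness of the types\<close>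

definition net_type :: "nat \<Rightarrow> ivl \<Rightarrow> real \<times> real list" where
  "net_type n \<Delta> = (norm_length n \<Delta>, neighbours n \<Delta>)"

text \<open>Contains the possible normalized distances from the left end of a cylinder to the
  endpoints in it; right ends of cylinders account for the shift by 1.\<close>

definition F1 :: "real set" where
  "F1 = F \<union> (\<lambda>f. f + 1) ` F"

lemma F1_finite: "finite F1"
  using F_finite by (simp add: F1_def)

lemma endpoint_in_F1:
  assumes "x \<in> endpoints n" "t \<in> pts n" "t \<le> x" "x \<le> t + \<rho> ^ n"
  shows "(x - t) / \<rho> ^ n \<in> F1"
proof -
  from assms(1) consider "x \<in> pts n" | s where "s \<in> pts n" "x = s + \<rho> ^ n" unfolding endpoints_eq by blast
  thus ?thesis
  proof cases
    case 1
    thus ?thesis using F_diff[of x n t] assms by (auto simp: F1_def abs_le_iff)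
  next
    case 2
    have "(s - t) / \<rho> ^ n \<in> F" using assms 2 by (intro F_diff) (auto simp: abs_le_iff)
    moreover have "(x - t) / \<rho> ^ n = (s - t) / \<rho> ^ n + 1" using 2 by (simp add: field_simps)
    ultimately show ?thesis by (auto simp: F1_def)
  qed
qed

text \<open>Measured from one neighbour, both ends of the interval have coordinates in
  \<open>F1\<close>, and the neighbour list consists of distinct elements of
  \<open>F1\<close>.\<close>

lemma finite_net_types: "finite {net_type n \<Delta> | n \<Delta>. \<Delta> \<in> net_intervals n}"
proof (rule finite_subset)
  let ?A = "(\<lambda>(x, y). x - y) ` (F1 \<times> F1) \<times> {xs. set xs \<subseteq> F1 \<and> distinct xs}"
  show "finite ?A" using F1_finite by (intro finite_cartesian_product finite_imageI finite_subset_distinct)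
  show "{net_type n \<Delta> | n \<Delta>. \<Delta> \<in> net_intervals n} \<subseteq> ?A"
  proof
    fix \<tau> assume "\<tau> \<in> {net_type n \<Delta> | n \<Delta>. \<Delta> \<in> net_intervals n}"
    then obtain n \<Delta> where D: "\<Delta> \<in> net_intervals n" and \<tau>: "\<tau> = net_type n \<Delta>" by blast
    have l: "fst \<Delta> < snd \<Delta>" using net_less[OF D] .
    have e: "fst \<Delta> \<in> endpoints n" "snd \<Delta> \<in> endpoints n" using D by (auto simp: net_iff)
    have f: "(fst \<Delta> - t) / \<rho> ^ n \<in> F1" "(snd \<Delta> - t) / \<rho> ^ n \<in> F1" if "t \<in> nb n \<Delta>" for t
      using that l e by (auto intro!: endpoint_in_F1 simp: nb_def)
    obtain t where t: "t \<in> nb n \<Delta>" using nb_nonempty[OF D] by blast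
    have "norm_length n \<Delta> = (snd \<Delta> - t) / \<rho> ^ n - (fst \<Delta> - t) / \<rho> ^ n"
      by (simp add: norm_length_def diff_divide_distrib)
    hence "norm_length n \<Delta> \<in> (\<lambda>(x, y). x - y) ` (F1 \<times> F1)" using f[OF t]
      by (intro image_eqI[of _ _ "((snd \<Delta> - t) / \<rho> ^ n, (fst \<Delta> - t) / \<rho> ^ n)"]) auto
    moreover have "set (neighbours n \<Delta>) \<subseteq> F1" using f by (auto simp: set_neighbours[OF l])
    ultimately show "\<tau> \<in> ?A" using distinct_neighbours[OF l] by (simp add: \<tau> net_type_def)
  qed
qed

lemma same_type_iff:
  "same_type n \<Delta> n' \<Delta>' \<longleftrightarrow> \<Delta> \<in> net_intervals n \<and> \<Delta>' \<in> net_intervals n' \<and> net_type n \<Delta> = net_type n' \<Delta>'"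
  by (auto simp: same_type_def net_type_def)

text \<open>Since \<open>R\<close> is invariant under transport, the least witness depends on the
  type only, and the maximum over the finitely many types bounds it.\<close>

lemma uniform_bound:
  fixes R :: "nat \<Rightarrow> nat \<Rightarrow> ivl \<Rightarrow> bool" and P :: "nat \<Rightarrow> ivl \<Rightarrow> bool"
  assumes ex: "\<And>n \<Delta>. P n \<Delta> \<Longrightarrow> \<exists>k. R k n \<Delta>"
    and net: "\<And>n \<Delta>. P n \<Delta> \<Longrightarrow> \<Delta> \<in> net_intervals n"
    and transfer: "\<And>k n \<Delta> n' \<Delta>'. same_type n \<Delta> n' \<Delta>' \<Longrightarrow> R k n \<Delta> \<Longrightarrow> R k n' \<Delta>'"
  shows "\<exists>N. \<forall>n \<Delta>. P n \<Delta> \<longrightarrow> (\<exists>k\<le>N. R k n \<Delta>)"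
proof -
  define T where "T = {net_type n \<Delta> | n \<Delta>. \<Delta> \<in> net_intervals n}"
  define g where "g \<tau> = (LEAST k. \<exists>n \<Delta>. \<Delta> \<in> net_intervals n \<and> net_type n \<Delta> = \<tau> \<and> R k n \<Delta>)" for \<tau>
  have "\<exists>k\<le>Max (g ` T). R k n \<Delta>" if D: "P n \<Delta>" for n \<Delta>
  proof -
    note N = net[OF D]
    have "\<exists>k n' \<Delta>'. \<Delta>' \<in> net_intervals n' \<and> net_type n' \<Delta>' = net_type n \<Delta> \<and> R k n' \<Delta>'"
      using ex[OF D] N by blast
    hence "\<exists>n' \<Delta>'. \<Delta>' \<in> net_intervals n' \<and> net_type n' \<Delta>' = net_type n \<Delta> \<and> R (g (net_type n \<Delta>)) n' \<Delta>'"
      unfolding g_def by (rule LeastI_ex)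
    hence "R (g (net_type n \<Delta>)) n \<Delta>" using transfer N unfolding same_type_iff by blast
    moreover have "g (net_type n \<Delta>) \<le> Max (g ` T)"
      using finite_net_types N unfolding T_def by (intro Max_ge finite_imageI imageI) blast+
    ultimately show ?thesis by blast
  qed
  thus ?thesis by blast
qed

subsection \<open>The essential class\<close>

definition overlaps :: "nat \<Rightarrow> real \<Rightarrow> real set" where
  "overlaps n t = {(s - t) / \<rho> ^ n | s. s \<in> pts n \<and> \<bar>s - t\<bar> < \<rho> ^ n}"

lemma overlaps_subset_F: "t \<in> pts n \<Longrightarrow> overlaps n t \<subseteq> F"
  using F_diff by (auto simp: overlaps_def)

text \<open>Prefixing a word copies all overlaps but may create new ones; maximality will exclude
  the latter.\<close>

lemma overlaps_mono:
  assumes "s \<in> pts n" shows "overlaps k t \<subseteq> overlaps (n + k) (s + \<rho> ^ n * t)"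
proof
  fix x assume "x \<in> overlaps k t"
  then obtain u where u: "u \<in> pts k" "\<bar>u - t\<bar> < \<rho> ^ k" "x = (u - t) / \<rho> ^ k" by (auto simp: overlaps_def)
  have e: "\<rho> ^ n * u - \<rho> ^ n * t = \<rho> ^ n * (u - t)" by (simp add: algebra_simps)
  have "\<bar>\<rho> ^ n * (u - t)\<bar> < \<rho> ^ (n + k)" using u by (simp add: abs_mult power_add)
  thus "x \<in> overlaps (n + k) (s + \<rho> ^ n * t)"
    using u pts_addI[OF assms u(1)] unfolding overlaps_def
    by (intro CollectI exI[of _ "s + \<rho> ^ n * u"]) (simp add: e power_add)
qed

text \<open>Choose a cylinder that overlaps a maximal number of cylinders of its level. The cylinders that
  overlap one of its copies inside \<open>S\<^sub>\<sigma>[0, 1]\<close> include the copies of these, so there are no others.\<close>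

lemma absorbing_cylinder:
  "\<exists>N. \<exists>\<eta>\<in>pts N. \<forall>n. \<forall>s\<in>pts n. \<forall>u\<in>pts (n + N).
     \<bar>u - (s + \<rho> ^ n * \<eta>)\<bar> < \<rho> ^ (n + N) \<longrightarrow> (\<exists>v\<in>pts N. u = s + \<rho> ^ n * v)"
proof -
  \<comment> \<open>The maximum over all levels exists because every set of overlaps is contained in
    the finite set \<open>F\<close>.\<close>
  have "\<exists>x. (snd x \<in> pts (fst x)) \<and> (\<forall>y. snd y \<in> pts (fst y) \<longrightarrow>
      card (overlaps (fst y) (snd y)) \<le> card (overlaps (fst x) (snd x)))"
  proof (rule ex_has_greatest_nat[of "\<lambda>x. snd x \<in> pts (fst x)" "(0, 0)" _ "Suc (card F)"])
    show "\<forall>y. snd y \<in> pts (fst y) \<longrightarrow> card (overlaps (fst y) (snd y)) < Suc (card F)"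
      using card_mono[OF F_finite overlaps_subset_F] by (auto simp: less_Suc_eq_le)
  qed simp
  then obtain N \<eta> where N: "\<eta> \<in> pts N"
    and mx: "\<And>n t. t \<in> pts n \<Longrightarrow> card (overlaps n t) \<le> card (overlaps N \<eta>)" by auto
  have "\<exists>v\<in>pts N. u = s + \<rho> ^ n * v"
    if a: "s \<in> pts n" "u \<in> pts (n + N)" "\<bar>u - (s + \<rho> ^ n * \<eta>)\<bar> < \<rho> ^ (n + N)" for n s u
  proof -
    have p: "s + \<rho> ^ n * \<eta> \<in> pts (n + N)" using a N by (intro pts_addI)
    have "overlaps N \<eta> = overlaps (n + N) (s + \<rho> ^ n * \<eta>)"
      using mx[OF p] overlaps_mono[OF a(1)] overlaps_subset_F[OF p] F_finite
      by (intro card_seteq) (auto intro: finite_subset)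
    moreover have "(u - (s + \<rho> ^ n * \<eta>)) / \<rho> ^ (n + N) \<in> overlaps (n + N) (s + \<rho> ^ n * \<eta>)"
      using a by (auto simp: overlaps_def)
    ultimately obtain v where v: "v \<in> pts N" "(u - (s + \<rho> ^ n * \<eta>)) / \<rho> ^ (n + N) = (v - \<eta>) / \<rho> ^ N"
      by (auto simp: overlaps_def)
    have "u = s + \<rho> ^ n * \<eta> + \<rho> ^ (n + N) * ((v - \<eta>) / \<rho> ^ N)" using v(2) by (simp add: field_simps)
    also have "\<dots> = s + \<rho> ^ n * (\<eta> + (v - \<eta>))" unfolding power_add distrib_left by simp
    also have "\<dots> = s + \<rho> ^ n * v" by simp
    finally show ?thesis using v by blast
  qed
  thus ?thesis using N by blast
qed

lemma cylinder_in: "v \<in> pts k \<Longrightarrow> 0 \<le> \<rho> ^ n * v" "v \<in> pts k \<Longrightarrow> \<rho> ^ n * v + \<rho> ^ (n + k) \<le> \<rho> ^ n"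
  using cylinder_nested[of v k 0 n] by simp_all

text \<open>The leftmost net intervals in all copies of an absorbing cylinder have the same type. Passing to
  their children makes the positions agree as well.\<close>

lemma universal_descendant:
  "\<exists>\<beta>\<in>char_vecs. \<forall>n. \<forall>\<Delta>\<in>net_intervals n.
     \<exists>k. \<exists>E\<in>net_intervals (n + k). inside E \<Delta> \<and> char_vec (n + k) E = \<beta>"
proof -
  obtain N \<eta> where \<eta>: "\<eta> \<in> pts N"
    and absorb: "\<And>n s u. s \<in> pts n \<Longrightarrow> u \<in> pts (n + N) \<Longrightarrow> \<bar>u - (s + \<rho> ^ n * \<eta>)\<bar> < \<rho> ^ (n + N) \<Longrightarrow>
      \<exists>v\<in>pts N. u = s + \<rho> ^ n * v" using absorbing_cylinder by blast
  obtain b where b: "(\<eta>, b) \<in> net_intervals N" "b \<le> \<eta> + \<rho> ^ N" using net_left[OF \<eta>] .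
  have copy: "\<exists>\<Delta>'. same_type N (\<eta>, b) (n + N) \<Delta>' \<and> s \<le> fst \<Delta>' \<and> snd \<Delta>' \<le> s + \<rho> ^ n" if s: "s \<in> pts n" for n s
  proof -
    define T where "T = s + \<rho> ^ n * \<eta>"
    define R where "R = \<rho> ^ (n + N)"
    have R: "R > 0" "R = \<rho> ^ n * \<rho> ^ N" by (simp_all add: R_def power_add)
    have T: "T \<in> pts (n + N)" unfolding T_def using s \<eta> by (rule pts_addI)
    obtain b' where b': "(T, b') \<in> net_intervals (n + N)" "b' \<le> T + R" using net_left[OF T] unfolding R_def .
    have near: "\<exists>v\<in>pts N. u = s + \<rho> ^ n * v" if "u \<in> pts (n + N)" "T - R < u" "u < T + R" for u
      using absorb[OF s that(1)] that unfolding T_def R_def by auto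
    \<comment> \<open>The copy of \<open>b\<close> is an endpoint to the right of \<open>T\<close>,
      which bounds \<open>b'\<close> above. Conversely the cylinder that ends or begins at
      \<open>b'\<close> overlaps the copy of the cylinder of \<eta>, so absorption makes
      \<open>b'\<close> the copy of a level \<open>N\<close> endpoint, and none lies between \<eta>
      and \<open>b\<close>.\<close>
    have eb: "b' = s + \<rho> ^ n * b"
    proof (rule antisym)
      have Tb: "T < s + \<rho> ^ n * b" using net_less[OF b(1)] by (simp add: T_def)
      have "s + \<rho> ^ n * b \<in> endpoints (n + N)"
      proof -
        have "b \<in> endpoints N" using b by (simp add: net_iff)
        then consider "b \<in> pts N" | v where "v \<in> pts N" "b = v + \<rho> ^ N" unfolding endpoints_eq by blast
        thus ?thesis
        proof cases
          case 1 thus ?thesis using pts_addI[OF s] by (simp add: endpoints_eq)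
        next
          case 2
          hence "s + \<rho> ^ n * b = (s + \<rho> ^ n * v) + \<rho> ^ (n + N)" by (simp add: power_add algebra_simps)
          thus ?thesis using pts_addI[OF s 2(1)] unfolding endpoints_eq by blast
        qed
      qed
      hence "s + \<rho> ^ n * b \<notin> {T<..<b'}" using b'(1) unfolding net_iff fst_conv snd_conv by blast
      thus "b' \<le> s + \<rho> ^ n * b" using Tb by auto
      have Tb': "T < b'" using net_less[OF b'(1)] by simp
      have "b' \<in> endpoints (n + N)" using b' by (simp add: net_iff)
      \<comment> \<open>The value \<open>T + R\<close> is separated off: a cylinder beginning there
        only touches the copy, and absorption says nothing about it. But it is the right end of the
        copy itself.\<close>
      then consider "b' \<in> pts (n + N)" "b' < T + R" | u where "u \<in> pts (n + N)" "b' = u + R" | "b' = T + R"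
        using b'(2) unfolding endpoints_eq R_def by fastforce
      hence "\<exists>e\<in>endpoints N. b' = s + \<rho> ^ n * e"
      proof cases
        case 1
        thus ?thesis using near[of b'] Tb' R by (auto simp: endpoints_eq)
      next
        case 2
        obtain v where "v \<in> pts N" "u = s + \<rho> ^ n * v" using near[of u] 2 Tb' b'(2) R by auto
        thus ?thesis using 2 R by (intro bexI[of _ "v + \<rho> ^ N"]) (auto simp: endpoints_eq algebra_simps)
      next
        case 3
        thus ?thesis using \<eta> R by (intro bexI[of _ "\<eta> + \<rho> ^ N"]) (auto simp: endpoints_eq algebra_simps T_def)
      qed
      then obtain e where e: "e \<in> endpoints N" "b' = s + \<rho> ^ n * e" by blast
      have "\<eta> < e" using Tb' by (simp add: e T_def)
      moreover have "e \<notin> {\<eta><..<b}" using b(1) e(1) unfolding net_iff fst_conv snd_conv by blast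
      ultimately show "s + \<rho> ^ n * b \<le> b'" by (simp add: e)
    qed
    have nbeq: "nb (n + N) (T, b') = (\<lambda>v. s + \<rho> ^ n * v) ` nb N (\<eta>, b)"
    proof (intro equalityI subsetI)
      fix u assume u: "u \<in> nb (n + N) (T, b')"
      hence "T - R < u" "u < T + R" "u \<in> pts (n + N)" using net_less[OF b'(1)] R by (auto simp: nb_def R_def)
      then obtain v where v: "v \<in> pts N" "u = s + \<rho> ^ n * v" using near by blast
      have "s + \<rho> ^ n * v \<le> s + \<rho> ^ n * \<eta>" "s + \<rho> ^ n * b \<le> s + \<rho> ^ n * v + \<rho> ^ n * \<rho> ^ N"
        using u R by (auto simp: nb_def v eb T_def R_def)
      hence "v \<le> \<eta>" "\<rho> ^ n * b \<le> \<rho> ^ n * (v + \<rho> ^ N)" by (simp_all add: algebra_simps)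
      hence "v \<in> nb N (\<eta>, b)" using v by (simp add: nb_def)
      thus "u \<in> (\<lambda>v. s + \<rho> ^ n * v) ` nb N (\<eta>, b)" using v by blast
    next
      fix u assume "u \<in> (\<lambda>v. s + \<rho> ^ n * v) ` nb N (\<eta>, b)"
      then obtain v where v: "v \<in> pts N" "v \<le> \<eta>" "b \<le> v + \<rho> ^ N" "u = s + \<rho> ^ n * v" by (auto simp: nb_def)
      have "\<rho> ^ n * b \<le> \<rho> ^ n * (v + \<rho> ^ N)" using v by (intro mult_left_mono) auto
      thus "u \<in> nb (n + N) (T, b')" using v pts_addI[OF s v(1)]
        by (simp add: nb_def T_def eb power_add algebra_simps)
    qed
    have "(\<lambda>u. (T - u) / \<rho> ^ (n + N)) ` nb (n + N) (T, b') = (\<lambda>v. (\<eta> - v) / \<rho> ^ N) ` nb N (\<eta>, b)"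
      unfolding nbeq image_image by (intro image_cong) (auto simp: T_def power_add right_diff_distrib[symmetric])
    hence "neighbours (n + N) (T, b') = neighbours N (\<eta>, b)"
      using neighbours_eq[of "(T, b')" "n + N"] neighbours_eq[of "(\<eta>, b)" N] net_less[OF b(1)] net_less[OF b'(1)] by simp
    moreover have "norm_length (n + N) (T, b') = norm_length N (\<eta>, b)"
      by (simp add: norm_length_def T_def eb power_add right_diff_distrib[symmetric])
    ultimately have "same_type N (\<eta>, b) (n + N) (T, b')" using b b' by (simp add: same_type_def)
    moreover have "s \<le> T" "b' \<le> s + \<rho> ^ n"
      using cylinder_in[OF \<eta>, of n] b'(2) by (auto simp: T_def R_def)
    ultimately show ?thesis by (intro exI[of _ "(T, b')"]) auto
  qed
  obtain E0 where E0: "parent N (\<eta>, b) E0" using child_exists[OF b(1)] .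
  show ?thesis
  proof (intro bexI[of _ "char_vec (Suc N) E0"] allI ballI)
    show "char_vec (Suc N) E0 \<in> char_vecs" using E0 char_vec_in_char_vecs by (simp add: parent_iff)
    fix n \<Delta> assume D: "\<Delta> \<in> net_intervals n"
    obtain k t b1 where k: "t \<in> pts (n + k)" "fst \<Delta> + \<rho> ^ (n + k) < t" "t + 2 * \<rho> ^ (n + k) < snd \<Delta>"
      using net_strictly_inside[OF D] by metis
    obtain \<Delta>' where D': "same_type N (\<eta>, b) (n + k + N) \<Delta>'" "t \<le> fst \<Delta>'" "snd \<Delta>' \<le> t + \<rho> ^ (n + k)"
      using copy[OF k(1)] by blast
    define E where "E = tri N (\<eta>, b) (n + k + N) \<Delta>' E0"
    have "char_vec (n + k + N + Suc 0) E = char_vec (N + Suc 0) E0" unfolding E_def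
      using E0 by (intro char_vec_tri[OF D'(1)]) (auto simp: parent_iff)
    moreover have "parent (n + k + N) \<Delta>' E" unfolding E_def by (rule parent_tri[OF D'(1) E0])
    moreover have "inside \<Delta>' \<Delta>" using D' k rho_pos(4)[of "n + k"] unfolding inside_def by linarith
    ultimately show "\<exists>k. \<exists>E\<in>net_intervals (n + k). inside E \<Delta> \<and> char_vec (n + k) E = char_vec (Suc N) E0"
      by (intro exI[of _ "k + N + 1"] bexI[of _ E]) (auto simp: parent_iff add_ac intro: inside_trans)
  qed
qed

text \<open>The descendants of the universal vector \<beta> form the class: they are closed under
  children, and from each of them \<beta> can be reached again. Any essential class contains \<beta>
  by closure, hence all its descendants, and its loop property gives the converse inclusion.\<close>

lemma is_essential_class_essential_class: "is_essential_class essential_class"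
proof -
  obtain \<beta> where \<beta>: "\<beta> \<in> char_vecs"
    and univ: "\<And>n \<Delta>. \<Delta> \<in> net_intervals n \<Longrightarrow>
       \<exists>k. \<exists>E\<in>net_intervals (n + k). inside E \<Delta> \<and> char_vec (n + k) E = \<beta>"
    using universal_descendant by blast
  define \<Omega> where "\<Omega> = {char_vec (n + k) E | n k E \<Delta>. \<Delta> \<in> net_intervals n \<and> char_vec n \<Delta> = \<beta> \<and>
    E \<in> net_intervals (n + k) \<and> inside E \<Delta>}"
  have \<Omega>I: "char_vec (n + k) E \<in> \<Omega>" if "\<Delta> \<in> net_intervals n" "char_vec n \<Delta> = \<beta>"
    "E \<in> net_intervals (n + k)" "inside E \<Delta>" for n k E \<Delta> using that unfolding \<Omega>_def by blast
  obtain n0 \<Delta>0 where D0: "\<Delta>0 \<in> net_intervals n0" "char_vec n0 \<Delta>0 = \<beta>" using \<beta> unfolding char_vecs_def by blast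
  have closed: "\<beta>' \<in> \<Omega>" if "\<alpha> \<in> \<Omega>" "child \<alpha> \<beta>'" for \<alpha> \<beta>'
  proof -
    obtain n k E \<Delta> where E: "\<alpha> = char_vec (n + k) E" "\<Delta> \<in> net_intervals n" "char_vec n \<Delta> = \<beta>"
      "E \<in> net_intervals (n + k)" "inside E \<Delta>" using \<open>\<alpha> \<in> \<Omega>\<close> unfolding \<Omega>_def by blast
    obtain E1 where "parent (n + k) E E1" "char_vec (Suc (n + k)) E1 = \<beta>'"
      using child_realize[OF \<open>child \<alpha> \<beta>'\<close> E(4)] E(1) by metis
    thus ?thesis using \<Omega>I[OF E(2,3), of E1 "Suc k"] inside_trans[OF _ E(5), of E1] by (auto simp: parent_iff)
  qed
  have loop: "\<exists>\<gamma>. admissible_path \<gamma> \<and> hd \<gamma> = \<alpha> \<and> last \<gamma> = \<beta>' \<and> set \<gamma> \<subseteq> \<Omega>" if "\<alpha> \<in> \<Omega>" "\<beta>' \<in> \<Omega>" for \<alpha> \<beta>'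
  proof -
    obtain n k E where E: "\<alpha> = char_vec (n + k) E" "E \<in> net_intervals (n + k)" using \<open>\<alpha> \<in> \<Omega>\<close> unfolding \<Omega>_def by blast
    obtain n' k' E' \<Delta>' where E': "\<beta>' = char_vec (n' + k') E'" "\<Delta>' \<in> net_intervals n'" "char_vec n' \<Delta>' = \<beta>"
      "E' \<in> net_intervals (n' + k')" "inside E' \<Delta>'" using \<open>\<beta>' \<in> \<Omega>\<close> unfolding \<Omega>_def by blast
    obtain l \<Delta>2 where D2: "\<Delta>2 \<in> net_intervals (n + k + l)" "inside \<Delta>2 E" "char_vec (n + k + l) \<Delta>2 = \<beta>"
      using univ[OF E(2)] by blast
    \<comment> \<open>Below \<open>E\<close> there is an interval \<open>\<Delta>2\<close> with
      vector \<beta>; the copy of \<open>E'\<close> below it has the wanted vector.\<close>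
    define E2 where "E2 = tri n' \<Delta>' (n + k + l) \<Delta>2 E'"
    have st: "same_type n' \<Delta>' (n + k + l) \<Delta>2" using E' D2 by (intro same_type_char) auto
    have c: "char_vec (n + k + l + k') E2 = \<beta>'" unfolding E2_def
      using char_vec_tri'[OF E'(2) D2(1) _ E'(4,5)] E' D2 by simp
    have E2: "E2 \<in> net_intervals (n + k + (l + k'))" "inside E2 E"
      using tri_net[OF st E'(4,5)] tri_inside[OF st E'(5)] D2(2) inside_trans by (auto simp: E2_def add_ac)
    obtain C where C: "C 0 = E" "C (l + k') = E2" "\<And>i. i < l + k' \<Longrightarrow> parent (n + k + i) (C i) (C (Suc i))"
      using chain_exists[OF E2(1) E(2) E2(2)] by blast
    let ?\<gamma> = "map (\<lambda>i. char_vec (n + k + i) (C i)) [0..<Suc (l + k')]"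
    have "admissible_path ?\<gamma>" using C E by (intro chain_path) auto
    moreover have "hd ?\<gamma> = \<alpha>" using C E by (simp add: hd_map del: upt_Suc)
    moreover have "last ?\<gamma> = \<beta>'" using C c by (simp add: add_ac)
    moreover have "char_vec (n + k + i) (C i) \<in> \<Omega>" if "i \<le> l + k'" for i
      using that
    proof (induction i)
      case (Suc i)
      hence "child (char_vec (n + k + i) (C i)) (char_vec (n + k + Suc i) (C (Suc i)))"
        using childI[OF C(3)[of i]] by simp
      thus ?case using closed Suc by simp
    qed (use C E \<open>\<alpha> \<in> \<Omega>\<close> in simp)
    hence "set ?\<gamma> \<subseteq> \<Omega>" unfolding set_map by (intro image_subsetI) auto
    ultimately show ?thesis by blast
  qed
  have "\<Omega> \<subseteq> char_vecs" unfolding \<Omega>_def char_vecs_def by blast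
  moreover have "\<beta> \<in> \<Omega>" using \<Omega>I[OF D0, of \<Delta>0 0] D0 by simp
  ultimately have ess: "is_essential_class \<Omega>"
    using closed loop unfolding is_essential_class_def loop_class_def by blast
  have "\<Omega>' = \<Omega>" if "is_essential_class \<Omega>'" for \<Omega>'
  proof -
    note e = is_essential_classD[OF that]
    obtain n \<Delta> where D: "\<Delta> \<in> net_intervals n" "char_vec n \<Delta> \<in> \<Omega>'" using e(1,2) unfolding char_vecs_def by blast
    obtain k E where "E \<in> net_intervals (n + k)" "inside E \<Delta>" "char_vec (n + k) E = \<beta>" using univ[OF D(1)] by blast
    hence b: "\<beta> \<in> \<Omega>'" using child_closed[OF e(3) D] by metis
    show ?thesis
    proof (intro equalityI subsetI)
      fix \<alpha> assume "\<alpha> \<in> \<Omega>"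
      thus "\<alpha> \<in> \<Omega>'" using child_closed[OF e(3)] b unfolding \<Omega>_def by blast
    next
      fix \<alpha> assume "\<alpha> \<in> \<Omega>'"
      then obtain \<gamma> where \<gamma>: "admissible_path \<gamma>" "hd \<gamma> = \<beta>" "last \<gamma> = \<alpha>" using e(4)[OF b] by blast
      then obtain k E where "E \<in> net_intervals (n0 + k)" "inside E \<Delta>0" "char_vec (n0 + k) E = \<alpha>"
        using path_realize[OF \<gamma>(1) D0(1)] D0 by auto
      thus "\<alpha> \<in> \<Omega>" using \<Omega>I[OF D0] by blast
    qed
  qed
  thus ?thesis unfolding essential_class_def using ess by (intro theI[of is_essential_class \<Omega>])
qed

lemmas essential_class_props = is_essential_classD[OF is_essential_class_essential_class]

lemma essential_closed:
  assumes "essential n \<Delta>" "E \<in> net_intervals (n + k)" "inside E \<Delta>"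
  shows "essential (n + k) E"
  using assms child_closed[OF essential_class_props(3) _ _ assms(2,3)] by (auto simp: essential_def)

lemma essential_reach:
  assumes "essential n \<Delta>" "\<alpha> \<in> essential_class"
  obtains k E where "E \<in> net_intervals (n + k)" "inside E \<Delta>" "char_vec (n + k) E = \<alpha>"
proof -
  obtain \<gamma> where "admissible_path \<gamma>" "hd \<gamma> = char_vec n \<Delta>" "last \<gamma> = \<alpha>"
    using essential_class_props(4)[of "char_vec n \<Delta>" \<alpha>] assms by (auto simp: essential_def)
  thus ?thesis using path_realize[of \<gamma> \<Delta> n] assms that by (auto simp: essential_def)
qed

end

context self_similar_measure
begin

subsection \<open>Transition matrices\<close>

text \<open>\<open>nbr n \<Delta> j\<close> is the left endpoint of the cylinder belonging to the \<open>j\<close>-th neighbour.\<close>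

definition nbr :: "nat \<Rightarrow> ivl \<Rightarrow> nat \<Rightarrow> real" where
  "nbr n \<Delta> j = fst \<Delta> - \<rho> ^ n * neighbours n \<Delta> ! j"

lemma nbr_in_nb:
  assumes "\<Delta> \<in> net_intervals n" "j < length (neighbours n \<Delta>)"
  shows "nbr n \<Delta> j \<in> nb n \<Delta>"
proof -
  have "neighbours n \<Delta> ! j \<in> (\<lambda>t. (fst \<Delta> - t) / \<rho> ^ n) ` nb n \<Delta>"
    using set_neighbours[OF net_less[OF assms(1)], of n] assms(2) nth_mem by blast
  then obtain t where t: "t \<in> nb n \<Delta>" "neighbours n \<Delta> ! j = (fst \<Delta> - t) / \<rho> ^ n" by blast
  have "nbr n \<Delta> j = t" unfolding nbr_def t(2) by simp
  thus ?thesis using t by simp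
qed

lemma nb_is_nbr:
  assumes "\<Delta> \<in> net_intervals n" "t \<in> nb n \<Delta>"
  obtains j where "j < length (neighbours n \<Delta>)" "nbr n \<Delta> j = t"
proof -
  have "(fst \<Delta> - t) / \<rho> ^ n \<in> set (neighbours n \<Delta>)"
    using set_neighbours[OF net_less[OF assms(1)], of n] assms(2) by blast
  then obtain j where j: "j < length (neighbours n \<Delta>)" "neighbours n \<Delta> ! j = (fst \<Delta> - t) / \<rho> ^ n"
    by (auto simp: in_set_conv_nth)
  have "nbr n \<Delta> j = t" unfolding nbr_def j(2) by simp
  thus ?thesis using that j by blast
qed

lemma interval_matrix_dim [simp]:
  "dim_row (interval_matrix n \<Delta>' \<Delta>) = length (neighbours n \<Delta>')"
  "dim_col (interval_matrix n \<Delta>' \<Delta>) = length (neighbours (Suc n) \<Delta>)"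
  by (simp_all add: interval_matrix_def)

text \<open>In normalized coordinates the word disappears: the letter is determined by the two
  neighbour values and the offset of the child in its parent. This is the invariance behind the
  choice in \<open>primitive_matrix\<close>.\<close>

lemma interval_matrix_entry:
  assumes "\<Delta>' \<in> net_intervals n" "j < length (neighbours n \<Delta>')" "k < length (neighbours (Suc n) \<Delta>)"
  shows "interval_matrix n \<Delta>' \<Delta> $$ (j, k) =
    (let Q = (\<lambda>l. l \<le> m \<and> d l = (fst \<Delta> - fst \<Delta>') / \<rho> ^ n + neighbours n \<Delta>' ! j - \<rho> * neighbours (Suc n) \<Delta> ! k)
     in if \<exists>l. Q l then p (THE l. Q l) else 0)"
proof -
  let ?v = "neighbours n \<Delta>' ! j" and ?w = "neighbours (Suc n) \<Delta> ! k"
  have "nbr n \<Delta>' j \<in> pts n" using nbr_in_nb[OF assms(1,2)] by (simp add: nb_def)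
  then obtain \<sigma>0 where s0: "\<sigma>0 \<in> words n" "S_word \<sigma>0 0 = fst \<Delta>' - \<rho> ^ n * ?v"
    by (auto simp: pts_def nbr_def)
  have "(l \<le> m \<and> (\<exists>\<sigma>\<in>words n. S_word \<sigma> 0 = fst \<Delta>' - \<rho> ^ n * ?v \<and>
                 S_word (\<sigma> @ [l]) 0 = fst \<Delta> - \<rho> ^ Suc n * ?w)) \<longleftrightarrow>
     (l \<le> m \<and> d l = (fst \<Delta> - fst \<Delta>') / \<rho> ^ n + ?v - \<rho> * ?w)" (is "?A \<longleftrightarrow> ?B") for l
  proof -
    have "fst \<Delta>' - \<rho> ^ n * ?v + \<rho> ^ n * d l = fst \<Delta> - \<rho> ^ Suc n * ?w \<longleftrightarrow>
       d l = (fst \<Delta> - fst \<Delta>') / \<rho> ^ n + ?v - \<rho> * ?w"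
      by (simp add: field_simps)
    moreover have "?A \<longleftrightarrow> l \<le> m \<and> fst \<Delta>' - \<rho> ^ n * ?v + \<rho> ^ n * d l = fst \<Delta> - \<rho> ^ Suc n * ?w"
    proof
      assume ?A thus "l \<le> m \<and> fst \<Delta>' - \<rho> ^ n * ?v + \<rho> ^ n * d l = fst \<Delta> - \<rho> ^ Suc n * ?w"
        by (auto simp: S_word_append_0 length_words)
    next
      assume "l \<le> m \<and> fst \<Delta>' - \<rho> ^ n * ?v + \<rho> ^ n * d l = fst \<Delta> - \<rho> ^ Suc n * ?w"
      thus ?A using s0 by (intro conjI bexI[of _ \<sigma>0]) (auto simp: S_word_append_0 length_words)
    qed
    ultimately show ?thesis by blast
  qed
  thus ?thesis using assms(2,3) by (simp add: interval_matrix_def)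
qed

lemma interval_matrix_pos:
  assumes "\<Delta>' \<in> net_intervals n" "j < length (neighbours n \<Delta>')" "k < length (neighbours (Suc n) \<Delta>)"
  shows "interval_matrix n \<Delta>' \<Delta> $$ (j, k) \<ge> 0"
    "interval_matrix n \<Delta>' \<Delta> $$ (j, k) > 0 \<longleftrightarrow> (\<exists>l\<le>m. nbr (Suc n) \<Delta> k = nbr n \<Delta>' j + \<rho> ^ n * d l)"
proof -
  define Q where "Q = (\<lambda>l. l \<le> m \<and> d l = (fst \<Delta> - fst \<Delta>') / \<rho> ^ n + neighbours n \<Delta>' ! j - \<rho> * neighbours (Suc n) \<Delta> ! k)"
  have e: "interval_matrix n \<Delta>' \<Delta> $$ (j, k) = (if \<exists>l. Q l then p (THE l. Q l) else 0)"
    using interval_matrix_entry[OF assms] unfolding Q_def Let_def .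
  have Q: "Q l \<longleftrightarrow> l \<le> m \<and> nbr (Suc n) \<Delta> k = nbr n \<Delta>' j + \<rho> ^ n * d l" for l
    by (auto simp: Q_def nbr_def field_simps)
  have "p (THE l. Q l) > 0" if ex: "Q l" for l
  proof -
    have "(THE l. Q l) = l" using ex d_inj by (intro the_equality) (auto simp: Q_def)
    thus ?thesis using ex p_pos[of l] by (auto simp: Q_def)
  qed
  thus "interval_matrix n \<Delta>' \<Delta> $$ (j, k) \<ge> 0"
    "interval_matrix n \<Delta>' \<Delta> $$ (j, k) > 0 \<longleftrightarrow> (\<exists>l\<le>m. nbr (Suc n) \<Delta> k = nbr n \<Delta>' j + \<rho> ^ n * d l)"
    unfolding e Q[symmetric] by (auto intro: less_imp_le)
qed

text \<open>Equal vectors force the second child to be the transported copy of the first one, so the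
  normalized offsets agree. It is the position that rules out another sibling of equal
  length.\<close>

lemma interval_matrix_cong:
  assumes "parent n \<Delta> \<Delta>1" "parent n' \<Delta>' \<Delta>1'"
    "char_vec n \<Delta> = char_vec n' \<Delta>'" "char_vec (Suc n) \<Delta>1 = char_vec (Suc n') \<Delta>1'"
  shows "interval_matrix n \<Delta> \<Delta>1 = interval_matrix n' \<Delta>' \<Delta>1'"
proof -
  have net: "\<Delta> \<in> net_intervals n" "\<Delta>' \<in> net_intervals n'" using assms by (auto simp: parent_iff)
  have nb: "neighbours n \<Delta> = neighbours n' \<Delta>'" "neighbours (Suc n) \<Delta>1 = neighbours (Suc n') \<Delta>1'"
    using assms(3,4) by (auto simp: char_vec_def)
  have st: "same_type n \<Delta> n' \<Delta>'" using net assms by (intro same_type_char)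
  have "\<Delta>1' = tri n \<Delta> n' \<Delta>' \<Delta>1" using child_eq_tri[OF st assms(1,2,4)] .
  hence "fst \<Delta>1' - fst \<Delta>' = \<rho> ^ n' * ((fst \<Delta>1 - fst \<Delta>) / \<rho> ^ n)" by (simp add: tr_def)
  hence d: "(fst \<Delta>1' - fst \<Delta>') / \<rho> ^ n' = (fst \<Delta>1 - fst \<Delta>) / \<rho> ^ n" by simp
  show ?thesis
  proof (rule eq_matI)
    fix i j assume "i < dim_row (interval_matrix n' \<Delta>' \<Delta>1')" "j < dim_col (interval_matrix n' \<Delta>' \<Delta>1')"
    thus "interval_matrix n \<Delta> \<Delta>1 $$ (i, j) = interval_matrix n' \<Delta>' \<Delta>1' $$ (i, j)"
      using interval_matrix_entry[OF net(1), of i j \<Delta>1] interval_matrix_entry[OF net(2), of i j \<Delta>1'] nb d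
      by simp
  qed (use nb in auto)
qed

lemma primitive_matrix_eq:
  assumes "parent n \<Delta> \<Delta>1"
  shows "primitive_matrix (char_vec n \<Delta>) (char_vec (Suc n) \<Delta>1) = interval_matrix n \<Delta> \<Delta>1"
proof -
  let ?P = "\<lambda>A. \<exists>n' \<Delta>' \<Delta>1'. parent n' \<Delta>' \<Delta>1' \<and> char_vec n' \<Delta>' = char_vec n \<Delta> \<and>
    char_vec (Suc n') \<Delta>1' = char_vec (Suc n) \<Delta>1 \<and> A = interval_matrix n' \<Delta>' \<Delta>1'"
  have "?P (interval_matrix n \<Delta> \<Delta>1)" using assms by blast
  hence "?P (primitive_matrix (char_vec n \<Delta>) (char_vec (Suc n) \<Delta>1))"
    unfolding primitive_matrix_def by (rule someI)
  thus ?thesis using interval_matrix_cong[OF assms] by metis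
qed

text \<open>An entry of the product is positive once the cylinder of its column extends that of its
  row: splitting off one letter gives an intermediate cylinder, which covers \<open>E 1\<close> by
  \<open>nb_parent\<close> and so contributes a positive term to the nonnegative sum.\<close>

lemma path_matrix_chain:
  assumes "\<forall>i<k. parent (n + i) (E i) (E (Suc i))" "E 0 \<in> net_intervals n"
    and "A = path_matrix (map (\<lambda>i. char_vec (n + i) (E i)) [0..<Suc k])"
  shows "dim_row A = length (neighbours n (E 0)) \<and> dim_col A = length (neighbours (n + k) (E k)) \<and>
    (\<forall>i<dim_row A. \<forall>j<dim_col A. A $$ (i, j) \<ge> 0 \<and>
       ((\<exists>u\<in>pts k. nbr (n + k) (E k) j = nbr n (E 0) i + \<rho> ^ n * u) \<longrightarrow> A $$ (i, j) > 0))"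
  using assms
proof (induction k arbitrary: n E A)
  case 0
  have l: "length (fst (snd (char_vec n (E 0)))) = length (neighbours n (E 0))" by (simp add: char_vec_def)
  have "i = j" if "i < length (neighbours n (E 0))" "j < length (neighbours n (E 0))" "nbr n (E 0) j = nbr n (E 0) i" for i j
    using that distinct_neighbours[OF net_less[OF 0(2)], of n] by (auto simp: nbr_def nth_eq_iff_index_eq)
  thus ?case using 0(3) by (auto simp: l)
next
  case (Suc k n E A)
  let ?f = "\<lambda>i. char_vec (n + i) (E i)" and ?g = "\<lambda>i. char_vec (Suc n + i) (E (Suc i))"
  define B where "B = path_matrix (map ?g [0..<Suc k])"
  define T where "T = primitive_matrix (?f 0) (?g 0)"
  have p: "parent (n + i) (E i) (E (Suc i))" if "i < Suc k" for i using Suc.prems(1) that by blast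
  have p0: "parent n (E 0) (E 1)" using p[of 0] by simp
  have T: "T = interval_matrix n (E 0) (E 1)" unfolding T_def using primitive_matrix_eq[OF p0] by simp
  have fg: "map ?f [0..<Suc (Suc k)] = ?f 0 # map ?g [0..<Suc k]"
    by (subst upt_conv_Cons) (simp_all add: map_Suc_upt[symmetric] del: upt_Suc)
  have ne: "map ?g [0..<Suc k] = ?g 0 # map ?g [Suc 0..<Suc k]"
    by (subst upt_conv_Cons) (simp_all del: upt_Suc)
  have A: "A = T * B"
    unfolding Suc.prems(3) fg B_def T_def by (subst (1 2) ne) simp
  have E1: "E 1 \<in> net_intervals (Suc n)" using p0 by (simp add: parent_iff)
  have "dim_row B = length (neighbours (Suc n) (E 1)) \<and> dim_col B = length (neighbours (Suc n + k) (E (Suc k))) \<and>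
    (\<forall>i<dim_row B. \<forall>j<dim_col B. B $$ (i, j) \<ge> 0 \<and>
       ((\<exists>u\<in>pts k. nbr (Suc n + k) (E (Suc k)) j = nbr (Suc n) (E 1) i + \<rho> ^ Suc n * u) \<longrightarrow> B $$ (i, j) > 0))"
    using Suc.IH[of "Suc n" "\<lambda>i. E (Suc i)" B] p[of "Suc i" for i] E1 by (simp add: B_def)
  note B = this
  have dT: "dim_row T = length (neighbours n (E 0))" "dim_col T = length (neighbours (Suc n) (E 1))" by (auto simp: T)
  have ent: "(T * B) $$ (i, j) = (\<Sum>l<dim_row B. T $$ (i, l) * B $$ (l, j))"
    if "i < dim_row T" "j < dim_col B" for i j
    using that B dT by (simp add: scalar_prod_def lessThan_atLeast0)
  have nonneg: "T $$ (i, l) * B $$ (l, j) \<ge> 0" if "i < dim_row T" "j < dim_col B" "l < dim_row B" for i j l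
    using that B dT interval_matrix_pos(1)[OF Suc.prems(2), of i l "E 1"] by (intro mult_nonneg_nonneg) (auto simp: T)
  have "(T * B) $$ (i, j) > 0"
    if ij: "i < dim_row T" "j < dim_col B" and u: "u \<in> pts (Suc k)" "nbr (n + Suc k) (E (Suc k)) j = nbr n (E 0) i + \<rho> ^ n * u" for i j u
  proof -
    obtain t u' where t: "t \<in> pts (Suc 0)" "u' \<in> pts k" "u = t + \<rho> ^ Suc 0 * u'" using pts_addE[of u "Suc 0" k] u(1) by auto
    obtain c where c: "c \<le> m" "t = d c" using t(1) by (auto simp: pts_1)
    define s where "s = nbr n (E 0) i"
    have s: "s \<in> pts n" using nbr_in_nb[OF Suc.prems(2), of i] ij dT by (simp add: s_def nb_def)
    have s1: "s + \<rho> ^ n * t \<in> pts (Suc n)" using pts_addI[OF s t(1)] by simp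
    have e: "nbr (Suc n + k) (E (Suc k)) j = (s + \<rho> ^ n * t) + \<rho> ^ Suc n * u'"
      using u(2) t(3) by (simp add: s_def algebra_simps)
    have Ek: "E (Suc i) \<in> net_intervals (Suc n + i) \<and> inside (E (Suc i)) (E 1)" if "i \<le> k" for i
      using that
    proof (induction i)
      case (Suc i) thus ?case using p[of "Suc i"] inside_trans[of "E (Suc (Suc i))" "E (Suc i)" "E 1"]
        by (auto simp: parent_iff)
    qed (use E1 in auto)
    have f: "s + \<rho> ^ n * t + \<rho> ^ Suc n * u' \<in> nb (Suc n + k) (E (Suc k))"
      unfolding e[symmetric] using B ij Ek[of k] by (intro nbr_in_nb) auto
    have "s + \<rho> ^ n * t \<in> nb (Suc n) (E 1)"
      by (rule nb_parent[OF E1 _ _ s1 t(2) f]) (use Ek[of k] in blast)+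
    then obtain l where l: "l < length (neighbours (Suc n) (E 1))" "nbr (Suc n) (E 1) l = s + \<rho> ^ n * t"
      using nb_is_nbr[OF E1] by blast
    have "T $$ (i, l) > 0" using l c ij dT unfolding T by (subst interval_matrix_pos(2)[OF Suc.prems(2)]) (auto simp: s_def)
    moreover have "B $$ (l, j) > 0" using B l ij t(2) e by auto
    ultimately have "0 < T $$ (i, l) * B $$ (l, j)" by simp
    also have "\<dots> \<le> (\<Sum>l<dim_row B. T $$ (i, l) * B $$ (l, j))"
      using nonneg ij l B by (intro member_le_sum) auto
    finally show ?thesis using ent ij by simp
  qed
  moreover have "(T * B) $$ (i, j) \<ge> 0" if "i < dim_row T" "j < dim_col B" for i j
    using nonneg that by (simp only: ent) (intro sum_nonneg, auto)
  ultimately show ?case unfolding A using dT B by auto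
qed

end

section \<open>The positive row property and full rows\<close>

locale finite_type_measure = self_similar_measure + finite_type_ifs

locale positive_row_ifs = finite_type_measure +
  assumes positive_rows: positive_row_property
begin

text \<open>A non-zero entry in the row of \<open>s\<close> is a letter extending the cylinder of
  \<open>s\<close> to one that covers the child. This converts the hypothesis on matrices into a
  statement on cylinders, and all later arguments use it in this form.\<close>

lemma positive_row_child:
  assumes "essential n \<Delta>" "parent n \<Delta> \<Delta>1" "s \<in> nb n \<Delta>"
  obtains u where "u \<in> pts (Suc 0)" "s + \<rho> ^ n * u \<in> nb (Suc n) \<Delta>1"
proof -
  have D: "\<Delta> \<in> net_intervals n" "\<Delta>1 \<in> net_intervals (Suc n)" using assms(2) by (auto simp: parent_iff)
  have e: "essential (Suc n) \<Delta>1" using essential_closed[OF assms(1), of \<Delta>1 1] assms(2) by (simp add: parent_iff)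
  obtain j where j: "j < length (neighbours n \<Delta>)" "nbr n \<Delta> j = s" using nb_is_nbr[OF D(1) assms(3)] .
  have "child (char_vec n \<Delta>) (char_vec (Suc n) \<Delta>1)" using childI[OF assms(2)] .
  then obtain k where k: "k < length (neighbours (Suc n) \<Delta>1)" "interval_matrix n \<Delta> \<Delta>1 $$ (j, k) \<noteq> 0"
    using positive_rows j assms(1) e unfolding positive_row_property_def essential_def
    by (metis interval_matrix_dim primitive_matrix_eq[OF assms(2)])
  hence "interval_matrix n \<Delta> \<Delta>1 $$ (j, k) > 0" using interval_matrix_pos(1)[OF D(1) j(1) k(1)] by simp
  then obtain l where "l \<le> m" "nbr (Suc n) \<Delta>1 k = s + \<rho> ^ n * d l"
    using interval_matrix_pos(2)[OF D(1) j(1) k(1)] j by auto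
  thus ?thesis using that[of "d l"] nbr_in_nb[OF D(2) k(1)] by (simp add: pts_1)
qed

lemma positive_row:
  assumes "essential n \<Delta>" "\<Delta>1 \<in> net_intervals (n + k)" "inside \<Delta>1 \<Delta>" "s \<in> nb n \<Delta>"
  shows "\<exists>u\<in>pts k. s + \<rho> ^ n * u \<in> nb (n + k) \<Delta>1"
  using assms(2,3)
proof (induction k arbitrary: \<Delta>1)
  case 0
  have "\<Delta> \<in> net_intervals n" using assms(1) by (simp add: essential_def)
  hence "\<Delta>1 = \<Delta>" using 0 ancestor_unique[of \<Delta>1 n \<Delta>1 n \<Delta>] by simp
  thus ?case using assms(4) by simp
next
  case (Suc k)
  have D: "\<Delta> \<in> net_intervals n" using assms(1) by (simp add: essential_def)
  obtain \<Delta>0 where d: "\<Delta>0 \<in> net_intervals (n + k)" "inside \<Delta>0 \<Delta>" "parent (n + k) \<Delta>0 \<Delta>1"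
    using net_inside_parent[OF Suc.prems(1) D Suc.prems(2)] .
  obtain u where u: "u \<in> pts k" "s + \<rho> ^ n * u \<in> nb (n + k) \<Delta>0" using Suc.IH[OF d(1,2)] by blast
  obtain v where v: "v \<in> pts (Suc 0)" "s + \<rho> ^ n * u + \<rho> ^ (n + k) * v \<in> nb (Suc (n + k)) \<Delta>1"
    using positive_row_child[OF essential_closed[OF assms(1) d(1,2)] d(3) u(2)] .
  have "u + \<rho> ^ k * v \<in> pts (Suc k)" using pts_addI[OF u(1) v(1)] by simp
  thus ?case using v(2) by (intro bexI[of _ "u + \<rho> ^ k * v"]) (simp_all add: power_add algebra_simps)
qed

text \<open>\<open>spreads n s k E\<close>: in terms of transition matrices, all entries of the row of \<open>s\<close> are positive.\<close>

definition spreads :: "nat \<Rightarrow> real \<Rightarrow> nat \<Rightarrow> ivl \<Rightarrow> bool" where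
  "spreads n s k E \<longleftrightarrow> (\<forall>u\<in>nb (n + k) E. \<exists>v\<in>pts k. u = s + \<rho> ^ n * v)"

lemma spreads_trans:
  assumes "v \<in> pts k" "spreads (n + k) (s + \<rho> ^ n * v) l E"
  shows "spreads n s (k + l) E"
  unfolding spreads_def
proof
  fix u assume "u \<in> nb (n + (k + l)) E"
  then obtain w where w: "w \<in> pts l" "u = s + \<rho> ^ n * v + \<rho> ^ (n + k) * w"
    using assms(2) by (auto simp: spreads_def add.assoc)
  hence "u = s + \<rho> ^ n * (v + \<rho> ^ k * w)" by (simp add: power_add algebra_simps)
  thus "\<exists>v\<in>pts (k + l). u = s + \<rho> ^ n * v" using pts_addI[OF assms(1) w(1)] by blast
qed

text \<open>Every cylinder over \<open>E'\<close> extends a cylinder over \<open>E\<close>, so a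
  full row stays full further down.\<close>

lemma spreads_inside:
  assumes "spreads n s k E" "E \<in> net_intervals (n + k)" "E' \<in> net_intervals (n + k + l)" "inside E' E"
  shows "spreads n s (k + l) E'"
  unfolding spreads_def
proof
  fix u assume u: "u \<in> nb (n + (k + l)) E'"
  obtain t w where t: "t \<in> pts (n + k)" "w \<in> pts l" "u = t + \<rho> ^ (n + k) * w"
    using u pts_addE[of u "n + k" l] by (auto simp: nb_def add.assoc)
  have "t \<in> nb (n + k) E" using nb_parent[OF assms(2,3,4) t(1,2)] u t(3) by (simp add: add.assoc)
  then obtain v where v: "v \<in> pts k" "t = s + \<rho> ^ n * v" using assms(1) by (auto simp: spreads_def)
  have "u = s + \<rho> ^ n * (v + \<rho> ^ k * w)" using t v by (simp add: power_add algebra_simps)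
  thus "\<exists>v\<in>pts (k + l). u = s + \<rho> ^ n * v" using pts_addI[OF v(1) t(2)] by blast
qed

text \<open>The positive row property extends \<open>s\<close> to a cylinder \<open>s'\<close> over
  a small net interval deep inside \<Delta>. Everything over the leftmost net interval of the
  absorbing copy in \<open>s'\<close> descends from \<open>s'\<close> and hence from
  \<open>s\<close>; the margins keep it strictly inside \<Delta>.\<close>

lemma spread_one:
  assumes "essential n \<Delta>" "s \<in> nb n \<Delta>"
  obtains k E where "E \<in> net_intervals (n + k)" "fst \<Delta> < fst E" "snd E < snd \<Delta>" "spreads n s k E"
proof -
  have D: "\<Delta> \<in> net_intervals n" using assms(1) by (simp add: essential_def)
  obtain N \<eta> where \<eta>: "\<eta> \<in> pts N"
    and absorb: "\<And>n s u. s \<in> pts n \<Longrightarrow> u \<in> pts (n + N) \<Longrightarrow> \<bar>u - (s + \<rho> ^ n * \<eta>)\<bar> < \<rho> ^ (n + N) \<Longrightarrow>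
      \<exists>v\<in>pts N. u = s + \<rho> ^ n * v" using absorbing_cylinder by blast
  obtain k t b where k: "t \<in> pts (n + k)" "(t, b) \<in> net_intervals (n + k)" "b \<le> t + \<rho> ^ (n + k)"
    "fst \<Delta> + \<rho> ^ (n + k) < t" "t + 2 * \<rho> ^ (n + k) < snd \<Delta>" using net_strictly_inside[OF D] by metis
  have "inside (t, b) \<Delta>" using k rho_pos(4)[of "n + k"] unfolding inside_def fst_conv snd_conv by linarith
  from positive_row[OF assms(1) k(2) this assms(2)]
  obtain v where v: "v \<in> pts k" "s + \<rho> ^ n * v \<in> nb (n + k) (t, b)" by blast
  define s' where "s' = s + \<rho> ^ n * v"
  have s': "s' \<in> pts (n + k)" "s' \<le> t" "b \<le> s' + \<rho> ^ (n + k)" using v by (auto simp: s'_def nb_def)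
  have tb: "t < b" using net_less[OF k(2)] by simp
  define T where "T = s' + \<rho> ^ (n + k) * \<eta>"
  have T: "T \<in> pts (n + k + N)" unfolding T_def using s' \<eta> by (intro pts_addI)
  obtain b' where b': "(T, b') \<in> net_intervals (n + k + N)" "b' \<le> T + \<rho> ^ (n + k + N)" using net_left[OF T] .
  have "spreads (n + k) s' N (T, b')"
    unfolding spreads_def
  proof
    fix u assume u: "u \<in> nb (n + k + N) (T, b')"
    hence "\<bar>u - T\<bar> < \<rho> ^ (n + k + N)" using net_less[OF b'(1)] by (auto simp: nb_def abs_if)
    thus "\<exists>v\<in>pts N. u = s' + \<rho> ^ (n + k) * v" using absorb[OF s'(1), of u] u by (auto simp: nb_def T_def)
  qed
  hence "spreads n s (k + N) (T, b')" using spreads_trans[OF v(1)] by (simp add: s'_def)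
  moreover have "s' \<le> T" "b' \<le> s' + \<rho> ^ (n + k)" using cylinder_nested[OF \<eta>, of s' "n + k"] b'(2) by (auto simp: T_def)
  moreover have "fst \<Delta> < s'" "s' + \<rho> ^ (n + k) < snd \<Delta>" using s' k tb rho_pos(4)[of "n + k"] by linarith+
  ultimately show ?thesis using that[of "(T, b')" "k + N"] b' by (simp add: add.assoc)
qed

text \<open>Induction over the neighbours: the next one is continued to a cylinder over the current
  \<open>E\<close> and spread inside \<open>E\<close>. The rows made full before remain so.\<close>

lemma spread_all:
  assumes "essential n \<Delta>" "A \<subseteq> nb n \<Delta>"
  shows "\<exists>k. \<exists>E\<in>net_intervals (n + k). inside E \<Delta> \<and> (\<forall>s\<in>A. spreads n s k E)"
proof -
  have D: "\<Delta> \<in> net_intervals n" using assms(1) by (simp add: essential_def)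
  have "finite A" using assms(2) finite_subset by fastforce
  thus ?thesis using assms(2)
  proof (induction A)
    case empty
    thus ?case using D by (intro exI[of _ 0] bexI[of _ \<Delta>]) auto
  next
    case (insert s A)
    then obtain k E where E: "E \<in> net_intervals (n + k)" "inside E \<Delta>" "\<And>s. s \<in> A \<Longrightarrow> spreads n s k E" by auto
    obtain v where v: "v \<in> pts k" "s + \<rho> ^ n * v \<in> nb (n + k) E"
      using positive_row[OF assms(1) E(1,2)] insert.prems by blast
    obtain l E' where E': "E' \<in> net_intervals (n + k + l)" "fst E < fst E'" "snd E' < snd E"
      "spreads (n + k) (s + \<rho> ^ n * v) l E'" using spread_one[OF essential_closed[OF assms(1) E(1,2)] v(2)] .
    have i: "inside E' E" using E' by (simp add: inside_def)
    have "spreads n s (k + l) E'" using spreads_trans[OF v(1) E'(4)] .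
    moreover have "spreads n s' (k + l) E'" if "s' \<in> A" for s'
      using spreads_inside[OF E(3)[OF that] E(1) E'(1) i] .
    ultimately show ?case using E'(1) inside_trans[OF i E(2)]
      by (intro exI[of _ "k + l"] bexI[of _ E']) (auto simp: add.assoc)
  qed
qed

text \<open>Strict inclusion is built in so that the fixed point of the affine map onto
  \<open>E\<close> will not be an endpoint of any level.\<close>

definition returns :: "char_vec \<Rightarrow> nat \<Rightarrow> nat \<Rightarrow> ivl \<Rightarrow> bool" where
  "returns \<alpha> k n \<Delta> \<longleftrightarrow> (\<exists>E\<in>net_intervals (n + k). fst \<Delta> < fst E \<and> snd E < snd \<Delta> \<and>
     char_vec (n + k) E = \<alpha> \<and> (\<forall>s\<in>nb n \<Delta>. spreads n s k E))"

lemma returns_exists: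
  assumes "essential n \<Delta>" "\<alpha> \<in> essential_class"
  shows "\<exists>k. returns \<alpha> k n \<Delta>"
proof -
  obtain k E where E: "E \<in> net_intervals (n + k)" "inside E \<Delta>" "\<forall>s\<in>nb n \<Delta>. spreads n s k E"
    using spread_all[OF assms(1) subset_refl] by blast
  note e = essential_closed[OF assms(1) E(1,2)]
  obtain s where s: "s \<in> nb (n + k) E" using nb_nonempty[OF E(1)] by blast
  \<comment> \<open>The rows are full already; this application of \<open>spread_one\<close> serves
    only to get strictly inside \<Delta>.\<close>
  obtain l E1 where E1: "E1 \<in> net_intervals (n + k + l)" "fst E < fst E1" "snd E1 < snd E"
    using spread_one[OF e s] by blast
  have i1: "inside E1 E" using E1 by (simp add: inside_def)
  obtain l' E2 where E2: "E2 \<in> net_intervals (n + k + l + l')" "inside E2 E1" "char_vec (n + k + l + l') E2 = \<alpha>"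
    using essential_reach[OF essential_closed[OF e E1(1) i1] assms(2)] .
  have "spreads n s (k + (l + l')) E2" if "s \<in> nb n \<Delta>" for s
    using spreads_inside[of n s k E E2 "l + l'"] E that E2 inside_trans[OF E2(2) i1] by (simp add: add.assoc)
  thus ?thesis using E E1 E2 unfolding returns_def
    by (intro exI[of _ "k + l + l'"] bexI[of _ E2]) (auto simp: inside_def add.assoc)
qed

lemma returns_transfer:
  assumes st: "same_type n \<Delta> n' \<Delta>'" and "returns \<alpha> k n \<Delta>"
  shows "returns \<alpha> k n' \<Delta>'"
proof -
  obtain E where E: "E \<in> net_intervals (n + k)" "fst \<Delta> < fst E" "snd E < snd \<Delta>" "char_vec (n + k) E = \<alpha>"
    "\<And>s. s \<in> nb n \<Delta> \<Longrightarrow> spreads n s k E" using assms(2) by (auto simp: returns_def)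
  have i: "inside E \<Delta>" using E by (simp add: inside_def)
  define E' where "E' = tri n \<Delta> n' \<Delta>' E"
  \<comment> \<open>Strictness forces positive depth, where the transport preserves the position as
    well.\<close>
  have "k \<noteq> 0"
  proof
    assume "k = 0"
    hence "E = \<Delta>" using st E(1) i ancestor_unique[of E n E n \<Delta>] by (simp add: same_type_def)
    thus False using E by simp
  qed
  hence c: "char_vec (n' + k) E' = \<alpha>" using char_vec_tri[OF st, of E "k - 1"] E i by (simp add: E'_def)
  have nets: "E' \<in> net_intervals (n' + k)" unfolding E'_def using tri_net[OF st E(1) i] .
  have str: "fst \<Delta>' < fst E'" "snd E' < snd \<Delta>'"
    using E tr_fst[of n \<Delta> n' \<Delta>'] tr_snd[OF st] unfolding E'_def fst_tri snd_tri by (metis tr_less_iff)+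
  have "spreads n' s' k E'" if s': "s' \<in> nb n' \<Delta>'" for s'
    unfolding spreads_def
  proof
    fix u' assume "u' \<in> nb (n' + k) E'"
    then obtain u where u: "u \<in> nb (n + k) E" "u' = tr n \<Delta> n' \<Delta>' u"
      unfolding E'_def nb_tri[OF st E(1) i] by blast
    define s where "s = tr n' \<Delta>' n \<Delta> s'"
    have "s \<in> nb n \<Delta>" unfolding s_def using tr_nb[OF same_type_sym[OF st] s'] .
    then obtain v where v: "v \<in> pts k" "u = s + \<rho> ^ n * v" using E(5) u(1) by (auto simp: spreads_def)
    have "u' = s' + \<rho> ^ n' * v" unfolding u(2) v(2) tr_affine by (simp add: s_def)
    thus "\<exists>v\<in>pts k. u' = s' + \<rho> ^ n' * v" using v by blast
  qed
  thus ?thesis using nets str c unfolding returns_def by blast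
qed

lemma returns_bounded:
  assumes "\<alpha> \<in> essential_class"
  shows "\<exists>N. \<forall>n \<Delta>. essential n \<Delta> \<longrightarrow> (\<exists>k\<le>N. returns \<alpha> k n \<Delta>)"
  using assms returns_exists returns_transfer
  by (intro uniform_bound) (auto simp: essential_def)

end

context self_similar_measure
begin

subsection \<open>The measure of cylinders\<close>

definition pw :: "nat list \<Rightarrow> real" where
  "pw \<sigma> = prod_list (map p \<sigma>)"

lemma pw_append: "pw (\<sigma> @ \<tau>) = pw \<sigma> * pw \<tau>"
  by (simp add: pw_def)

lemma sum_words_add:
  "(\<Sum>\<sigma>\<in>words (n + k). f \<sigma>) = (\<Sum>\<sigma>\<in>words n. \<Sum>\<tau>\<in>words k. f (\<sigma> @ \<tau>))"
  unfolding words_append sum.reindex[OF words_append_inj] sum.cartesian_product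
  by (simp add: case_prod_unfold comp_def)

lemma sum_words_1: "(\<Sum>\<sigma>\<in>words (Suc 0). f \<sigma>) = (\<Sum>j\<le>m. f [j])"
  unfolding words_1 by (subst sum.reindex) (auto simp: inj_on_def)

definition pmin :: real where
  "pmin = Min (p ` {..m})"

lemma pmin_pos: "0 < pmin" and pmin_le: "j \<le> m \<Longrightarrow> pmin \<le> p j"
  unfolding pmin_def using p_pos by (auto simp: Min_gr_iff)

lemma pmin_le_1: "pmin \<le> 1"
proof -
  have "p 0 \<le> (\<Sum>j\<le>m. p j)" using p_pos by (intro member_le_sum) (auto intro: less_imp_le)
  thus ?thesis using pmin_le[of 0] p_sum by simp
qed

lemma pw_ge: "\<sigma> \<in> words n \<Longrightarrow> pmin ^ n \<le> pw \<sigma>"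
proof (induction n arbitrary: \<sigma>)
  case (Suc n)
  then obtain j \<tau> where t: "\<sigma> = j # \<tau>" "j \<le> m" "\<tau> \<in> words n"
    by (cases \<sigma>) (auto simp: words_def)
  have "pmin * pmin ^ n \<le> p j * pw \<tau>" using Suc.IH[OF t(3)] pmin_le[OF t(2)] pmin_pos p_pos[OF t(2)]
    by (intro mult_mono) auto
  thus ?case by (simp add: t pw_def)
qed (simp add: pw_def)

lemma pw_pos: "\<sigma> \<in> words n \<Longrightarrow> 0 < pw \<sigma>"
  using pw_ge[of \<sigma> n] pmin_pos by (meson less_le_trans zero_less_power)

lemma sum_pw: "(\<Sum>\<sigma>\<in>words n. pw \<sigma>) = 1"
proof (induction n)
  case (Suc n)
  have "(\<Sum>\<sigma>\<in>words (n + Suc 0). pw \<sigma>) = (\<Sum>\<sigma>\<in>words n. pw \<sigma> * (\<Sum>j\<le>m. p j))"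
    unfolding sum_words_add sum_words_1 by (simp add: pw_append sum_distrib_left) (simp add: pw_def)
  thus ?case using Suc p_sum by simp
qed (simp add: pw_def)

interpretation prob_space \<mu> by (rule mu_prob)

lemma space_mu: "space \<mu> = UNIV"
  using sets_eq_imp_space_eq[OF mu_sets] by simp

lemma S_measurable: "S_word \<sigma> \<in> borel_measurable borel"
proof -
  have "(\<lambda>x. S_word \<sigma> 0 + \<rho> ^ length \<sigma> * x) \<in> borel_measurable borel" by measurable
  thus ?thesis by (rule measurable_cong[THEN iffD2, rotated]) (rule S_word_affine)
qed

lemma S_vimage_borel: "A \<in> sets borel \<Longrightarrow> S_word \<sigma> -` A \<in> sets borel"
  using measurable_sets[OF S_measurable, of A] by simp

lemma mu_words:
  "A \<in> sets borel \<Longrightarrow> measure \<mu> A = (\<Sum>\<sigma>\<in>words n. pw \<sigma> * measure \<mu> (S_word \<sigma> -` A))"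
proof (induction n)
  case (Suc n)
  have step: "measure \<mu> (S_word \<sigma> -` A) = (\<Sum>j\<le>m. p j * measure \<mu> (S_word (\<sigma> @ [j]) -` A))" for \<sigma>
  proof -
    have "S j -` (S_word \<sigma> -` A) = S_word (\<sigma> @ [j]) -` A" for j
      by (auto simp: S_word_append S_def)
    thus ?thesis using mu_invariant[OF S_vimage_borel[OF Suc.prems, of \<sigma>]] by simp
  qed
  have "measure \<mu> A = (\<Sum>\<sigma>\<in>words n. pw \<sigma> * measure \<mu> (S_word \<sigma> -` A))" by (rule Suc.IH[OF Suc.prems])
  also have "\<dots> = (\<Sum>\<sigma>\<in>words n. pw \<sigma> * (\<Sum>j\<le>m. p j * measure \<mu> (S_word (\<sigma> @ [j]) -` A)))"
    by (rule sum.cong[OF refl], subst step, rule refl)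
  also have "\<dots> = (\<Sum>\<sigma>\<in>words (n + Suc 0). pw \<sigma> * measure \<mu> (S_word \<sigma> -` A))"
    unfolding sum_words_add sum_words_1 sum_distrib_left
    by (intro sum.cong refl) (simp add: pw_append, simp add: pw_def)
  finally show ?case by simp
qed (simp add: pw_def vimage_def)

text \<open>Each map of level \<open>n\<close> sends the \<open>t\<close>-neighbourhood of the unit
  interval into its \<open>\<rho> ^ n * t\<close>-neighbourhood; averaging by invariance, no mass is
  lost.\<close>

lemma mu_expand: "t \<ge> 0 \<Longrightarrow> measure \<mu> {-t..1 + t} \<le> measure \<mu> {-(\<rho> ^ n * t)..1 + \<rho> ^ n * t}"
proof -
  assume t: "t \<ge> 0"
  have "measure \<mu> {-t..1 + t} = (\<Sum>\<sigma>\<in>words n. pw \<sigma> * measure \<mu> {-t..1 + t})"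
    by (simp add: sum_distrib_right[symmetric] sum_pw)
  also have "\<dots> \<le> (\<Sum>\<sigma>\<in>words n. pw \<sigma> * measure \<mu> (S_word \<sigma> -` {-(\<rho> ^ n * t)..1 + \<rho> ^ n * t}))"
  proof (intro sum_mono mult_left_mono finite_measure_mono)
    fix \<sigma> assume s: "\<sigma> \<in> words n"
    show "S_word \<sigma> -` {-(\<rho> ^ n * t)..1 + \<rho> ^ n * t} \<in> sets \<mu>" using S_vimage_borel mu_sets by simp
    show "{-t..1 + t} \<subseteq> S_word \<sigma> -` {-(\<rho> ^ n * t)..1 + \<rho> ^ n * t}"
    proof
      fix x assume x: "x \<in> {-t..1 + t}"
      have "S_word \<sigma> 0 \<in> pts n" using s by (simp add: pts_def)
      hence b: "0 \<le> S_word \<sigma> 0" "S_word \<sigma> 0 + \<rho> ^ n \<le> 1" using pts_bounds by auto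
      have "\<rho> ^ n * (- t) \<le> \<rho> ^ n * x" "\<rho> ^ n * x \<le> \<rho> ^ n * (1 + t)"
        using x mult_left_mono[of "- t" x "\<rho> ^ n"] mult_left_mono[of x "1 + t" "\<rho> ^ n"] by simp_all
      moreover have "\<rho> ^ n * (1 + t) = \<rho> ^ n + \<rho> ^ n * t" "\<rho> ^ n * (- t) = - (\<rho> ^ n * t)"
        by (simp_all add: distrib_left)
      ultimately have "-(\<rho> ^ n * t) \<le> S_word \<sigma> 0 + \<rho> ^ n * x" "S_word \<sigma> 0 + \<rho> ^ n * x \<le> 1 + \<rho> ^ n * t"
        using b by linarith+
      thus "x \<in> S_word \<sigma> -` {-(\<rho> ^ n * t)..1 + \<rho> ^ n * t}"
        using S_word_affine[of \<sigma> x] s by (simp add: length_words)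
    qed
    show "0 \<le> pw \<sigma>" using pw_pos[OF s] by simp
  qed
  also have "\<dots> = measure \<mu> {-(\<rho> ^ n * t)..1 + \<rho> ^ n * t}" by (rule mu_words[symmetric]) simp
  finally show ?thesis .
qed

text \<open>Invariance alone concentrates the measure: all mass at bounded distance is pushed into
  the unit interval as \<open>n\<close> grows, and bounded neighbourhoods exhaust the line.\<close>

lemma mu_unit: "measure \<mu> {0..1} = 1"
proof (rule antisym)
  show "measure \<mu> {0..1} \<le> 1" by simp
  have ge: "measure \<mu> {-t..1 + t} \<le> measure \<mu> {0..1}" if t: "t \<ge> 0" for t
  proof -
    let ?A = "\<lambda>n. {-(\<rho> ^ n * t)..1 + \<rho> ^ n * t}"
    have "\<rho> ^ k * t \<le> \<rho> ^ n * t" if "n \<le> k" for n k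
      using that t ratio by (intro mult_right_mono power_decreasing) auto
    hence "decseq ?A" unfolding decseq_def by auto
    moreover have "range ?A \<subseteq> sets \<mu>" unfolding mu_sets by (intro image_subsetI atLeastAtMost_borel)
    ultimately have "(\<lambda>n. measure \<mu> (?A n)) \<longlonglongrightarrow> measure \<mu> (\<Inter>n. ?A n)" by (intro finite_Lim_measure_decseq)
    moreover have "(\<Inter>n. ?A n) = {0..1}"
    proof (intro equalityI subsetI)
      fix x assume x: "x \<in> (\<Inter>n. ?A n)"
      have lim: "(\<lambda>n. \<rho> ^ n * t) \<longlonglongrightarrow> 0 * t" using ratio by (intro tendsto_intros LIMSEQ_realpow_zero) auto
      have lims: "(\<lambda>n. -(\<rho> ^ n * t)) \<longlonglongrightarrow> - (0 * t)" "(\<lambda>n. 1 + \<rho> ^ n * t) \<longlonglongrightarrow> 1 + 0 * t"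
        by (intro tendsto_intros lim)+
      have xn: "- (\<rho> ^ n * t) \<le> x" "x \<le> 1 + \<rho> ^ n * t" for n using x by auto
      have "- (0 * t) \<le> x" using lims(1) by (rule LIMSEQ_le_const2) (use xn in blast)
      moreover have "x \<le> 1 + 0 * t" using lims(2) by (rule LIMSEQ_le_const) (use xn in blast)
      ultimately show "x \<in> {0..1}" by simp
    next
      fix x :: real assume x: "x \<in> {0..1}"
      have "x \<in> ?A n" for n
      proof -
        have "0 \<le> \<rho> ^ n * t" using t by simp
        thus ?thesis using x by simp
      qed
      thus "x \<in> (\<Inter>n. ?A n)" by blast
    qed
    ultimately have "(\<lambda>n. measure \<mu> (?A n)) \<longlonglongrightarrow> measure \<mu> {0..1}" by simp
    thus ?thesis using mu_expand[OF t] by (intro LIMSEQ_le_const) auto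
  qed
  let ?B = "\<lambda>i::nat. {-real i..1 + real i}"
  have "incseq ?B" unfolding incseq_def by auto
  moreover have "range ?B \<subseteq> sets \<mu>" unfolding mu_sets by (intro image_subsetI atLeastAtMost_borel)
  ultimately have "(\<lambda>i. measure \<mu> (?B i)) \<longlonglongrightarrow> measure \<mu> (\<Union>i. ?B i)" by (intro finite_Lim_measure_incseq)
  moreover have "(\<Union>i. ?B i) = UNIV"
  proof (intro equalityI subsetI UNIV_I)
    fix x :: real
    obtain i :: nat where "\<bar>x\<bar> \<le> real i" using real_arch_simple by blast
    thus "x \<in> (\<Union>i. ?B i)" by (intro UN_I[of i]) auto
  qed
  ultimately have "(\<lambda>i. measure \<mu> (?B i)) \<longlonglongrightarrow> 1" using prob_space space_mu by simp
  thus "1 \<le> measure \<mu> {0..1}" using ge by (intro LIMSEQ_le_const2) auto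
qed

lemma mu_outside: "A \<in> sets borel \<Longrightarrow> A \<inter> {0..1} = {} \<Longrightarrow> measure \<mu> A = 0"
proof -
  assume A: "A \<in> sets borel" "A \<inter> {0..1} = {}"
  have "measure \<mu> A + measure \<mu> {0..1} = measure \<mu> (A \<union> {0..1})"
    using A mu_sets by (intro finite_measure_Union[symmetric]) auto
  also have "\<dots> \<le> 1" by simp
  finally show ?thesis using mu_unit measure_nonneg[of \<mu> A] by simp
qed

definition cyl :: "nat \<Rightarrow> nat list \<Rightarrow> real set" where
  "cyl n \<sigma> = {S_word \<sigma> 0..S_word \<sigma> 0 + \<rho> ^ n}"

lemma S_word_in_cyl: "\<sigma> \<in> words n \<Longrightarrow> S_word \<sigma> x \<in> cyl n \<sigma> \<longleftrightarrow> x \<in> {0..1}"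
  using S_word_affine[of \<sigma> x] mult_le_cancel_left_pos[OF rho_pos(4)[of n], of 0 x]
  by (auto simp: cyl_def length_words)

lemma mu_le_sum:
  assumes "A \<in> sets borel"
  shows "measure \<mu> A \<le> (\<Sum>\<sigma>\<in>{\<sigma>\<in>words n. cyl n \<sigma> \<inter> A \<noteq> {}}. pw \<sigma>)"
proof -
  have "measure \<mu> A = (\<Sum>\<sigma>\<in>words n. pw \<sigma> * measure \<mu> (S_word \<sigma> -` A))" by (rule mu_words[OF assms])
  also have "\<dots> \<le> (\<Sum>\<sigma>\<in>words n. if cyl n \<sigma> \<inter> A \<noteq> {} then pw \<sigma> else 0)"
  proof (rule sum_mono)
    fix \<sigma> assume s: "\<sigma> \<in> words n"
    show "pw \<sigma> * measure \<mu> (S_word \<sigma> -` A) \<le> (if cyl n \<sigma> \<inter> A \<noteq> {} then pw \<sigma> else 0)"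
    proof (cases "cyl n \<sigma> \<inter> A = {}")
      case True
      hence "S_word \<sigma> -` A \<inter> {0..1} = {}" using S_word_in_cyl[OF s] by blast
      hence "measure \<mu> (S_word \<sigma> -` A) = 0" using mu_outside[OF S_vimage_borel[OF assms]] by blast
      thus ?thesis using True by simp
    qed (use pw_pos[OF s] in \<open>simp add: mult_left_le\<close>)
  qed
  also have "\<dots> = (\<Sum>\<sigma>\<in>{\<sigma>\<in>words n. cyl n \<sigma> \<inter> A \<noteq> {}}. pw \<sigma>)" by (simp add: sum.If_cases Int_def)
  finally show ?thesis .
qed

lemma sum_le_mu:
  assumes "A \<in> sets borel"
  shows "(\<Sum>\<sigma>\<in>{\<sigma>\<in>words n. cyl n \<sigma> \<subseteq> A}. pw \<sigma>) \<le> measure \<mu> A"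
proof -
  have "(\<Sum>\<sigma>\<in>{\<sigma>\<in>words n. cyl n \<sigma> \<subseteq> A}. pw \<sigma>) = (\<Sum>\<sigma>\<in>words n. if cyl n \<sigma> \<subseteq> A then pw \<sigma> else 0)"
    by (simp add: sum.If_cases Int_def)
  also have "\<dots> \<le> (\<Sum>\<sigma>\<in>words n. pw \<sigma> * measure \<mu> (S_word \<sigma> -` A))"
  proof (rule sum_mono)
    fix \<sigma> assume s: "\<sigma> \<in> words n"
    show "(if cyl n \<sigma> \<subseteq> A then pw \<sigma> else 0) \<le> pw \<sigma> * measure \<mu> (S_word \<sigma> -` A)"
    proof (cases "cyl n \<sigma> \<subseteq> A")
      case True
      hence "{0..1} \<subseteq> S_word \<sigma> -` A" using S_word_in_cyl[OF s] by blast
      hence "measure \<mu> {0..1} \<le> measure \<mu> (S_word \<sigma> -` A)"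
        using S_vimage_borel[OF assms] mu_sets by (intro finite_measure_mono) auto
      hence "1 \<le> measure \<mu> (S_word \<sigma> -` A)" using mu_unit by simp
      thus ?thesis using True pw_pos[OF s] by simp
    qed (use pw_pos[OF s] in simp)
  qed
  also have "\<dots> = measure \<mu> A" by (rule mu_words[OF assms, symmetric])
  finally show ?thesis .
qed

section \<open>The weight of the cylinders containing a point\<close>

definition G :: "nat \<Rightarrow> real \<Rightarrow> real" where
  "G n z = (\<Sum>\<sigma>\<in>{\<sigma>\<in>words n. z \<in> cyl n \<sigma>}. pw \<sigma>)"

lemma G_alt: "G n z = (\<Sum>\<sigma>\<in>words n. if z \<in> cyl n \<sigma> then pw \<sigma> else 0)"
  by (simp add: G_def sum.If_cases Int_def)

lemma G_nonneg: "0 \<le> G n z"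
  unfolding G_def using pw_pos by (intro sum_nonneg) (auto intro: less_imp_le)

lemma G_le_1: "G n z \<le> 1"
  unfolding G_def sum_pw[of n, symmetric] using pw_pos by (intro sum_mono2) (auto intro: less_imp_le)

lemma cyl_subset_unit: "\<sigma> \<in> words n \<Longrightarrow> cyl n \<sigma> \<subseteq> {0..1}"
  using pts_bounds[of "S_word \<sigma> 0" n] by (auto simp: cyl_def pts_def)

lemma G_outside: "z \<notin> {0..1} \<Longrightarrow> G n z = 0"
  unfolding G_def using cyl_subset_unit by (intro sum.neutral) blast

lemma cyl_append:
  assumes "\<sigma> \<in> words n"
  shows "z \<in> cyl (n + k) (\<sigma> @ \<tau>) \<longleftrightarrow> (z - S_word \<sigma> 0) / \<rho> ^ n \<in> cyl k \<tau>"
  using assms by (auto simp: cyl_def S_word_append_0 length_words pos_le_divide_eq pos_divide_le_eq power_add algebra_simps)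

lemma G_add: "G (n + k) z = (\<Sum>\<sigma>\<in>words n. pw \<sigma> * G k ((z - S_word \<sigma> 0) / \<rho> ^ n))"
  unfolding G_alt sum_words_add
  by (intro sum.cong) (auto simp: cyl_append pw_append sum_distrib_left if_distrib cong: if_cong)

lemma cyl_iff_unit: "\<sigma> \<in> words n \<Longrightarrow> z \<in> cyl n \<sigma> \<longleftrightarrow> (z - S_word \<sigma> 0) / \<rho> ^ n \<in> {0..1}"
  by (auto simp: cyl_def pos_le_divide_eq pos_divide_le_eq algebra_simps)

lemma G_antimono: "G (n + k) z \<le> G n z"
  unfolding G_add unfolding G_alt[of n z]
proof (rule sum_mono)
  fix \<sigma> assume s: "\<sigma> \<in> words n"
  show "pw \<sigma> * G k ((z - S_word \<sigma> 0) / \<rho> ^ n) \<le> (if z \<in> cyl n \<sigma> then pw \<sigma> else 0)"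
    using G_outside[of "(z - S_word \<sigma> 0) / \<rho> ^ n" k] G_le_1[of k "(z - S_word \<sigma> 0) / \<rho> ^ n"] pw_pos[OF s]
    unfolding cyl_iff_unit[OF s] by (auto simp: mult_left_le)
qed

lemma G_ge_word: "\<sigma> \<in> words n \<Longrightarrow> pw \<sigma> * G k ((z - S_word \<sigma> 0) / \<rho> ^ n) \<le> G (n + k) z"
proof -
  assume s: "\<sigma> \<in> words n"
  have "0 \<le> pw \<tau> * G k ((z - S_word \<tau> 0) / \<rho> ^ n)" if "\<tau> \<in> words n" for \<tau>
    using mult_nonneg_nonneg[OF less_imp_le[OF pw_pos[OF that]] G_nonneg] .
  thus ?thesis unfolding G_add using s
    by (intro member_le_sum[where f = "\<lambda>\<sigma>. pw \<sigma> * G k ((z - S_word \<sigma> 0) / \<rho> ^ n)"]) simp_all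
qed

lemma K_in_cyl: "z \<in> K \<Longrightarrow> \<exists>\<sigma>\<in>words n. z \<in> cyl n \<sigma>"
  using cylinder_around[of z n] by (force simp: pts_def cyl_def)

lemma G_ge: "z \<in> K \<Longrightarrow> pmin ^ n \<le> G n z"
proof -
  assume "z \<in> K"
  then obtain \<sigma> where s: "\<sigma> \<in> words n" "z \<in> cyl n \<sigma>" using K_in_cyl by blast
  have "pw \<sigma> \<le> G n z" unfolding G_def using s pw_pos by (intro member_le_sum) (auto intro: less_imp_le)
  thus ?thesis using pw_ge[OF s(1)] by simp
qed

lemma G_pos: "z \<in> K \<Longrightarrow> 0 < G n z"
  using G_ge[of z n] pmin_pos by (meson less_le_trans zero_less_power)

section \<open>Balls and local dimensions along geometric radii\<close>

abbreviation ball_mu :: "real \<Rightarrow> real \<Rightarrow> real" where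
  "ball_mu x r \<equiv> measure \<mu> {x - r..x + r}"

lemma ball_mu_mono: "r \<le> s \<Longrightarrow> ball_mu x r \<le> ball_mu x s"
  using mu_sets by (intro finite_measure_mono) auto

lemma G_le_mu: "G n z \<le> ball_mu z (\<rho> ^ n)"
proof -
  have "G n z \<le> (\<Sum>\<sigma>\<in>{\<sigma>\<in>words n. cyl n \<sigma> \<subseteq> {z - \<rho> ^ n..z + \<rho> ^ n}}. pw \<sigma>)"
    unfolding G_def using pw_pos by (intro sum_mono2) (auto simp: cyl_def intro: less_imp_le)
  also have "\<dots> \<le> ball_mu z (\<rho> ^ n)" by (rule sum_le_mu) simp
  finally show ?thesis .
qed

lemma ball_mu_pos: "x \<in> K \<Longrightarrow> r > 0 \<Longrightarrow> 0 < ball_mu x r"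
proof -
  assume x: "x \<in> K" and r: "r > 0"
  obtain n where "\<rho> ^ n < r" using real_arch_pow_inv[OF r ratio(2)] by blast
  hence "G n x \<le> ball_mu x r" using G_le_mu[of n x] ball_mu_mono[of "\<rho> ^ n" r x] by simp
  thus ?thesis using G_pos[OF x, of n] by simp
qed

lemma ln_rho: "ln \<rho> < 0"
  using ratio by simp

lemma ball_mu_rate: "x \<in> K \<Longrightarrow> ln (ball_mu x (\<rho> ^ n)) / ln \<rho> \<le> (ln pmin / ln \<rho>) * real n"
proof -
  assume x: "x \<in> K"
  have "ln (pmin ^ n) \<le> ln (ball_mu x (\<rho> ^ n))"
    using G_ge[OF x, of n] G_le_mu[of n x] ball_mu_pos[OF x, of "\<rho> ^ n"] pmin_pos by (subst ln_le_cancel_iff) auto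
  hence "ln (ball_mu x (\<rho> ^ n)) / ln \<rho> \<le> ln (pmin ^ n) / ln \<rho>" using ln_rho by (intro divide_right_mono_neg) auto
  thus ?thesis using pmin_pos by (simp add: ln_realpow mult.commute)
qed

text \<open>A constant factor and a shift of the scale change logarithms by bounded amounts or shift
  their index, and both effects vanish after division by \<open>n\<close>. Any sequence comparable
  with the mass of balls in this sense computes the local dimensions.\<close>

lemma local_dim_sequence:
  assumes x: "x \<in> K" and g: "\<And>n. 0 < g n" and C: "C > 0"
    and up: "eventually (\<lambda>n. ball_mu x (\<rho> ^ (n + q)) \<le> C * g n) sequentially"
    and lo: "eventually (\<lambda>n. g (n + q) \<le> C * ball_mu x (\<rho> ^ n)) sequentially"
  shows "upper_local_dim \<mu> x = limsup (\<lambda>n. ereal (ln (g n) / ln \<rho> / real n))"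
    "lower_local_dim \<mu> x = liminf (\<lambda>n. ereal (ln (g n) / ln \<rho> / real n))"
proof -
  define X where "X n = ln (ball_mu x (\<rho> ^ n)) / ln \<rho>" for n
  define Y where "Y n = ln (g n) / ln \<rho>" for n
  define c where "c = \<bar>ln C / ln \<rho>\<bar>"
  define \<beta> where "\<beta> = ln pmin / ln \<rho>"
  have bp: "0 < ball_mu x (\<rho> ^ n)" for n using ball_mu_pos[OF x] by simp
  have X: "X n \<le> \<beta> * real n" for n unfolding X_def \<beta>_def by (rule ball_mu_rate[OF x])
  have \<beta>: "0 \<le> \<beta>" unfolding \<beta>_def using pmin_le_1 pmin_pos ln_rho by (simp add: divide_nonpos_neg)
  \<comment> \<open>\<open>ln \<rho>\<close> is negative, so an upper bound for mass turns into a
    lower bound for its rate.\<close>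
  have cmp: "ln b / ln \<rho> \<le> ln a / ln \<rho> + c" if "a \<le> C * b" "0 < a" "0 < b" for a b
  proof -
    have "ln a \<le> ln (C * b)" using that C by simp
    also have "\<dots> = ln C + ln b" using that C by (simp add: ln_mult)
    finally have "(ln C + ln b) / ln \<rho> \<le> ln a / ln \<rho>" using ln_rho by (intro divide_right_mono_neg) auto
    moreover have "- c \<le> ln C / ln \<rho>" unfolding c_def by linarith
    ultimately show ?thesis by (simp add: add_divide_distrib)
  qed
  have YX: "eventually (\<lambda>n. Y n \<le> X (n + q) + c) sequentially"
    using up by eventually_elim (use cmp g bp in \<open>auto simp: X_def Y_def\<close>)
  have XY: "eventually (\<lambda>n. X n \<le> Y (n + q) + c) sequentially"
    using lo by eventually_elim (use cmp g bp in \<open>auto simp: X_def Y_def\<close>)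
  have Xb: "eventually (\<lambda>n. X n \<le> \<beta> * (real n + 1)) sequentially"
    using \<beta> by (intro always_eventually allI order.trans[OF X] mult_left_mono) auto
  have Yb: "eventually (\<lambda>n. Y n \<le> (\<beta> * (real q + 1) + c) * (real n + 1)) sequentially"
    using YX
  proof eventually_elim
    case (elim n)
    have "Y n \<le> \<beta> * real (n + q) + c" using elim X[of "n + q"] by simp
    also have "\<beta> * real (n + q) \<le> \<beta> * ((real q + 1) * (real n + 1))"
      using \<beta> by (intro mult_left_mono) (auto simp: algebra_simps)
    also have "c \<le> c * (real n + 1)" using mult_left_mono[of 1 "real n + 1" c] by (simp add: c_def)
    finally show ?case by (simp add: algebra_simps)
  qed
  note 1 = limsup_rate_le[OF YX Xb] and 2 = limsup_rate_le[OF XY Yb]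
  have rad: "upper_local_dim \<mu> x = limsup (\<lambda>n. ereal (X n / real n))"
    "lower_local_dim \<mu> x = liminf (\<lambda>n. ereal (X n / real n))"
    unfolding upper_local_dim_def lower_local_dim_def dim_ratio_def X_def
    using ratio ball_mu_pos[OF x] ball_mu_mono ball_mu_rate[OF x]
    by (intro radial_limits[where \<beta> = \<beta>]; simp add: \<beta>_def)+
  show "upper_local_dim \<mu> x = limsup (\<lambda>n. ereal (ln (g n) / ln \<rho> / real n))"
    using antisym[OF 1(1) 2(1)] rad(1) by (simp add: Y_def)
  show "lower_local_dim \<mu> x = liminf (\<lambda>n. ereal (ln (g n) / ln \<rho> / real n))"
    using antisym[OF 1(2) 2(2)] rad(2) by (simp add: Y_def)
qed

lemma local_dim_sequence_lim:
  assumes "x \<in> K" "\<And>n. 0 < g n" "C > 0"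
    and "eventually (\<lambda>n. ball_mu x (\<rho> ^ (n + q)) \<le> C * g n) sequentially"
    and "eventually (\<lambda>n. g (n + q) \<le> C * ball_mu x (\<rho> ^ n)) sequentially"
    and "(\<lambda>n. ln (g n) / real n) \<longlonglongrightarrow> L"
  shows "(dim_ratio \<mu> x \<longlongrightarrow> ereal (L / ln \<rho>)) (at_right 0)"
proof -
  have "(\<lambda>n. ln (g n) / real n / ln \<rho>) \<longlonglongrightarrow> L / ln \<rho>" using assms(6) ln_rho by (intro tendsto_intros) auto
  hence "(\<lambda>n. ereal (ln (g n) / ln \<rho> / real n)) \<longlonglongrightarrow> ereal (L / ln \<rho>)"
    by (simp add: mult.commute)
  hence "limsup (\<lambda>n. ereal (ln (g n) / ln \<rho> / real n)) = ereal (L / ln \<rho>)"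
    "liminf (\<lambda>n. ereal (ln (g n) / ln \<rho> / real n)) = ereal (L / ln \<rho>)"
    using lim_imp_Limsup lim_imp_Liminf sequentially_bot by blast+
  thus ?thesis using local_dim_sequence[OF assms(1-5)] unfolding upper_local_dim_def lower_local_dim_def
    by (intro Liminf_eq_Limsup) auto
qed

end

context finite_type_measure
begin

subsection \<open>Points with finite orbits\<close>

text \<open>If the parent cylinders are within one length of each other, the normalized gap is among
  finitely many positive numbers formed from \<open>F\<close> and the translations. Otherwise the
  parents are already disjoint, and the gap between the children is at least theirs.\<close>

lemma cylinder_gap:
  "\<exists>c>0. \<forall>n. \<forall>s\<in>pts n. \<forall>t\<in>pts n. t + \<rho> ^ n < s \<longrightarrow> c * \<rho> ^ n \<le> s - (t + \<rho> ^ n)"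
proof -
  define D where "D = {x \<in> (\<lambda>(f, i, j). (f + d i - d j) / \<rho> - 1) ` (F \<times> {..m} \<times> {..m}). x > 0}"
  have D: "finite D" unfolding D_def using F_finite by auto
  define c where "c = Min (insert 1 D)"
  have c: "c > 0" "\<And>x. x \<in> D \<Longrightarrow> c \<le> x" using D by (auto simp: c_def) (simp add: D_def)
  have "c * \<rho> ^ n \<le> s - (t + \<rho> ^ n)" if "s \<in> pts n" "t \<in> pts n" "t + \<rho> ^ n < s" for n s t
    using that
  proof (induction n arbitrary: s t)
    case (Suc n)
    obtain s' i where s: "s' \<in> pts n" "i \<le> m" "s = s' + \<rho> ^ n * d i" using pts_SucE[OF Suc.prems(1)] .
    obtain t' j where t: "t' \<in> pts n" "j \<le> m" "t = t' + \<rho> ^ n * d j" using pts_SucE[OF Suc.prems(2)] .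
    have b: "s' \<le> s" "s + \<rho> ^ Suc n \<le> s' + \<rho> ^ n" "t' \<le> t" "t + \<rho> ^ Suc n \<le> t' + \<rho> ^ n"
      using cylinder_nested[of "d i" "Suc 0" s' n] cylinder_nested[of "d j" "Suc 0" t' n] s t by (auto simp: pts_1)
    show ?case
    proof (cases "\<bar>s' - t'\<bar> \<le> \<rho> ^ n")
      case True
      define x where "x = ((s' - t') / \<rho> ^ n + d i - d j) / \<rho> - 1"
      have e: "\<rho> ^ Suc n * x = s - (t + \<rho> ^ Suc n)"
      proof -
        have "\<rho> * (X / \<rho> - 1) = X - \<rho>" for X by (simp add: field_simps)
        hence "\<rho> ^ n * (\<rho> * x) = \<rho> ^ n * ((s' - t') / \<rho> ^ n + d i - d j - \<rho>)" unfolding x_def by simp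
        also have "\<dots> = \<rho> ^ n * ((s' - t') / \<rho> ^ n) + \<rho> ^ n * d i - \<rho> ^ n * d j - \<rho> ^ n * \<rho>"
          by (simp only: distrib_left right_diff_distrib)
        also have "\<rho> ^ n * ((s' - t') / \<rho> ^ n) = s' - t'" by simp
        finally show ?thesis using s t by (simp add: mult_ac)
      qed
      have "0 < \<rho> ^ Suc n * x" unfolding e using Suc.prems by simp
      hence "x > 0" by (rule zero_less_mult_pos) simp
      moreover have "(s' - t') / \<rho> ^ n \<in> F" using F_diff[OF s(1) t(1) True] .
      ultimately have "x \<in> D" unfolding D_def x_def using s(2) t(2)
        by (intro CollectI conjI image_eqI[of _ _ "((s' - t') / \<rho> ^ n, i, j)"]) auto
      hence "c * \<rho> ^ Suc n \<le> x * \<rho> ^ Suc n" using c(2) by (intro mult_right_mono) auto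
      thus ?thesis using e by (simp only: mult.commute)
    next
      case False
      hence "\<rho> ^ n < s' - t' \<or> \<rho> ^ n < t' - s'" by linarith
      hence l: "t' + \<rho> ^ n < s'" using Suc.prems(3) b rho_pos(4)[of "Suc n"] by linarith
      have "c * \<rho> ^ Suc n \<le> c * \<rho> ^ n" using c(1) ratio by (intro mult_left_mono power_decreasing) auto
      also have "\<dots> \<le> s' - (t' + \<rho> ^ n)" using Suc.IH[OF s(1) t(1) l] .
      also have "\<dots> \<le> s - (t + \<rho> ^ Suc n)" using b by simp
      finally show ?thesis .
    qed
  qed simp
  thus ?thesis using c(1) by blast
qed

text \<open>The orbit of \<open>z\<close> under the inverse maps, as long as it stays in \<open>[0, 1]\<close>.\<close>

definition orb :: "real \<Rightarrow> real set" where
  "orb z = {(z - t) / \<rho> ^ n | n t. t \<in> pts n \<and> t \<le> z \<and> z \<le> t + \<rho> ^ n}"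

lemma orbI: "t \<in> pts n \<Longrightarrow> t \<le> z \<Longrightarrow> z \<le> t + \<rho> ^ n \<Longrightarrow> (z - t) / \<rho> ^ n \<in> orb z"
  unfolding orb_def by blast

text \<open>Compare a cylinder missing \<open>z\<close> with one containing \<open>z\<close>. Either
  they are disjoint and \<open>cylinder_gap\<close> applies, or their normalized offset lies in
  \<open>F\<close>; then the normalized distance to \<open>z\<close> is a positive combination of an
  element of \<open>F\<close> and an orbit point, of which there are finitely many.\<close>

lemma ball_le_G:
  assumes z: "z \<in> K" and fin: "finite (orb z)"
  shows "\<exists>c>0. \<forall>n. ball_mu z (c * \<rho> ^ n) \<le> G n z"
proof -
  obtain c1 where c1: "c1 > 0" "\<And>n s t. s \<in> pts n \<Longrightarrow> t \<in> pts n \<Longrightarrow> t + \<rho> ^ n < s \<Longrightarrow> c1 * \<rho> ^ n \<le> s - (t + \<rho> ^ n)"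
    using cylinder_gap by blast
  define E where "E = {x \<in> (\<lambda>(f, w). f - w) ` (F \<times> orb z) \<union> (\<lambda>(f, w). w - f - 1) ` (F \<times> orb z). x > 0}"
  have E: "finite E" unfolding E_def using F_finite fin by auto
  \<comment> \<open>Halving the least distance makes a cylinder that meets the closed ball
    contradict that distance strictly.\<close>
  define c where "c = Min (insert c1 E) / 2"
  have c: "c > 0" using E c1 by (auto simp: c_def) (simp add: E_def)
  have c2: "2 * c \<le> c1" "\<And>x. x \<in> E \<Longrightarrow> 2 * c \<le> x" using E by (auto simp: c_def)
  have "ball_mu z (c * \<rho> ^ n) \<le> G n z" for n
  proof -
    have "z \<in> cyl n \<sigma>" if \<sigma>: "\<sigma> \<in> words n" "cyl n \<sigma> \<inter> {z - c * \<rho> ^ n..z + c * \<rho> ^ n} \<noteq> {}" for \<sigma>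
    proof (rule ccontr)
      assume nz: "z \<notin> cyl n \<sigma>"
      define s where "s = S_word \<sigma> 0"
      have s: "s \<in> pts n" using \<sigma> by (auto simp: s_def pts_def)
      have near: "s \<le> z + c * \<rho> ^ n" "z - c * \<rho> ^ n \<le> s + \<rho> ^ n" using \<sigma>(2) by (auto simp: cyl_def s_def)
      obtain t where t: "t \<in> pts n" "t \<le> z" "z \<le> t + \<rho> ^ n" using cylinder_around[OF z] .
      define w where "w = (z - t) / \<rho> ^ n"
      have w: "w \<in> orb z" "z = t + \<rho> ^ n * w" using orbI[OF t] by (simp_all add: w_def)
      have r0: "0 < c * \<rho> ^ n" using c by simp
      have a: "\<rho> ^ n * ((s - t) / \<rho> ^ n) = s - t" by simp
      have c1c: "2 * (c * \<rho> ^ n) \<le> c1 * \<rho> ^ n" using c2(1) mult_right_mono[of "2 * c" c1 "\<rho> ^ n"] by (simp add: mult_ac)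
      have fin: False if x: "x > 0 \<longrightarrow> x \<in> E" "0 < \<rho> ^ n * x" "\<rho> ^ n * x \<le> c * \<rho> ^ n" for x
      proof -
        have "x > 0" using x(2) by (rule zero_less_mult_pos) simp
        hence "2 * c \<le> x" using x(1) c2(2) by blast
        hence "\<rho> ^ n * (2 * c) \<le> \<rho> ^ n * x" by (intro mult_left_mono) auto
        thus False using x(3) c by (simp add: mult_ac)
      qed
      have "z < s \<or> s + \<rho> ^ n < z" using nz by (auto simp: cyl_def s_def)
      thus False
      proof
        assume zs: "z < s"
        show False
        proof (cases "t + \<rho> ^ n < s")
          case True thus False using c1(2)[OF s t(1) True] near t c1c r0 by linarith
        next
          case False
          hence f: "(s - t) / \<rho> ^ n \<in> F" using zs t s by (intro F_diff) auto
          have e: "\<rho> ^ n * ((s - t) / \<rho> ^ n - w) = s - z"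
            unfolding right_diff_distrib using a w(2) by linarith
          show False
          proof (rule fin[of "(s - t) / \<rho> ^ n - w"])
            show "0 < (s - t) / \<rho> ^ n - w \<longrightarrow> (s - t) / \<rho> ^ n - w \<in> E"
              using f w(1) unfolding E_def by (intro impI CollectI conjI UnI1 image_eqI[of _ _ "((s - t) / \<rho> ^ n, w)"]) auto
          qed (use e zs near in auto)
        qed
      next
        assume zs: "s + \<rho> ^ n < z"
        show False
        proof (cases "s + \<rho> ^ n < t")
          case True thus False using c1(2)[OF t(1) s True] near t c1c r0 by linarith
        next
          case False
          hence f: "(s - t) / \<rho> ^ n \<in> F" using zs t s by (intro F_diff) auto
          have e: "\<rho> ^ n * (w - (s - t) / \<rho> ^ n - 1) = z - (s + \<rho> ^ n)"
            unfolding right_diff_distrib using a w(2) by linarith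
          show False
          proof (rule fin[of "w - (s - t) / \<rho> ^ n - 1"])
            show "0 < w - (s - t) / \<rho> ^ n - 1 \<longrightarrow> w - (s - t) / \<rho> ^ n - 1 \<in> E"
              using f w(1) unfolding E_def by (intro impI CollectI conjI UnI2 image_eqI[of _ _ "((s - t) / \<rho> ^ n, w)"]) auto
          qed (use e zs near in auto)
        qed
      qed
    qed
    hence "{\<sigma> \<in> words n. cyl n \<sigma> \<inter> {z - c * \<rho> ^ n..z + c * \<rho> ^ n} \<noteq> {}} \<subseteq> {\<sigma> \<in> words n. z \<in> cyl n \<sigma>}" by blast
    hence "(\<Sum>\<sigma>\<in>{\<sigma> \<in> words n. cyl n \<sigma> \<inter> {z - c * \<rho> ^ n..z + c * \<rho> ^ n} \<noteq> {}}. pw \<sigma>) \<le> G n z"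
      unfolding G_def using pw_pos by (intro sum_mono2) (auto intro: less_imp_le)
    thus ?thesis using mu_le_sum[of "{z - c * \<rho> ^ n..z + c * \<rho> ^ n}" n] by simp
  qed
  thus ?thesis using c by blast
qed

lemma orb_closed:
  assumes "w \<in> orb z" "\<sigma> \<in> words k" "w \<in> cyl k \<sigma>"
  shows "(w - S_word \<sigma> 0) / \<rho> ^ k \<in> orb z"
proof -
  obtain n t where t: "t \<in> pts n" "w = (z - t) / \<rho> ^ n" using assms(1) by (auto simp: orb_def)
  define u where "u = S_word \<sigma> 0"
  have u: "u \<in> pts k" using assms(2) by (auto simp: u_def pts_def)
  have z: "z = t + \<rho> ^ n * w" by (simp add: t(2))
  have "\<rho> ^ n * u \<le> \<rho> ^ n * w" "\<rho> ^ n * w \<le> \<rho> ^ n * (u + \<rho> ^ k)"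
    using assms(3) by (auto intro!: mult_left_mono simp: cyl_def u_def)
  hence "t + \<rho> ^ n * u \<le> z" "z \<le> t + \<rho> ^ n * u + \<rho> ^ (n + k)" by (auto simp: z power_add distrib_left)
  hence "(z - (t + \<rho> ^ n * u)) / \<rho> ^ (n + k) \<in> orb z" using pts_addI[OF t(1) u] by (intro orbI)
  moreover have "z - (t + \<rho> ^ n * u) = \<rho> ^ n * (w - u)" by (simp add: z right_diff_distrib)
  ultimately show ?thesis by (simp add: power_add u_def)
qed

lemma orb_refl: "z \<in> K \<Longrightarrow> z \<in> orb z"
  using orbI[of 0 0 z] K_subset by auto

lemma orb_weight: "w \<in> orb z \<Longrightarrow> \<exists>\<delta>>0. \<forall>n. \<delta> * G n w \<le> G n z"
proof -
  assume "w \<in> orb z"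
  then obtain k t where t: "t \<in> pts k" "w = (z - t) / \<rho> ^ k" by (auto simp: orb_def)
  then obtain \<sigma> where s: "\<sigma> \<in> words k" "t = S_word \<sigma> 0" by (auto simp: pts_def)
  have "pw \<sigma> * G n w \<le> G n z" for n
    using G_ge_word[OF s(1), of n z] G_antimono[of n k z] t s by (simp add: add.commute)
  thus ?thesis using pw_pos[OF s(1)] by blast
qed

text \<open>By monotonicity of \<open>G\<close> in \<open>n\<close>, the growth along \<open>z\<close> is comparable to the maximal growth along its
  orbit, and the latter is submultiplicative.\<close>

lemma G_rate:
  assumes z: "z \<in> K" and fin: "finite (orb z)"
  shows "\<exists>L. (\<lambda>n. ln (G n z) / real n) \<longlonglongrightarrow> L"
proof -
  define M where "M n = Max ((\<lambda>w. G n w) ` orb z)" for n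
  have ub: "G n w \<le> M n" if "w \<in> orb z" for n w
    unfolding M_def using fin that by (intro Max_ge) auto
  have M_pos: "0 < M n" for n using G_pos[OF z, of n] ub[OF orb_refl[OF z], of n] by simp
  have att: "\<exists>w\<in>orb z. M n = G n w" for n
  proof -
    have "M n \<in> (\<lambda>w. G n w) ` orb z" unfolding M_def using fin orb_refl[OF z] by (intro Max_in) auto
    thus ?thesis by blast
  qed
  have sub: "M (n + k) \<le> M n * M k" for n k
  proof -
    obtain w where w: "w \<in> orb z" "M (n + k) = G (n + k) w" using att by blast
    have "G (n + k) w \<le> (\<Sum>\<sigma>\<in>words n. (if w \<in> cyl n \<sigma> then pw \<sigma> else 0) * M k)"
      unfolding G_add
    proof (rule sum_mono)
      fix \<sigma> assume s: "\<sigma> \<in> words n"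
      show "pw \<sigma> * G k ((w - S_word \<sigma> 0) / \<rho> ^ n) \<le> (if w \<in> cyl n \<sigma> then pw \<sigma> else 0) * M k"
      proof (cases "w \<in> cyl n \<sigma>")
        case True
        thus ?thesis using ub[OF orb_closed[OF w(1) s True]] pw_pos[OF s] by (simp add: mult_left_mono)
      next
        case False
        hence "(w - S_word \<sigma> 0) / \<rho> ^ n \<notin> {0..1}" using cyl_iff_unit[OF s] by blast
        thus ?thesis using G_outside False by simp
      qed
    qed
    also have "\<dots> = G n w * M k" by (simp add: G_alt sum_distrib_right)
    also have "\<dots> \<le> M n * M k" using ub[OF w(1)] M_pos by (intro mult_right_mono) (auto intro: less_imp_le)
    finally show ?thesis using w by simp
  qed
  have "\<exists>L. (\<lambda>n. ln (M n) / real n) \<longlonglongrightarrow> L"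
  proof (rule fekete[where C = "- ln pmin"])
    show "ln (M (n + k)) \<le> ln (M n) + ln (M k)" for n k
    proof -
      have "ln (M (n + k)) \<le> ln (M n * M k)" using sub[of n k] M_pos[of "n + k"] M_pos[of n] M_pos[of k] by simp
      thus ?thesis using M_pos[of n] M_pos[of k] by (simp add: ln_mult)
    qed
    show "- (- ln pmin) * real n \<le> ln (M n)" for n
    proof -
      have "ln (pmin ^ n) \<le> ln (M n)"
        using G_ge[OF z, of n] ub[OF orb_refl[OF z], of n] M_pos[of n] pmin_pos by simp
      thus ?thesis using pmin_pos by (simp add: ln_realpow mult.commute)
    qed
  qed
  then obtain L where L: "(\<lambda>n. ln (M n) / real n) \<longlonglongrightarrow> L" by blast
  \<comment> \<open>Each orbit point is reached from \<open>z\<close> by a fixed word, whose weight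
    is lost only once. As the orbit is finite, one constant serves for all.\<close>
  have "\<forall>w\<in>orb z. \<exists>\<delta>. \<delta> > 0 \<and> (\<forall>n. \<delta> * G n w \<le> G n z)" using orb_weight by blast
  from bchoice[OF this] obtain \<delta> where \<delta>: "\<And>w. w \<in> orb z \<Longrightarrow> \<delta> w > 0" "\<And>w n. w \<in> orb z \<Longrightarrow> \<delta> w * G n w \<le> G n z"
    by blast
  define \<delta>0 where "\<delta>0 = Min (\<delta> ` orb z)"
  have d0: "\<delta>0 > 0" unfolding \<delta>0_def using fin orb_refl[OF z] \<delta>(1) by (subst Min_gr_iff) auto
  have low: "\<delta>0 * M n \<le> G n z" for n
  proof -
    obtain w where w: "w \<in> orb z" "M n = G n w" using att by blast
    have "\<delta>0 * G n w \<le> \<delta> w * G n w" unfolding \<delta>0_def using fin w by (intro mult_right_mono Min_le G_nonneg) auto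
    thus ?thesis using \<delta>(2)[OF w(1), of n] w(2) by simp
  qed
  have "(\<lambda>n. ln (G n z) / real n) \<longlonglongrightarrow> L"
  proof (rule tendsto_sandwich[of "\<lambda>n. ln \<delta>0 / real n + ln (M n) / real n" _ _ "\<lambda>n. ln (M n) / real n"])
    show "\<forall>\<^sub>F n in sequentially. ln \<delta>0 / real n + ln (M n) / real n \<le> ln (G n z) / real n"
    proof (intro always_eventually allI)
      fix n
      have "ln (\<delta>0 * M n) \<le> ln (G n z)" using low[of n] d0 M_pos[of n] G_pos[OF z, of n] by simp
      hence "ln \<delta>0 + ln (M n) \<le> ln (G n z)" using d0 M_pos[of n] by (simp add: ln_mult)
      hence "(ln \<delta>0 + ln (M n)) / real n \<le> ln (G n z) / real n" by (intro divide_right_mono) auto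
      thus "ln \<delta>0 / real n + ln (M n) / real n \<le> ln (G n z) / real n" by (simp add: add_divide_distrib)
    qed
    show "\<forall>\<^sub>F n in sequentially. ln (G n z) / real n \<le> ln (M n) / real n"
      using ub[OF orb_refl[OF z]] G_pos[OF z] M_pos by (intro always_eventually allI divide_right_mono) auto
    show "(\<lambda>n. ln \<delta>0 / real n + ln (M n) / real n) \<longlonglongrightarrow> L"
      using tendsto_add[OF lim_const_over_n[of "ln \<delta>0"] L] by simp
  qed (rule L)
  thus ?thesis by blast
qed

lemma finite_orb_local_dim:
  assumes z: "z \<in> K" and fin: "finite (orb z)"
  shows "\<exists>L. (\<lambda>n. ln (G n z) / real n) \<longlonglongrightarrow> L \<and> (dim_ratio \<mu> z \<longlongrightarrow> ereal (L / ln \<rho>)) (at_right 0)"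
proof -
  obtain L where L: "(\<lambda>n. ln (G n z) / real n) \<longlonglongrightarrow> L" using G_rate[OF assms] by blast
  obtain c where c: "c > 0" "\<And>n. ball_mu z (c * \<rho> ^ n) \<le> G n z" using ball_le_G[OF assms] by blast
  obtain q where q: "\<rho> ^ q < c" using real_arch_pow_inv[OF c(1) ratio(2)] by blast
  have "(dim_ratio \<mu> z \<longlongrightarrow> ereal (L / ln \<rho>)) (at_right 0)"
  proof (rule local_dim_sequence_lim[OF z, where g = "\<lambda>n. G n z" and C = 1 and q = q])
    have "ball_mu z (\<rho> ^ (n + q)) \<le> 1 * G n z" for n
    proof -
      have "\<rho> ^ q * \<rho> ^ n \<le> c * \<rho> ^ n" using q by (intro mult_right_mono) auto
      hence "\<rho> ^ (n + q) \<le> c * \<rho> ^ n" by (simp add: power_add mult.commute)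
      from ball_mu_mono[OF this, of z] show ?thesis using c(2)[of n] by linarith
    qed
    thus "\<forall>\<^sub>F n in sequentially. ball_mu z (\<rho> ^ (n + q)) \<le> 1 * G n z" by simp
    have "G (n + q) z \<le> 1 * ball_mu z (\<rho> ^ n)" for n using G_antimono[of n q z] G_le_mu[of n z] by simp
    thus "\<forall>\<^sub>F n in sequentially. G (n + q) z \<le> 1 * ball_mu z (\<rho> ^ n)" by simp
  qed (use G_pos[OF z] L in auto)
  thus ?thesis using L by blast
qed

text \<open>From level \<open>N\<close> on, an orbit point is the position of \<open>z\<close> in
  \<open>\<Delta> n\<close> plus the offset of \<open>\<Delta> n\<close> in a cylinder over it. The
  positions repeat with the period, and the offsets lie in \<open>F1\<close>.\<close>

lemma periodic_finite_orb:
  assumes "period_of z \<theta>"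
  shows "finite (orb z)"
proof -
  obtain \<gamma> J where cyc: "admissible_cycle \<theta>" and rep: "symbolic_rep z \<gamma>"
    and per: "\<And>k. \<gamma> (Suc J + k) = butlast \<theta> ! (k mod length (butlast \<theta>))"
    using assms by (auto simp: period_of_def)
  define N where "N = Suc J"
  define L where "L = length (butlast \<theta>)"
  have "length \<theta> \<ge> 2" using cyc by (simp add: admissible_cycle_def)
  hence L: "L \<ge> 1" unfolding L_def length_butlast by linarith
  obtain \<Delta> where \<Delta>: "\<And>n. \<Delta> n \<in> net_intervals n" "\<And>n. z \<in> ivl_set (\<Delta> n)"
    "\<And>n. parent n (\<Delta> n) (\<Delta> (Suc n))" "\<And>n. \<gamma> n = char_vec n (\<Delta> n)"
    using rep unfolding symbolic_rep_def by blast
  have char: "char_vec n (\<Delta> n) = char_vec (n + L) (\<Delta> (n + L))" if nN: "n \<ge> N" for n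
  proof -
    obtain k where n: "n = Suc J + k" using le_Suc_ex[of "Suc J" n] nN unfolding N_def by blast
    show ?thesis using per[of k] per[of "k + L"] \<Delta>(4) by (simp add: n L_def add_ac)
  qed
  define \<xi> where "\<xi> n = (z - fst (\<Delta> n)) / \<rho> ^ n" for n
  have \<xi>01: "0 \<le> \<xi> n" "\<xi> n \<le> 1" for n
  proof -
    obtain t where "t \<in> nb n (\<Delta> n)" using nb_nonempty[OF \<Delta>(1)] by blast
    hence "snd (\<Delta> n) - fst (\<Delta> n) \<le> \<rho> ^ n" by (auto simp: nb_def)
    thus "0 \<le> \<xi> n" "\<xi> n \<le> 1" using \<Delta>(2)[of n] by (auto simp: \<xi>_def)
  qed
  have step: "\<xi> n - \<xi> (n + L) = \<rho> * (\<xi> (Suc n) - \<xi> (Suc n + L))" if n: "n \<ge> N" for n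
  proof -
    have st: "same_type n (\<Delta> n) (n + L) (\<Delta> (n + L))" using char[OF n] \<Delta>(1) by (intro same_type_char)
    have "\<Delta> (Suc (n + L)) = tri n (\<Delta> n) (n + L) (\<Delta> (n + L)) (\<Delta> (Suc n))"
      using child_eq_tri[OF st \<Delta>(3) \<Delta>(3)] char[of "Suc n"] n by simp
    hence "fst (\<Delta> (Suc (n + L))) - fst (\<Delta> (n + L)) = \<rho> ^ (n + L) * ((fst (\<Delta> (Suc n)) - fst (\<Delta> n)) / \<rho> ^ n)"
      by (simp add: tr_def)
    hence e: "(fst (\<Delta> (Suc (n + L))) - fst (\<Delta> (n + L))) / \<rho> ^ (n + L) = (fst (\<Delta> (Suc n)) - fst (\<Delta> n)) / \<rho> ^ n"
      by simp
    have x: "\<xi> k = (fst (\<Delta> (Suc k)) - fst (\<Delta> k)) / \<rho> ^ k + \<rho> * \<xi> (Suc k)" for k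
    proof -
      have "\<rho> * \<xi> (Suc k) = (z - fst (\<Delta> (Suc k))) / \<rho> ^ k" by (simp add: \<xi>_def)
      thus ?thesis by (simp add: \<xi>_def add_divide_distrib[symmetric])
    qed
    show ?thesis using x[of n] x[of "n + L"] e by (simp add: right_diff_distrib)
  qed
  \<comment> \<open>By \<open>step\<close> the difference of the two positions is
    \<open>\<rho> ^ k\<close> times a difference of positions \<open>k\<close> levels deeper, which
    is at most 1. So it is 0.\<close>
  have \<xi>_per: "\<xi> (n + L) = \<xi> n" if n: "n \<ge> N" for n
  proof -
    have "\<bar>\<xi> n - \<xi> (n + L)\<bar> \<le> \<rho> ^ k" for k
    proof -
      have "\<xi> n - \<xi> (n + L) = \<rho> ^ k * (\<xi> (n + k) - \<xi> (n + k + L))"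
      proof (induction k)
        case (Suc k) thus ?case using step[of "n + k"] n by simp
      qed simp
      moreover have "\<bar>\<xi> (n + k) - \<xi> (n + k + L)\<bar> \<le> 1"
        using \<xi>01[of "n + k"] \<xi>01[of "n + k + L"] by linarith
      ultimately show ?thesis by (simp add: abs_mult mult_left_le)
    qed
    moreover have "(\<lambda>k. \<rho> ^ k) \<longlonglongrightarrow> 0" using ratio by (intro LIMSEQ_realpow_zero) auto
    ultimately have "\<bar>\<xi> n - \<xi> (n + L)\<bar> \<le> 0" by (intro LIMSEQ_le_const) auto
    thus ?thesis by simp
  qed
  have \<xi>_fin: "\<xi> n \<in> \<xi> ` {N..<N + L}" if "n \<ge> N" for n
    using that
  proof (induction n rule: less_induct)
    case (less n)
    show ?case
    proof (cases "n < N + L")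
      case False
      hence "\<xi> (n - L) = \<xi> n" using \<xi>_per[of "n - L"] by simp
      thus ?thesis using less.IH[of "n - L"] False L by auto
    qed (use less in auto)
  qed
  \<comment> \<open>0 and 1 stand for the cases in which \<open>z\<close> is an end of the cylinder;
    then the cylinder may lie on the other side of \<open>z\<close> from
    \<open>\<Delta> n\<close>.\<close>
  let ?B = "(\<Union>n<N. (\<lambda>t. (z - t) / \<rho> ^ n) ` pts n) \<union> {0, 1} \<union> (\<lambda>(x, v). x + v) ` (\<xi> ` {N..<N + L} \<times> F1)"
  have "orb z \<subseteq> ?B"
  proof
    fix w assume "w \<in> orb z"
    then obtain n t where w: "t \<in> pts n" "t \<le> z" "z \<le> t + \<rho> ^ n" "w = (z - t) / \<rho> ^ n" by (auto simp: orb_def)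
    show "w \<in> ?B"
    proof (cases "n < N \<or> t = z \<or> z = t + \<rho> ^ n")
      case True thus ?thesis using w by auto
    next
      case False
      hence n: "n \<ge> N" "t < z" "z < t + \<rho> ^ n" using w by auto
      have zz: "fst (\<Delta> n) \<le> z" "z \<le> snd (\<Delta> n)" using \<Delta>(2)[of n] by auto
      have c: "t \<le> fst (\<Delta> n)" "snd (\<Delta> n) \<le> t + \<rho> ^ n" using net_cover[OF \<Delta>(1) w(1)] n zz by auto
      have "(fst (\<Delta> n) - t) / \<rho> ^ n \<in> F1"
        using \<Delta>(1)[of n] c zz n w(1) by (intro endpoint_in_F1) (auto simp: net_iff)
      moreover have "w = \<xi> n + (fst (\<Delta> n) - t) / \<rho> ^ n" by (simp add: w(4) \<xi>_def diff_divide_distrib)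
      ultimately have "w \<in> (\<lambda>(x, v). x + v) ` (\<xi> ` {N..<N + L} \<times> F1)"
        using \<xi>_fin[OF n(1)] by (intro image_eqI[of _ _ "(\<xi> n, (fst (\<Delta> n) - t) / \<rho> ^ n)"]) auto
      thus ?thesis by blast
    qed
  qed
  moreover have "finite ?B" using F1_finite by auto
  ultimately show ?thesis by (rule finite_subset)
qed

lemma periodic_local_dim:
  assumes "periodic_point z"
  shows "\<exists>L. (\<lambda>n. ln (G n z) / real n) \<longlonglongrightarrow> L \<and> (dim_ratio \<mu> z \<longlongrightarrow> ereal (L / ln \<rho>)) (at_right 0)"
  using assms periodic_finite_orb finite_orb_local_dim by (auto simp: periodic_point_def)

end

context positive_row_ifs
begin

subsection \<open>Interior essential periodic points\<close>

lemma net_fst_unique: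
  assumes "\<Delta> \<in> net_intervals n" "\<Delta>' \<in> net_intervals n" "fst \<Delta> = fst \<Delta>'"
  shows "\<Delta> = \<Delta>'"
  using net_unique[OF assms(1,2), of "(fst \<Delta> + min (snd \<Delta>) (snd \<Delta>')) / 2"] net_less[OF assms(1)] net_less[OF assms(2)] assms(3)
  by (auto simp: min_def split: if_splits)

lemma net_snd_unique:
  assumes "\<Delta> \<in> net_intervals n" "\<Delta>' \<in> net_intervals n" "snd \<Delta> = snd \<Delta>'"
  shows "\<Delta> = \<Delta>'"
  using net_unique[OF assms(1,2), of "(snd \<Delta> + max (fst \<Delta>) (fst \<Delta>')) / 2"] net_less[OF assms(1)] net_less[OF assms(2)] assms(3)
  by (auto simp: max_def split: if_splits)

text \<open>The iterates \<open>c q\<close> of 1 under the contraction stay in the closed set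
  \<open>K\<close> and converge to its fixed point.\<close>

lemma fixed_point_in_K:
  assumes "v \<in> pts L" "z = v + \<rho> ^ L * z" "L \<ge> 1"
  shows "z \<in> K"
proof -
  define c where "c q = z + (\<rho> ^ L) ^ q * (1 - z)" for q
  have "c q \<in> K" for q
  proof (induction q)
    case (Suc q)
    have "v + \<rho> ^ L * c q = (v + \<rho> ^ L * z) + \<rho> ^ L * (\<rho> ^ L) ^ q * (1 - z)"
      by (simp add: c_def distrib_left mult.assoc)
    hence "c (Suc q) = v + \<rho> ^ L * c q" using assms(2) by (simp add: c_def)
    thus ?case using cylinder_subset_K[OF assms(1) Suc] by simp
  qed (simp add: c_def one_in_K)
  moreover have "c \<longlonglongrightarrow> z"
  proof -
    have "\<rho> ^ L < 1" using ratio assms(3) by (simp add: power_Suc_less_one power_less_one_iff)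
    hence "(\<lambda>q. z + (\<rho> ^ L) ^ q * (1 - z)) \<longlonglongrightarrow> z + 0 * (1 - z)"
      by (intro tendsto_intros LIMSEQ_realpow_zero) auto
    thus ?thesis by (simp add: c_def[abs_def])
  qed
  ultimately show ?thesis using compact_imp_closed[OF K_compact] closed_sequentially by blast
qed

text \<open>The periodic point is the fixed point \<open>y\<close> of the affine map from \<open>E0\<close> to its copy \<open>E1\<close>.\<close>

context
  fixes J k l :: nat and E0 D E1 :: ivl
  assumes ess: "essential J E0"
    and D: "D \<in> net_intervals (J + k)" "inside D E0"
    and E1: "E1 \<in> net_intervals (J + k + l)" "fst D < fst E1" "snd E1 < snd D"
    and char: "char_vec (J + k + l) E1 = char_vec J E0"
    and spr: "\<And>s. s \<in> nb (J + k) D \<Longrightarrow> spreads (J + k) s l E1"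
begin

private definition L where "L = k + l"
private definition y where "y = (fst E1 - \<rho> ^ L * fst E0) / (1 - \<rho> ^ L)"
private abbreviation "\<psi> \<equiv> tr J E0 (J + L) E1"

private lemma E0: "E0 \<in> net_intervals J"
  using ess by (simp add: essential_def)

private lemma E1': "E1 \<in> net_intervals (J + L)" "char_vec (J + L) E1 = char_vec J E0"
  using E1 char by (simp_all add: L_def add.assoc)

private lemma strict: "fst E0 < fst E1" "snd E1 < snd E0" "inside E1 E0" "inside E1 D"
  using E1 D(2) by (auto simp: inside_def)

private lemma L_pos: "L \<ge> 1"
proof (rule ccontr)
  assume "\<not> ?thesis"
  hence "L = 0" by simp
  hence "E1 = E0" using E1'(1) E0 strict(3) ancestor_unique[of E1 J E1 J E0] by simp
  thus False using strict by simp
qed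

private lemma rhoL: "0 < \<rho> ^ L" "\<rho> ^ L < 1"
  using ratio L_pos by (simp_all add: power_less_one_iff)

private lemma st: "same_type J E0 (J + L) E1"
  using E0 E1' by (intro same_type_char) auto

private lemma y_fst: "y - fst E1 = \<rho> ^ L * (y - fst E0)" "y - fst E0 > 0"
proof -
  have e: "y * (1 - \<rho> ^ L) = fst E1 - \<rho> ^ L * fst E0" using rhoL by (simp add: y_def)
  thus "y - fst E1 = \<rho> ^ L * (y - fst E0)" by (simp add: algebra_simps)
  have "(y - fst E0) * (1 - \<rho> ^ L) = fst E1 - fst E0" using e by (simp add: algebra_simps)
  hence "0 < (1 - \<rho> ^ L) * (y - fst E0)" using strict by (simp add: mult.commute)
  thus "y - fst E0 > 0" by (rule zero_less_mult_pos) (use rhoL in simp)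
qed

private lemma psi_y: "\<psi> y = y"
proof -
  have "\<rho> ^ (J + L) * ((y - fst E0) / \<rho> ^ J) = \<rho> ^ L * (y - fst E0)" by (simp add: power_add)
  thus ?thesis using y_fst(1) by (simp add: tr_def)
qed

private lemma y_in_E1: "fst E1 < y" "y < snd E1"
proof -
  have "0 < \<rho> ^ L * (y - fst E0)" using y_fst(2) by (intro mult_pos_pos) auto
  thus "fst E1 < y" using y_fst(1) by simp
  have "snd E1 - y = \<rho> ^ (J + L) * ((snd E0 - y) / \<rho> ^ J)"
    using tr_diff[of J E0 "J + L" E1 "snd E0" y] psi_y tr_snd[OF st] by simp
  hence e: "snd E1 - y = \<rho> ^ L * (snd E0 - y)" by (simp add: power_add)
  hence "(1 - \<rho> ^ L) * (snd E0 - y) = snd E0 - snd E1" by (simp add: algebra_simps)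
  hence "0 < (1 - \<rho> ^ L) * (snd E0 - y)" using strict by simp
  hence "0 < snd E0 - y" by (rule zero_less_mult_pos) (use rhoL in simp)
  hence "0 < \<rho> ^ L * (snd E0 - y)" by (intro mult_pos_pos) auto
  thus "y < snd E1" using e by simp
qed

private lemma y_in: "fst E0 < y" "y < snd E0" "fst D < y" "y < snd D"
  using y_in_E1 strict E1 by auto

private lemma psi_inv_y: "tr (J + L) E1 J E0 y = y"
  by (subst (1) psi_y[symmetric]) (rule tr_inverse)

text \<open>Pulling back along \<open>\<psi>\<close>, which fixes \<open>y\<close>, lowers the level
  by \<open>L\<close>. So an endpoint of level \<open>J + q * L\<close> at \<open>y\<close> would
  descend to one of level \<open>J\<close> in the interior of \<open>E0\<close>.\<close>

private lemma y_not_endpoint: "y \<notin> endpoints n"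
proof -
  have "y \<notin> endpoints (J + q * L)" for q
  proof (induction q)
    case 0
    have "y \<in> {fst E0<..<snd E0}" using y_in by simp
    hence "y \<notin> endpoints J" using E0 unfolding net_iff by blast
    thus ?case by simp
  next
    case (Suc q)
    show ?case
    proof
      assume "y \<in> endpoints (J + Suc q * L)"
      hence "y \<in> endpoints (J + L + q * L)" by (simp add: add_ac)
      from tr_endpoints[OF same_type_sym[OF st] this] have "y \<in> endpoints (J + q * L)"
        using y_in_E1 psi_inv_y by simp
      thus False using Suc by simp
    qed
  qed
  moreover have "n \<le> J + n * L" using L_pos by (simp add: trans_le_add2)
  ultimately show ?thesis using endpoints_mono_le by blast
qed

text \<open>The positive row property leads from \<open>s\<close> to some neighbour of
  \<open>D\<close>, from which all neighbours of \<open>E1\<close> are reached. This is the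
  positivity of the matrix of the period.\<close>

private lemma connected: "s \<in> nb J E0 \<Longrightarrow> s' \<in> nb (J + L) E1 \<Longrightarrow> \<exists>v\<in>pts L. s' = s + \<rho> ^ J * v"
proof -
  assume s: "s \<in> nb J E0" "s' \<in> nb (J + L) E1"
  obtain u where u: "u \<in> pts k" "s + \<rho> ^ J * u \<in> nb (J + k) D" using positive_row[OF ess D s(1)] by blast
  have "spreads J s (k + l) E1" using spreads_trans[OF u(1) spr[OF u(2)]] .
  thus ?thesis using s(2) by (simp add: spreads_def L_def)
qed

private lemma rel_psi: "(y - \<psi> s) / \<rho> ^ (J + L) = (y - s) / \<rho> ^ J"
  using tr_norm_diff[of J E0 "J + L" E1 y s 0] tr_diff[of J E0 "J + L" E1 y s] psi_y by (simp add: power_add)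

text \<open>Some word leads from \<open>s\<close> to its copy \<open>\<psi> s\<close>, and
  \<open>y\<close> has the same normalized position in both cylinders. That position is the fixed
  point of the map of this word.\<close>

private lemma fixed_rel:
  assumes "s \<in> nb J E0" shows "(y - s) / \<rho> ^ J \<in> K"
proof -
  obtain v where v: "v \<in> pts L" "\<psi> s = s + \<rho> ^ J * v" using connected[OF assms tr_nb[OF st assms]] by blast
  have "(y - s) / \<rho> ^ J = v + \<rho> ^ L * ((y - \<psi> s) / \<rho> ^ (J + L))"
    unfolding v(2) by (simp add: power_add field_simps)
  thus ?thesis unfolding rel_psi using fixed_point_in_K[OF v(1)] L_pos by blast
qed

private lemma y_in_K: "y \<in> K"
proof -
  obtain s where s: "s \<in> nb J E0" using nb_nonempty[OF E0] by blast
  have "s + \<rho> ^ J * ((y - s) / \<rho> ^ J) \<in> K" using s by (intro cylinder_subset_K fixed_rel) (auto simp: nb_def)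
  thus ?thesis by simp
qed

private definition \<Delta> where "\<Delta> n = (SOME \<Delta>. \<Delta> \<in> net_intervals n \<and> fst \<Delta> < y \<and> y < snd \<Delta>)"

private lemma \<Delta>: "\<Delta> n \<in> net_intervals n" "fst (\<Delta> n) < y" "y < snd (\<Delta> n)"
proof -
  have "\<exists>\<Delta>. \<Delta> \<in> net_intervals n \<and> fst \<Delta> < y \<and> y < snd \<Delta>"
    using net_around[OF y_in_K y_not_endpoint[of n]] by metis
  hence "\<Delta> n \<in> net_intervals n \<and> fst (\<Delta> n) < y \<and> y < snd (\<Delta> n)" unfolding \<Delta>_def by (rule someI_ex)
  thus "\<Delta> n \<in> net_intervals n" "fst (\<Delta> n) < y" "y < snd (\<Delta> n)" by auto
qed

private lemma \<Delta>_eq: "E \<in> net_intervals n \<Longrightarrow> fst E < y \<Longrightarrow> y < snd E \<Longrightarrow> \<Delta> n = E"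
  using net_unique[OF \<Delta>(1)] \<Delta> by blast

private lemma \<Delta>_parent: "parent n (\<Delta> n) (\<Delta> (Suc n))"
  using net_inside_if_meet[of "\<Delta> (Suc n)" n 1 "\<Delta> n" y] \<Delta> by (simp add: parent_iff)

private lemma \<Delta>_char: "n \<ge> J \<Longrightarrow> char_vec (n + L) (\<Delta> (n + L)) = char_vec n (\<Delta> n)"
proof -
  assume "n \<ge> J"
  then obtain i where n: "n = J + i" using le_Suc_ex by blast
  have i: "inside (\<Delta> n) E0" unfolding n using net_inside_if_meet[of "\<Delta> (J + i)" J i E0 y] \<Delta> E0 y_in by blast
  have net: "tri J E0 (J + L) E1 (\<Delta> n) \<in> net_intervals (J + L + i)"
    using tri_net[OF st _ i, of i] \<Delta>(1)[of n] by (simp add: n)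
  have "\<psi> (fst (\<Delta> n)) < \<psi> y" "\<psi> y < \<psi> (snd (\<Delta> n))" using \<Delta> by simp_all
  hence "\<Delta> (J + L + i) = tri J E0 (J + L) E1 (\<Delta> n)" using net psi_y by (intro \<Delta>_eq) auto
  moreover have "char_vec (J + L + i) (tri J E0 (J + L) E1 (\<Delta> n)) = char_vec (J + i) (\<Delta> n)"
    using char_vec_tri'[OF E0 E1'(1) E1'(2)[symmetric] _ i] \<Delta>(1)[of n] by (simp add: n)
  ultimately show ?thesis by (simp add: n add_ac)
qed

private lemma \<Delta>_char_mod: "char_vec (J + i) (\<Delta> (J + i)) = char_vec (J + i mod L) (\<Delta> (J + i mod L))"
proof (induction i rule: less_induct)
  case (less i)
  show ?case
  proof (cases "i < L")
    case False
    hence "char_vec (J + (i - L) + L) (\<Delta> (J + (i - L) + L)) = char_vec (J + (i - L)) (\<Delta> (J + (i - L)))"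
      by (intro \<Delta>_char) simp
    thus ?thesis using less.IH[of "i - L"] False L_pos by (simp add: le_mod_geq)
  qed simp
qed

private lemma interior_y: "interior_essential y"
proof -
  have "\<not> boundary_point y"
  proof
    assume "boundary_point y"
    then obtain n E where "E \<in> net_intervals n" "y = fst E \<or> y = snd E" unfolding boundary_point_def by blast
    hence "y \<in> endpoints n" by (auto simp: net_iff)
    thus False using y_not_endpoint by blast
  qed
  thus ?thesis unfolding interior_essential_def using y_in_K ess y_in by blast
qed

private definition \<theta> where "\<theta> = map (\<lambda>i. char_vec (J + i) (\<Delta> (J + i))) [0..<Suc L]"

private lemma \<Delta>J: "\<Delta> J = E0" "\<Delta> (J + L) = E1" "\<Delta> (J + 0) = E0"
  using \<Delta>_eq E0 E1' y_in y_in_E1 by auto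

private lemma period_y: "period_of y \<theta>"
proof -
  have "admissible_path \<theta>" unfolding \<theta>_def
    using chain_path[of L J "\<lambda>i. \<Delta> (J + i)"] \<Delta>_parent \<Delta>(1) by simp
  moreover have "length \<theta> \<ge> 2" using L_pos by (simp add: \<theta>_def)
  moreover have "hd \<theta> = last \<theta>"
    using \<Delta>J E1'(2) by (simp add: \<theta>_def hd_append hd_map)
  ultimately have "admissible_cycle \<theta>" by (simp add: admissible_cycle_def)
  moreover have "symbolic_rep y (\<lambda>n. char_vec n (\<Delta> n))"
    unfolding symbolic_rep_def using \<Delta> \<Delta>_parent by (intro exI[of _ \<Delta>]) (auto intro: less_imp_le)
  \<comment> \<open>The periodic part starts at level \<open>J + L\<close> instead of
    \<open>J\<close>: the definition of a period requires a non-empty initial segment, and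
    \<open>J\<close> may be 0.\<close>
  moreover have "char_vec (Suc (J + L - 1) + i) (\<Delta> (Suc (J + L - 1) + i)) = butlast \<theta> ! (i mod length (butlast \<theta>))" for i
  proof -
    have b: "butlast \<theta> = map (\<lambda>i. char_vec (J + i) (\<Delta> (J + i))) [0..<L]" by (simp add: \<theta>_def butlast_append)
    have "i mod L < L" using L_pos by simp
    moreover have "Suc (J + L - 1) + i = J + (L + i)" using L_pos by simp
    ultimately show ?thesis using \<Delta>_char_mod[of "L + i"] unfolding b by (simp add: add.assoc)
  qed
  ultimately show ?thesis unfolding period_of_def by blast
qed

private lemma positive_y: "positive_periodic_point y"
proof -
  note A = path_matrix_chain[of L J "\<lambda>i. \<Delta> (J + i)" "path_matrix \<theta>"]
  have A: "dim_row (path_matrix \<theta>) = length (neighbours J E0) \<and> dim_col (path_matrix \<theta>) = length (neighbours (J + L) E1) \<and>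
    (\<forall>i<dim_row (path_matrix \<theta>). \<forall>j<dim_col (path_matrix \<theta>).
       (\<exists>u\<in>pts L. nbr (J + L) E1 j = nbr J E0 i + \<rho> ^ J * u) \<longrightarrow> path_matrix \<theta> $$ (i, j) > 0)"
    using A \<Delta>_parent E0 \<Delta>J by (simp add: \<theta>_def del: upt_Suc)
  have "path_matrix \<theta> $$ (i, j) > 0" if "i < dim_row (path_matrix \<theta>)" "j < dim_col (path_matrix \<theta>)" for i j
  proof -
    have "nbr J E0 i \<in> nb J E0" "nbr (J + L) E1 j \<in> nb (J + L) E1"
      using A that nbr_in_nb[OF E0] nbr_in_nb[OF E1'(1)] by auto
    thus ?thesis using A that connected by blast
  qed
  thus ?thesis unfolding positive_periodic_point_def using y_in_K period_y by blast
qed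

section \<open>Growth of the weights over one period\<close>

private definition Y where "Y = (\<lambda>s. (y - s) / \<rho> ^ J) ` nb J E0"

private lemma Y: "finite Y" "Y \<noteq> {}"
  using nb_nonempty[OF E0] by (auto simp: Y_def)

private lemma Y_unit: "z \<in> Y \<Longrightarrow> z \<in> {0..1}"
  unfolding Y_def using fixed_rel K_subset by blast

private lemma covers_y:
  assumes "E \<in> net_intervals n" "fst E < y" "y < snd E" "\<sigma> \<in> words n" "y \<in> cyl n \<sigma>"
  shows "S_word \<sigma> 0 \<in> nb n E"
proof -
  have p: "S_word \<sigma> 0 \<in> pts n" using assms(4) by (auto simp: pts_def)
  have "fst E < S_word \<sigma> 0 + \<rho> ^ n" "S_word \<sigma> 0 < snd E" using assms by (auto simp: cyl_def)
  thus ?thesis using net_cover[OF assms(1) p] p by (simp add: nb_def)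
qed

private lemma lift_word:
  assumes "s \<in> pts n" "\<sigma> \<in> words i" "(y - s) / \<rho> ^ n \<in> cyl i \<sigma>"
  obtains \<tau> where "\<tau> \<in> words (n + i)" "S_word \<tau> 0 = s + \<rho> ^ n * S_word \<sigma> 0" "y \<in> cyl (n + i) \<tau>"
proof -
  obtain \<eta> where h: "\<eta> \<in> words n" "s = S_word \<eta> 0" using assms(1) by (auto simp: pts_def)
  have "\<eta> @ \<sigma> \<in> words (n + i)" unfolding words_append using h assms(2) by auto
  moreover have "S_word (\<eta> @ \<sigma>) 0 = s + \<rho> ^ n * S_word \<sigma> 0" using h by (simp add: S_word_append_0 length_words)
  moreover have "y \<in> cyl (n + i) (\<eta> @ \<sigma>)" using cyl_append[OF h(1)] assms(3) h(2) by simp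
  ultimately show ?thesis using that by blast
qed

private lemma rel_lift: "((y - s) / \<rho> ^ n - u) / \<rho> ^ i = (y - (s + \<rho> ^ n * u)) / \<rho> ^ (n + i)"
  by (simp add: power_add field_simps)

text \<open>After \<open>L\<close> further letters the cylinder covers \<open>E1\<close>. Since
  \<open>\<psi>\<close> fixes \<open>y\<close>, positions relative to neighbours of
  \<open>E1\<close> are positions relative to neighbours of \<open>E0\<close>.\<close>

private lemma Y_closed:
  assumes "z \<in> Y" "\<sigma> \<in> words L" "z \<in> cyl L \<sigma>"
  shows "(z - S_word \<sigma> 0) / \<rho> ^ L \<in> Y"
proof -
  obtain s where s: "s \<in> nb J E0" "z = (y - s) / \<rho> ^ J" using assms(1) by (auto simp: Y_def)
  obtain \<tau> where t: "\<tau> \<in> words (J + L)" "S_word \<tau> 0 = s + \<rho> ^ J * S_word \<sigma> 0" "y \<in> cyl (J + L) \<tau>"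
    using lift_word[of s J \<sigma> L] s assms by (auto simp: nb_def)
  define u where "u = s + \<rho> ^ J * S_word \<sigma> 0"
  have "u \<in> nb (J + L) E1" using covers_y[OF E1'(1) y_in_E1 t(1,3)] t(2) by (simp add: u_def)
  hence v: "tr (J + L) E1 J E0 u \<in> nb J E0" by (rule tr_nb[OF same_type_sym[OF st]])
  have "(y - u) / \<rho> ^ (J + L) = (y - tr (J + L) E1 J E0 u) / \<rho> ^ J"
    using rel_psi[of "tr (J + L) E1 J E0 u"] by simp
  moreover have "(z - S_word \<sigma> 0) / \<rho> ^ L = (y - u) / \<rho> ^ (J + L)" unfolding s(2) u_def by (rule rel_lift)
  ultimately show ?thesis using v by (auto simp: Y_def)
qed

text \<open>Taken at depth \<open>k\<close>, the depth of \<open>D\<close> below \<open>E0\<close>,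
  rather than at the full period: this matches the scale \<open>J + k\<close> at which
  \<open>y\<close> is compared with the given point.\<close>

private definition H where "H = Max (G k ` Y)"

private lemma H_ge: "z \<in> Y \<Longrightarrow> G k z \<le> H"
  unfolding H_def using Y by (intro Max_ge) auto

private lemma H_pos: "0 < H"
proof -
  obtain s where s: "s \<in> nb J E0" using nb_nonempty[OF E0] by blast
  have "0 < G k ((y - s) / \<rho> ^ J)" by (rule G_pos[OF fixed_rel[OF s]])
  also have "\<dots> \<le> H" using s by (intro H_ge) (auto simp: Y_def)
  finally show ?thesis .
qed

private lemma G_upper: "z \<in> Y \<Longrightarrow> G (q * L) z \<le> H ^ q"
proof (induction q arbitrary: z)
  case (Suc q)
  have "G (L + q * L) z \<le> (\<Sum>\<sigma>\<in>words L. (if z \<in> cyl L \<sigma> then pw \<sigma> else 0) * H ^ q)"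
    unfolding G_add
  proof (rule sum_mono)
    fix \<sigma> assume s: "\<sigma> \<in> words L"
    show "pw \<sigma> * G (q * L) ((z - S_word \<sigma> 0) / \<rho> ^ L) \<le> (if z \<in> cyl L \<sigma> then pw \<sigma> else 0) * H ^ q"
    proof (cases "z \<in> cyl L \<sigma>")
      case True
      thus ?thesis using Suc.IH[OF Y_closed[OF Suc.prems s True]] pw_pos[OF s] by (simp add: mult_left_mono)
    next
      case False
      hence "(z - S_word \<sigma> 0) / \<rho> ^ L \<notin> {0..1}" using cyl_iff_unit[OF s] by blast
      thus ?thesis using G_outside False by simp
    qed
  qed
  also have "\<dots> = G L z * H ^ q" by (simp add: G_alt sum_distrib_right)
  also have "\<dots> \<le> H * H ^ q"
    using H_ge[OF Suc.prems] G_antimono[of k l z] H_pos by (intro mult_right_mono) (auto simp: L_def)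
  finally show ?case by simp
qed (use G_le_1 in simp)

text \<open>A word of length \<open>k\<close> whose cylinder contains \<open>z\<close> leads to a
  neighbour of \<open>D\<close>, which full connection continues to \<open>\<psi> s\<close>. There
  \<open>y\<close> has the position \<open>z\<close> again, so each such word keeps at least the
  fraction \<open>pmin ^ l * G n z\<close> of its weight, and the estimate can be iterated with the
  same \<open>z\<close>.\<close>

private lemma G_lower_step:
  assumes "z \<in> Y" shows "pmin ^ l * G k z * G n z \<le> G (L + n) z"
proof -
  obtain s where s: "s \<in> nb J E0" "z = (y - s) / \<rho> ^ J" using assms(1) by (auto simp: Y_def)
  have "G (k + (l + n)) z \<ge> (\<Sum>\<eta>\<in>words k. (if z \<in> cyl k \<eta> then pw \<eta> else 0) * (pmin ^ l * G n z))"
    unfolding G_add[of k]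
  proof (rule sum_mono)
    fix \<eta> assume h: "\<eta> \<in> words k"
    show "(if z \<in> cyl k \<eta> then pw \<eta> else 0) * (pmin ^ l * G n z) \<le> pw \<eta> * G (l + n) ((z - S_word \<eta> 0) / \<rho> ^ k)"
    proof (cases "z \<in> cyl k \<eta>")
      case True
      obtain \<tau> where t: "\<tau> \<in> words (J + k)" "S_word \<tau> 0 = s + \<rho> ^ J * S_word \<eta> 0" "y \<in> cyl (J + k) \<tau>"
        using lift_word[of s J \<eta> k] s h True by (auto simp: nb_def)
      define u where "u = s + \<rho> ^ J * S_word \<eta> 0"
      have u: "u \<in> nb (J + k) D" using covers_y[OF D(1) y_in(3,4) t(1,3)] t(2) by (simp add: u_def)
      have zu: "(z - S_word \<eta> 0) / \<rho> ^ k = (y - u) / \<rho> ^ (J + k)" unfolding s(2) u_def by (rule rel_lift)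
      have "\<psi> s \<in> nb (J + k + l) E1" using tr_nb[OF st s(1)] by (simp add: L_def add.assoc)
      then obtain w where w: "w \<in> pts l" "\<psi> s = u + \<rho> ^ (J + k) * w" using spr[OF u] by (auto simp: spreads_def)
      then obtain \<kappa> where \<kappa>: "\<kappa> \<in> words l" "w = S_word \<kappa> 0" by (auto simp: pts_def)
      have "((y - u) / \<rho> ^ (J + k) - S_word \<kappa> 0) / \<rho> ^ l = (y - \<psi> s) / \<rho> ^ (J + k + l)"
        unfolding w(2) \<kappa>(2) by (rule rel_lift)
      also have "\<dots> = z" using rel_psi[of s] s(2) by (simp add: L_def add.assoc)
      finally have "pw \<kappa> * G n z \<le> G (l + n) ((z - S_word \<eta> 0) / \<rho> ^ k)"
        using G_ge_word[OF \<kappa>(1), of n "(y - u) / \<rho> ^ (J + k)"] unfolding zu by simp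
      moreover have "pmin ^ l * G n z \<le> pw \<kappa> * G n z" using pw_ge[OF \<kappa>(1)] G_nonneg by (intro mult_right_mono)
      ultimately have "pmin ^ l * G n z \<le> G (l + n) ((z - S_word \<eta> 0) / \<rho> ^ k)" by linarith
      thus ?thesis using True pw_pos[OF h] by (simp add: mult_left_mono)
    next
      case False
      thus ?thesis using pw_pos[OF h] G_nonneg by simp
    qed
  qed
  moreover have "(\<Sum>\<eta>\<in>words k. (if z \<in> cyl k \<eta> then pw \<eta> else 0) * (pmin ^ l * G n z)) = pmin ^ l * G k z * G n z"
    unfolding sum_distrib_right[symmetric] G_alt[of k, symmetric] by simp
  ultimately show ?thesis by (simp add: L_def add.assoc)
qed

private lemma G_lower:
  assumes "z \<in> Y" "G k z = H" shows "(pmin ^ l * H) ^ q \<le> G (q * L) z"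
proof (induction q)
  case 0
  show ?case using Y_unit[OF assms(1)] by (simp add: G_alt cyl_def pw_def)
next
  case (Suc q)
  have "pmin ^ l * H * (pmin ^ l * H) ^ q \<le> pmin ^ l * H * G (q * L) z"
    using Suc H_pos pmin_pos by (intro mult_left_mono) auto
  also have "\<dots> \<le> G (L + q * L) z" using G_lower_step[OF assms(1), of "q * L"] assms(2) by simp
  finally show ?case by simp
qed

private lemma G_y_upper: "(\<And>z. z \<in> Y \<Longrightarrow> G n z \<le> c) \<Longrightarrow> 0 \<le> c \<Longrightarrow> G (J + n) y \<le> c"
proof -
  assume c: "\<And>z. z \<in> Y \<Longrightarrow> G n z \<le> c" "0 \<le> c"
  have "G (J + n) y \<le> (\<Sum>\<sigma>\<in>words J. pw \<sigma> * c)"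
    unfolding G_add
  proof (intro sum_mono mult_left_mono)
    fix \<sigma> assume s: "\<sigma> \<in> words J"
    show "G n ((y - S_word \<sigma> 0) / \<rho> ^ J) \<le> c"
    proof (cases "y \<in> cyl J \<sigma>")
      case True
      have "S_word \<sigma> 0 \<in> nb J E0" using covers_y[OF E0 y_in(1,2) s True] .
      thus ?thesis using c(1) by (auto simp: Y_def)
    next
      case False
      hence "(y - S_word \<sigma> 0) / \<rho> ^ J \<notin> {0..1}" using cyl_iff_unit[OF s] by blast
      thus ?thesis using G_outside c(2) by simp
    qed
    show "0 \<le> pw \<sigma>" using pw_pos[OF s] by simp
  qed
  thus ?thesis by (simp add: sum_distrib_right[symmetric] sum_pw)
qed

private lemma G_y_lower: "z \<in> Y \<Longrightarrow> pmin ^ J * G n z \<le> G (J + n) y"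
proof -
  assume "z \<in> Y"
  then obtain s where s: "s \<in> nb J E0" "z = (y - s) / \<rho> ^ J" by (auto simp: Y_def)
  then obtain \<sigma> where \<sigma>: "\<sigma> \<in> words J" "s = S_word \<sigma> 0" by (auto simp: nb_def pts_def)
  have "pmin ^ J * G n z \<le> pw \<sigma> * G n z" using pw_ge[OF \<sigma>(1)] G_nonneg by (intro mult_right_mono)
  thus ?thesis using G_ge_word[OF \<sigma>(1), of n y] s \<sigma> by simp
qed

text \<open>Along the levels \<open>J + q * L\<close> the weight at \<open>y\<close> lies, up to a
  fixed factor, between the powers of \<open>pmin ^ l * H\<close> and of \<open>H\<close>; taking
  logarithms and limits bounds the rate. The two bounds for \<open>(k + l) * \<Lambda>\<close>
  differ by an amount independent of \<open>k\<close>.\<close>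

lemma periodic_approximation:
  "\<exists>y H \<Lambda>. interior_essential y \<and> positive_periodic_point y \<and> fst D < y \<and> y < snd D \<and>
     (\<lambda>n. ln (G n y) / real n) \<longlonglongrightarrow> \<Lambda> \<and> (dim_ratio \<mu> y \<longlongrightarrow> ereal (\<Lambda> / ln \<rho>)) (at_right 0) \<and>
     0 < H \<and> real l * ln pmin + ln H \<le> real (k + l) * \<Lambda> \<and> real (k + l) * \<Lambda> \<le> ln H \<and>
     pmin ^ J * H \<le> G (J + k) y \<and> G (J + k) y \<le> H \<and> ln pmin \<le> \<Lambda> \<and> \<Lambda> \<le> 0"
proof -
  have "periodic_point y" unfolding periodic_point_def using y_in_K period_y by blast
  then obtain \<Lambda> where \<Lambda>: "(\<lambda>n. ln (G n y) / real n) \<longlonglongrightarrow> \<Lambda>"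
    "(dim_ratio \<mu> y \<longlongrightarrow> ereal (\<Lambda> / ln \<rho>)) (at_right 0)" using periodic_local_dim by blast
  have "H \<in> G k ` Y" unfolding H_def using Y by (intro Max_in) auto
  then obtain z where "H = G k z" "z \<in> Y" by (rule imageE)
  hence z: "z \<in> Y" "G k z = H" by simp_all
  have sub: "filterlim (\<lambda>q. J + q * L) sequentially sequentially"
  proof (rule filterlim_at_top_mono[OF filterlim_ident])
    show "\<forall>\<^sub>F q in sequentially. q \<le> J + q * L" using L_pos by (intro always_eventually) (simp add: trans_le_add2)
  qed
  have lim1: "(\<lambda>q. ln (G (J + q * L) y) / real (J + q * L)) \<longlonglongrightarrow> \<Lambda>"
    using filterlim_compose[OF \<Lambda>(1) sub] .
  have "(\<lambda>q. real J / real q + real L) \<longlonglongrightarrow> 0 + real L" by (intro tendsto_intros lim_const_over_n)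
  hence lim2: "(\<lambda>q. ln (G (J + q * L) y) / real (J + q * L) * (real J / real q + real L)) \<longlonglongrightarrow> \<Lambda> * real L"
    using tendsto_mult[OF lim1] by simp
  have ev: "eventually (\<lambda>q. ln (G (J + q * L) y) / real (J + q * L) * (real J / real q + real L) = ln (G (J + q * L) y) / real q) sequentially"
    using eventually_ge_at_top[of 1]
  proof eventually_elim
    case (elim q)
    have "real J / real q + real L = real (J + q * L) / real q" using elim by (simp add: field_simps)
    moreover have "J + q * L \<noteq> 0" using elim L_pos by simp
    hence "real (J + q * L) \<noteq> 0" by (simp only: of_nat_eq_0_iff not_False_eq_True)
    moreover have "a / N * (N / b) = a / b" if "N \<noteq> 0" for a b N :: real using that by simp
    ultimately show ?case by (simp only:)
  qed
  have lim: "(\<lambda>q. ln (G (J + q * L) y) / real q) \<longlonglongrightarrow> real L * \<Lambda>"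
    using Lim_transform_eventually[OF lim2 ev] by (simp add: mult.commute)
  have Gp: "0 < G n y" for n by (rule G_pos[OF y_in_K])
  have up: "eventually (\<lambda>q. ln (G (J + q * L) y) / real q \<le> ln H) sequentially"
    using eventually_ge_at_top[of 1]
  proof eventually_elim
    case (elim q)
    have "G (J + q * L) y \<le> H ^ q" using H_pos by (intro G_y_upper G_upper) auto
    hence "ln (G (J + q * L) y) \<le> real q * ln H" using Gp[of "J + q * L"] H_pos
      by (simp add: ln_realpow[symmetric])
    thus ?case using elim by (simp add: field_simps)
  qed
  have lo: "eventually (\<lambda>q. real J * ln pmin / real q + (real l * ln pmin + ln H) \<le> ln (G (J + q * L) y) / real q) sequentially"
    using eventually_ge_at_top[of 1]
  proof eventually_elim
    case (elim q)
    have "pmin ^ J * (pmin ^ l * H) ^ q \<le> pmin ^ J * G (q * L) z"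
      using G_lower[OF z, of q] pmin_pos by (intro mult_left_mono) auto
    also have "\<dots> \<le> G (J + q * L) y" by (rule G_y_lower[OF z(1)])
    finally have "ln (pmin ^ J * (pmin ^ l * H) ^ q) \<le> ln (G (J + q * L) y)"
      using Gp[of "J + q * L"] pmin_pos H_pos by simp
    hence "real J * ln pmin + real q * (real l * ln pmin + ln H) \<le> ln (G (J + q * L) y)"
      using pmin_pos H_pos by (simp add: ln_mult ln_realpow)
    hence "(real J * ln pmin + real q * (real l * ln pmin + ln H)) / real q \<le> ln (G (J + q * L) y) / real q"
      by (intro divide_right_mono) auto
    thus ?case using elim by (simp add: add_divide_distrib)
  qed
  have 1: "real L * \<Lambda> \<le> ln H" using tendsto_upperbound[OF lim up] by simp
  have "(\<lambda>q. real J * ln pmin / real q + (real l * ln pmin + ln H)) \<longlonglongrightarrow> 0 + (real l * ln pmin + ln H)"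
    by (intro tendsto_intros lim_const_over_n)
  hence 2: "0 + (real l * ln pmin + ln H) \<le> real L * \<Lambda>" using tendsto_le[OF sequentially_bot lim _ lo] by blast
  have 3: "pmin ^ J * H \<le> G (J + k) y" using G_y_lower[OF z(1), of k] z(2) by simp
  have 4: "G (J + k) y \<le> H" using H_ge H_pos by (intro G_y_upper) auto
  have 5: "ln pmin \<le> \<Lambda>"
  proof (rule tendsto_lowerbound[OF \<Lambda>(1)])
    show "\<forall>\<^sub>F n in sequentially. ln pmin \<le> ln (G n y) / real n"
      using eventually_ge_at_top[of 1]
    proof eventually_elim
      case (elim n)
      have "ln (pmin ^ n) \<le> ln (G n y)" using G_ge[OF y_in_K, of n] Gp[of n] pmin_pos by simp
      thus ?case using elim pmin_pos by (simp add: ln_realpow field_simps)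
    qed
  qed simp
  have 6: "\<Lambda> \<le> 0"
  proof (rule tendsto_upperbound[OF \<Lambda>(1)])
    show "\<forall>\<^sub>F n in sequentially. ln (G n y) / real n \<le> 0"
      using G_le_1 Gp by (intro always_eventually allI) (simp add: divide_nonpos_nonneg)
  qed simp
  show ?thesis
    by (intro exI[of _ y] exI[of _ H] exI[of _ \<Lambda>])
      (use interior_y positive_y y_in \<Lambda> H_pos 1 2 3 4 5 6 in \<open>simp add: L_def\<close>)
qed

end

subsection \<open>Truly essential points\<close>

lemma truly_essential_in_K: "truly_essential x \<Longrightarrow> x \<in> K"
  by (auto simp: truly_essential_def boundary_essential_def interior_essential_def)

text \<open>For a boundary essential point only the two net intervals on its sides can contain it,
  at a level where it is an endpoint. An interior essential point lies in a single one, as it is no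
  endpoint.\<close>

lemma truly_essential_level:
  assumes "truly_essential x"
  shows "\<exists>J. \<forall>\<Delta>\<in>net_intervals J. fst \<Delta> \<le> x \<and> x \<le> snd \<Delta> \<longrightarrow> essential J \<Delta>"
  using assms unfolding truly_essential_def
proof
  assume "boundary_essential x"
  then obtain n \<Delta> where n: "\<Delta> \<in> net_intervals n" "x = fst \<Delta> \<or> x = snd \<Delta>" "essential n \<Delta>"
    "\<And>\<Delta>'. other_side n x \<Delta> \<Delta>' \<Longrightarrow> essential n \<Delta>'" unfolding boundary_essential_def by blast
  have xe: "x \<in> endpoints n" using n(1,2) by (auto simp: net_iff)
  have "essential n \<Delta>'" if D: "\<Delta>' \<in> net_intervals n" "fst \<Delta>' \<le> x" "x \<le> snd \<Delta>'" for \<Delta>'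
  proof -
    have "x \<notin> {fst \<Delta>'<..<snd \<Delta>'}" using D(1) xe unfolding net_iff by blast
    hence x: "x = fst \<Delta>' \<or> x = snd \<Delta>'" using D by auto
    show ?thesis
    proof (cases "\<Delta>' = \<Delta>")
      case False
      hence "other_side n x \<Delta> \<Delta>'"
        using net_fst_unique[OF D(1) n(1)] net_snd_unique[OF D(1) n(1)] x n(2) D(1) unfolding other_side_def by auto
      thus ?thesis by (rule n(4))
    qed (use n(3) in simp)
  qed
  thus ?thesis by blast
next
  assume "interior_essential x"
  then obtain n \<Delta> where n: "essential n \<Delta>" "fst \<Delta> < x" "x < snd \<Delta>" unfolding interior_essential_def by blast
  have D: "\<Delta> \<in> net_intervals n" using n(1) by (simp add: essential_def)
  have "x \<in> {fst \<Delta><..<snd \<Delta>}" using n by simp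
  hence xe: "x \<notin> endpoints n" using D unfolding net_iff by blast
  have "\<Delta>' = \<Delta>" if D': "\<Delta>' \<in> net_intervals n" "fst \<Delta>' \<le> x" "x \<le> snd \<Delta>'" for \<Delta>'
  proof -
    have "fst \<Delta>' \<noteq> x" "snd \<Delta>' \<noteq> x" using D'(1) xe unfolding net_iff by blast+
    thus ?thesis using net_unique[OF D'(1) D, of x] n D' by simp
  qed
  thus ?thesis using n(1) by blast
qed

text \<open>The finitely many level \<open>J\<close> intervals missing \<open>x\<close> are closed,
  so they have positive distance from it. A neighbourhood is required because the approximation uses
  cylinders near \<open>x\<close>.\<close>

lemma truly_essential_nearby:
  assumes "truly_essential x"
  shows "\<exists>J. \<exists>r>0. \<forall>\<Delta>\<in>net_intervals J. fst \<Delta> \<le> x + r \<longrightarrow> x - r \<le> snd \<Delta> \<longrightarrow> essential J \<Delta>"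
proof -
  obtain J where J: "\<And>\<Delta>. \<Delta> \<in> net_intervals J \<Longrightarrow> fst \<Delta> \<le> x \<Longrightarrow> x \<le> snd \<Delta> \<Longrightarrow> essential J \<Delta>"
    using truly_essential_level[OF assms] by blast
  define A where "A = (\<lambda>\<Delta>. max (fst \<Delta> - x) (x - snd \<Delta>)) ` {\<Delta> \<in> net_intervals J. \<not> (fst \<Delta> \<le> x \<and> x \<le> snd \<Delta>)}"
  have A: "finite A" "\<And>a. a \<in> A \<Longrightarrow> a > 0" by (auto simp: A_def)
  define r where "r = Min (insert 1 A) / 2"
  have r: "r > 0" using A by (simp add: r_def)
  have "essential J \<Delta>" if D: "\<Delta> \<in> net_intervals J" "fst \<Delta> \<le> x + r" "x - r \<le> snd \<Delta>" for \<Delta>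
  proof (cases "fst \<Delta> \<le> x \<and> x \<le> snd \<Delta>")
    case False
    hence "max (fst \<Delta> - x) (x - snd \<Delta>) \<in> A" unfolding A_def using D(1) by blast
    hence "2 * r \<le> max (fst \<Delta> - x) (x - snd \<Delta>)" using A by (simp add: r_def)
    also have "\<dots> \<le> r" using D by simp
    finally show ?thesis using r by simp
  qed (use J D in blast)
  thus ?thesis using r by blast
qed

section \<open>Approximation at a given scale\<close>

lemma card_pts_window: "card {t \<in> pts n. a \<le> t \<and> t \<le> a + \<rho> ^ n} \<le> card F"
proof (cases "{t \<in> pts n. a \<le> t \<and> t \<le> a + \<rho> ^ n} = {}")
  case False
  then obtain t0 where t0: "t0 \<in> pts n" "a \<le> t0" "t0 \<le> a + \<rho> ^ n" by blast
  show ?thesis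
  proof (rule card_inj_on_le[of "\<lambda>t. (t - t0) / \<rho> ^ n"])
    show "inj_on (\<lambda>t. (t - t0) / \<rho> ^ n) {t \<in> pts n. a \<le> t \<and> t \<le> a + \<rho> ^ n}" by (auto simp: inj_on_def)
    show "(\<lambda>t. (t - t0) / \<rho> ^ n) ` {t \<in> pts n. a \<le> t \<and> t \<le> a + \<rho> ^ n} \<subseteq> F"
      using t0 by (auto intro!: F_diff)
  qed (rule F_finite)
next
  case True
  thus ?thesis by (simp only: card.empty)
qed

text \<open>Pigeonhole: cylinders meeting the ball begin in a range of three cylinder lengths, split
  into the windows \<open>W 2\<close>, \<open>W 1\<close>, \<open>W 0\<close> with at most
  \<open>card F\<close> left endpoints each. The summand 1 makes the comparison strict. Words with
  the same cylinder are counted together.\<close>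

lemma heavy_cylinder:
  assumes "x \<in> K"
  obtains t where "t \<in> pts n" "x - 2 * \<rho> ^ n \<le> t" "t \<le> x + \<rho> ^ n"
    "ball_mu x (\<rho> ^ n) \<le> (3 * real (card F) + 1) * (\<Sum>\<sigma>\<in>{\<sigma>\<in>words n. S_word \<sigma> 0 = t}. pw \<sigma>)"
proof -
  define C where "C = 3 * real (card F) + 1"
  define P where "P t = (\<Sum>\<sigma>\<in>{\<sigma>\<in>words n. S_word \<sigma> 0 = t}. pw \<sigma>)" for t
  define T where "T = {t \<in> pts n. x - 2 * \<rho> ^ n \<le> t \<and> t \<le> x + \<rho> ^ n}"
  define W where "W i = {t \<in> pts n. x - i * \<rho> ^ n \<le> t \<and> t \<le> x - i * \<rho> ^ n + \<rho> ^ n}" for i :: real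
  have "T \<subseteq> W 2 \<union> (W 1 \<union> W 0)" by (auto simp: T_def W_def)
  hence "card T \<le> card (W 2 \<union> (W 1 \<union> W 0))" by (intro card_mono) (auto simp: W_def)
  also have "\<dots> \<le> card (W 2) + (card (W 1) + card (W 0))"
    using card_Un_le[of "W 2" "W 1 \<union> W 0"] card_Un_le[of "W 1" "W 0"] by linarith
  finally have "card T \<le> card (W 2) + (card (W 1) + card (W 0))" .
  moreover have w: "card (W i) \<le> card F" for i unfolding W_def by (rule card_pts_window)
  ultimately have "card T \<le> 3 * card F" using w[of 0] w[of 1] w[of 2] by linarith
  hence cT: "real (card T) < C" by (simp add: C_def)
  have pos: "0 < ball_mu x (\<rho> ^ n)" using ball_mu_pos[OF assms] by simp
  have "\<exists>t\<in>T. ball_mu x (\<rho> ^ n) \<le> C * P t"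
  proof (rule ccontr)
    assume "\<not> ?thesis"
    hence less: "C * P t \<le> ball_mu x (\<rho> ^ n)" if "t \<in> T" for t using that by force
    have "ball_mu x (\<rho> ^ n) \<le> (\<Sum>\<sigma>\<in>{\<sigma>\<in>words n. cyl n \<sigma> \<inter> {x - \<rho> ^ n..x + \<rho> ^ n} \<noteq> {}}. pw \<sigma>)"
      by (rule mu_le_sum) simp
    also have "\<dots> \<le> (\<Sum>\<sigma>\<in>{\<sigma>\<in>words n. S_word \<sigma> 0 \<in> T}. pw \<sigma>)"
    proof (rule sum_mono2)
      show "{\<sigma> \<in> words n. cyl n \<sigma> \<inter> {x - \<rho> ^ n..x + \<rho> ^ n} \<noteq> {}} \<subseteq> {\<sigma> \<in> words n. S_word \<sigma> 0 \<in> T}"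
        by (auto simp: T_def cyl_def pts_def)
    qed (auto intro: less_imp_le pw_pos)
    also have "\<dots> = (\<Sum>t\<in>T. \<Sum>\<sigma>\<in>{\<sigma>\<in>{\<sigma>\<in>words n. S_word \<sigma> 0 \<in> T}. S_word \<sigma> 0 = t}. pw \<sigma>)"
      by (rule sum.group[symmetric]) (auto simp: T_def)
    also have "\<dots> = (\<Sum>t\<in>T. P t)" unfolding P_def by (intro sum.cong) auto
    finally have "C * ball_mu x (\<rho> ^ n) \<le> C * (\<Sum>t\<in>T. P t)" by (intro mult_left_mono) (auto simp: C_def)
    also have "\<dots> = (\<Sum>t\<in>T. C * P t)" by (simp add: sum_distrib_left)
    also have "\<dots> \<le> (\<Sum>t\<in>T. ball_mu x (\<rho> ^ n))" by (intro sum_mono less)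
    also have "\<dots> = real (card T) * ball_mu x (\<rho> ^ n)" by simp
    also have "\<dots> < C * ball_mu x (\<rho> ^ n)" using cT pos by (intro mult_strict_right_mono)
    finally show False by simp
  qed
  thus ?thesis using that unfolding T_def P_def C_def by blast
qed

definition periodic_dims :: "ereal set" where
  "periodic_dims = {local_dim \<mu> y | y. interior_essential y \<and> positive_periodic_point y}"

text \<open>\<open>e\<close> is the local dimension at the periodic point and \<open>g\<close> its
  weight \<open>G n y\<close>. The constants \<open>C\<close> and \<open>c\<close> depend on
  \<open>x\<close> but not on \<open>n\<close>, so \<open>e\<close> follows the rate of the ball
  masses up to an error of order \<open>1 / n\<close>.\<close>

lemma approximation_at_scale:
  assumes te: "truly_essential x"
  shows "\<exists>C c n0. C > 0 \<and> (\<forall>n\<ge>n0. \<exists>e g. ereal e \<in> periodic_dims \<and> 0 < g \<and>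
    ball_mu x (\<rho> ^ n) \<le> C * g \<and> g \<le> ball_mu x (3 * \<rho> ^ n) \<and>
    \<bar>e * real n - ln g / ln \<rho>\<bar> \<le> c \<and> e \<le> ln pmin / ln \<rho>)"
proof -
  have x: "x \<in> K" by (rule truly_essential_in_K[OF te])
  obtain J r where r: "r > 0"
    and near: "\<And>\<Delta>. \<Delta> \<in> net_intervals J \<Longrightarrow> fst \<Delta> \<le> x + r \<Longrightarrow> x - r \<le> snd \<Delta> \<Longrightarrow> essential J \<Delta>"
    using truly_essential_nearby[OF te] by blast
  have "\<forall>\<alpha>\<in>essential_class. \<exists>N. \<forall>n \<Delta>. essential n \<Delta> \<longrightarrow> (\<exists>k\<le>N. returns \<alpha> k n \<Delta>)"
    using returns_bounded by blast
  from bchoice[OF this] obtain Nf where Nf: "\<And>\<alpha> n \<Delta>. \<alpha> \<in> essential_class \<Longrightarrow> essential n \<Delta> \<Longrightarrow> \<exists>k\<le>Nf \<alpha>. returns \<alpha> k n \<Delta>"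
    by blast
  \<comment> \<open>The return depth is bounded for each target vector separately; the targets are
    vectors of the finitely many net intervals of level \<open>J\<close>, so \<open>N\<close> serves
    all scales.\<close>
  define N where "N = Max (insert 0 (Nf ` char_vec J ` net_intervals J))"
  have N: "Nf (char_vec J \<Delta>) \<le> N" if "\<Delta> \<in> net_intervals J" for \<Delta>
    unfolding N_def using that by (intro Max_ge) auto
  define C where "C = 3 * real (card F) + 1"
  define P where "P = - ln pmin"
  have P: "P \<ge> 0" using pmin_le_1 pmin_pos by (simp add: P_def)
  define c where "c = P * real (J + N) / - ln \<rho>"
  \<comment> \<open>The heavy cylinder lies within \<open>3 * \<rho> ^ n\<close> of
    \<open>x\<close>; for \<open>n \<ge> n1\<close> this is below \<open>r\<close>, and the ancestor
    of level \<open>J\<close> is essential.\<close>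
  obtain n1 where n1: "\<rho> ^ n1 < r / 3" using real_arch_pow_inv[of "r / 3" \<rho>] r ratio by auto
  define n0 where "n0 = max n1 J"
  have "\<exists>e g. ereal e \<in> periodic_dims \<and> 0 < g \<and> ball_mu x (\<rho> ^ n) \<le> C * g \<and> g \<le> ball_mu x (3 * \<rho> ^ n) \<and>
    \<bar>e * real n - ln g / ln \<rho>\<bar> \<le> c \<and> e \<le> ln pmin / ln \<rho>" if n: "n \<ge> n0" for n
  proof -
    obtain k where k: "n = J + k" using n le_Suc_ex[of J n] by (auto simp: n0_def)
    have "\<rho> ^ n \<le> \<rho> ^ n1" using n ratio by (intro power_decreasing) (auto simp: n0_def)
    hence rn: "3 * \<rho> ^ n < r" using n1 by simp
    have rp: "0 < \<rho> ^ n" by simp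
    obtain t where t: "t \<in> pts n" "x - 2 * \<rho> ^ n \<le> t" "t \<le> x + \<rho> ^ n"
      "ball_mu x (\<rho> ^ n) \<le> C * (\<Sum>\<sigma>\<in>{\<sigma>\<in>words n. S_word \<sigma> 0 = t}. pw \<sigma>)"
      unfolding C_def using heavy_cylinder[OF x] .
    obtain b where b: "(t, b) \<in> net_intervals n" "b \<le> t + \<rho> ^ n" using net_left[OF t(1)] .
    have tb: "t < b" using net_less[OF b(1)] by simp
    obtain E0 where E0: "E0 \<in> net_intervals J" "inside (t, b) E0" using ancestor[of "(t, b)" J k] b(1) k by auto
    have "fst E0 \<le> t" "b \<le> snd E0" using E0(2) by (auto simp: inside_def)
    hence e0: "essential J E0" using t tb rn rp by (intro near[OF E0(1)]) linarith+
    have eD: "essential n (t, b)" using essential_closed[OF e0 _ E0(2), of k] b(1) k by simp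
    have \<alpha>: "char_vec J E0 \<in> essential_class" using e0 by (simp add: essential_def)
    obtain l where l: "l \<le> Nf (char_vec J E0)" "returns (char_vec J E0) l n (t, b)" using Nf[OF \<alpha> eD] by blast
    obtain E1 where E1: "E1 \<in> net_intervals (J + k + l)" "fst (t, b) < fst E1" "snd E1 < snd (t, b)"
      "char_vec (J + k + l) E1 = char_vec J E0" "\<And>s. s \<in> nb (J + k) (t, b) \<Longrightarrow> spreads (J + k) s l E1"
      using l(2) unfolding returns_def k by blast
    obtain y H \<Lambda> where y: "interior_essential y" "positive_periodic_point y" "t < y" "y < b"
      "(dim_ratio \<mu> y \<longlongrightarrow> ereal (\<Lambda> / ln \<rho>)) (at_right 0)" "0 < H"
      "real l * ln pmin + ln H \<le> real (k + l) * \<Lambda>" "real (k + l) * \<Lambda> \<le> ln H"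
      "pmin ^ J * H \<le> G n y" "G n y \<le> H" "ln pmin \<le> \<Lambda>" "\<Lambda> \<le> 0"
      using periodic_approximation[OF e0 _ E0(2) E1] b(1) unfolding k by auto
    have yK: "y \<in> K" using y(1) by (simp add: interior_essential_def)
    have gp: "0 < G n y" by (rule G_pos[OF yK])
    have "local_dim \<mu> y = ereal (\<Lambda> / ln \<rho>)" unfolding local_dim_def using y(5) by (intro tendsto_Lim) auto
    hence 1: "ereal (\<Lambda> / ln \<rho>) \<in> periodic_dims" using y(1,2) unfolding periodic_dims_def by (metis (mono_tags, lifting) mem_Collect_eq)
    have "(\<Sum>\<sigma>\<in>{\<sigma>\<in>words n. S_word \<sigma> 0 = t}. pw \<sigma>) \<le> G n y"
      unfolding G_def using y(3,4) b(2) pw_pos by (intro sum_mono2) (auto simp: cyl_def intro: less_imp_le)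
    hence "C * (\<Sum>\<sigma>\<in>{\<sigma>\<in>words n. S_word \<sigma> 0 = t}. pw \<sigma>) \<le> C * G n y" by (intro mult_left_mono) (auto simp: C_def)
    hence 2: "ball_mu x (\<rho> ^ n) \<le> C * G n y" using t(4) by linarith
    have "G n y \<le> (\<Sum>\<sigma>\<in>{\<sigma>\<in>words n. cyl n \<sigma> \<subseteq> {x - 3 * \<rho> ^ n..x + 3 * \<rho> ^ n}}. pw \<sigma>)"
      unfolding G_def using y(3,4) b(2) t(2,3) pw_pos by (intro sum_mono2) (auto simp: cyl_def intro: less_imp_le)
    also have "\<dots> \<le> ball_mu x (3 * \<rho> ^ n)" by (rule sum_le_mu) simp
    finally have 3: "G n y \<le> ball_mu x (3 * \<rho> ^ n)" .
    have 4: "\<Lambda> / ln \<rho> \<le> ln pmin / ln \<rho>" using y(11) ln_rho by (intro divide_right_mono_neg) auto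
    have lg: "real J * ln pmin + ln H \<le> ln (G n y)" "ln (G n y) \<le> ln H"
    proof -
      have "ln (pmin ^ J * H) \<le> ln (G n y)" using y(6,9) pmin_pos gp by simp
      thus "real J * ln pmin + ln H \<le> ln (G n y)" using y(6) pmin_pos by (simp add: ln_mult ln_realpow)
      show "ln (G n y) \<le> ln H" using y(10) gp y(6) by simp
    qed
    have lN: "l \<le> N" using l(1) N[OF E0(1)] by simp
    have "\<bar>\<Lambda> * real n - ln (G n y)\<bar> \<le> P * real (J + N)"
    proof -
      \<comment> \<open>Compared with \<open>ln H\<close>, the first summand is too small by at most
        \<open>l * P\<close> and the second contributes between \<open>- J * P\<close> and 0, the
        third between 0 and \<open>l * P\<close>. As \<open>ln (G n y)\<close> is below
        \<open>ln H\<close> by at most \<open>J * P\<close>, the total error is at most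
        \<open>(J + l) * P\<close> on either side.\<close>
      have a: "\<Lambda> * real n = real (k + l) * \<Lambda> + real J * \<Lambda> - real l * \<Lambda>" by (simp add: k algebra_simps)
      have "real J * (- P) \<le> real J * \<Lambda>" "real J * \<Lambda> \<le> 0" "real l * (- P) \<le> real l * \<Lambda>" "real l * \<Lambda> \<le> 0"
        using y(11,12) by (auto simp: P_def mult_nonneg_nonpos intro!: mult_left_mono)
      moreover have "real l * P \<le> real N * P" using lN P by (intro mult_right_mono) auto
      ultimately show ?thesis using a y(7,8) lg unfolding P_def by (auto simp: abs_le_iff algebra_simps)
    qed
    hence "\<bar>\<Lambda> * real n - ln (G n y)\<bar> / - ln \<rho> \<le> c" unfolding c_def using ln_rho by (intro divide_right_mono) auto
    moreover have "\<Lambda> / ln \<rho> * real n - ln (G n y) / ln \<rho> = (\<Lambda> * real n - ln (G n y)) / ln \<rho>"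
      by (simp add: diff_divide_distrib)
    ultimately have "\<bar>\<Lambda> / ln \<rho> * real n - ln (G n y) / ln \<rho>\<bar> \<le> c" using ln_rho by simp
    thus ?thesis using 1 2 3 4 gp by blast
  qed
  thus ?thesis by (intro exI[of _ C] exI[of _ c] exI[of _ n0]) (simp add: C_def)
qed

text \<open>Both values are limits of subsequences, whose terms eventually lie in
  \<open>A\<close>.\<close>

lemma limsup_in_closure:
  fixes u :: "nat \<Rightarrow> ereal"
  assumes "eventually (\<lambda>n. u n \<in> A) sequentially"
  shows "limsup u \<in> closure A" "liminf u \<in> closure A"
proof -
  have *: "l \<in> closure A" if "strict_mono r" "(u \<circ> r) \<longlonglongrightarrow> l" for r l
  proof (rule Lim_in_closed_set[OF closed_closure _ sequentially_bot that(2)])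
    have "eventually (\<lambda>n. u (r n) \<in> A) sequentially" using eventually_subseq[OF that(1) assms] .
    thus "eventually (\<lambda>n. (u \<circ> r) n \<in> closure A) sequentially"
      by eventually_elim (use closure_subset in auto)
  qed
  show "limsup u \<in> closure A" using limsup_subseq_lim[of u] * by blast
  show "liminf u \<in> closure A" using liminf_subseq_lim[of u] * by blast
qed

text \<open>The dimensions \<open>e n\<close> chosen at all scales have the same limsup and liminf
  as the rates of \<open>g n\<close>, and these are the upper and lower local dimensions at
  \<open>x\<close>.\<close>

lemma local_dims_in_closure:
  assumes te: "truly_essential x"
  shows "upper_local_dim \<mu> x \<in> closure periodic_dims" "lower_local_dim \<mu> x \<in> closure periodic_dims"
proof -
  have x: "x \<in> K" by (rule truly_essential_in_K[OF te])
  obtain C c n0 where C: "C > 0" and ex: "\<And>n. n \<ge> n0 \<Longrightarrow> \<exists>e g. ereal e \<in> periodic_dims \<and> 0 < g \<and>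
    ball_mu x (\<rho> ^ n) \<le> C * g \<and> g \<le> ball_mu x (3 * \<rho> ^ n) \<and>
    \<bar>e * real n - ln g / ln \<rho>\<bar> \<le> c \<and> e \<le> ln pmin / ln \<rho>"
    using approximation_at_scale[OF te] by blast
  define Q where "Q n e g \<longleftrightarrow> ereal e \<in> periodic_dims \<and> 0 < g \<and>
    ball_mu x (\<rho> ^ n) \<le> C * g \<and> g \<le> ball_mu x (3 * \<rho> ^ n) \<and>
    \<bar>e * real n - ln g / ln \<rho>\<bar> \<le> c \<and> e \<le> ln pmin / ln \<rho>" for n e g
  have "\<forall>n\<in>{n0..}. \<exists>v. Q n (fst v) (snd v)" using ex unfolding Q_def by auto
  from bchoice[OF this] obtain v where v: "\<And>n. n \<ge> n0 \<Longrightarrow> Q n (fst (v n)) (snd (v n))" by auto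
  define e where "e n = fst (v n)" for n
  \<comment> \<open>The default 1 below \<open>n0\<close> keeps \<open>g\<close> positive at every
    index, as \<open>local_dim_sequence\<close> requires.\<close>
  define g where "g n = (if n \<ge> n0 then snd (v n) else 1)" for n
  have Q: "Q n (e n) (g n)" if "n \<ge> n0" for n using v[OF that] that by (simp add: e_def g_def)
  have gpos: "0 < g n" for n using Q[of n] by (cases "n \<ge> n0") (auto simp: Q_def g_def)
  \<comment> \<open>A shift by \<open>q\<close> absorbs the factor 3 in the radius.\<close>
  obtain q where q: "\<rho> ^ q < 1 / 3" using real_arch_pow_inv[of "1 / 3" \<rho>] ratio by auto
  \<comment> \<open>One constant serves both comparisons; the lower one has factor 1.\<close>
  define C' where "C' = max C 1"
  have up: "eventually (\<lambda>n. ball_mu x (\<rho> ^ (n + q)) \<le> C' * g n) sequentially"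
    using eventually_ge_at_top[of n0]
  proof eventually_elim
    case (elim n)
    have "\<rho> ^ (n + q) \<le> \<rho> ^ n" using ratio by (intro power_decreasing) auto
    from ball_mu_mono[OF this, of x] have "ball_mu x (\<rho> ^ (n + q)) \<le> C * g n" using Q[OF elim] unfolding Q_def by linarith
    also have "\<dots> \<le> C' * g n" using gpos[of n] by (intro mult_right_mono) (auto simp: C'_def)
    finally show ?case .
  qed
  have lo: "eventually (\<lambda>n. g (n + q) \<le> C' * ball_mu x (\<rho> ^ n)) sequentially"
    using eventually_ge_at_top[of n0]
  proof eventually_elim
    case (elim n)
    have "\<rho> ^ n * \<rho> ^ q \<le> \<rho> ^ n * (1 / 3)" using q by (intro mult_left_mono) auto
    hence "3 * \<rho> ^ (n + q) \<le> \<rho> ^ n" by (simp add: power_add)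
    from ball_mu_mono[OF this, of x] have "g (n + q) \<le> 1 * ball_mu x (\<rho> ^ n)" using Q[of "n + q"] elim unfolding Q_def by auto
    also have "\<dots> \<le> C' * ball_mu x (\<rho> ^ n)" by (intro mult_right_mono) (auto simp: C'_def)
    finally show ?case .
  qed
  have "C' > 0" using C by (simp add: C'_def)
  note dims = local_dim_sequence[OF x gpos this up lo]
  define A where "A n = e n * real n" for n
  define B where "B n = ln (g n) / ln \<rho>" for n
  define \<beta> where "\<beta> = ln pmin / ln \<rho>"
  have \<beta>: "0 \<le> \<beta>" unfolding \<beta>_def using pmin_le_1 pmin_pos ln_rho by (simp add: divide_nonpos_neg)
  have AB: "\<bar>A n - B n\<bar> \<le> c" "A n \<le> \<beta> * real n" if "n \<ge> n0" for n
    using Q[OF that] mult_right_mono[of "e n" \<beta> "real n"] unfolding Q_def A_def B_def \<beta>_def by simp_all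
  have c: "0 \<le> c" using AB(1)[of n0] by simp
  have ev: "eventually (\<lambda>n. A n \<le> B (n + 0) + c) sequentially" "eventually (\<lambda>n. B n \<le> A (n + 0) + c) sequentially"
    using AB(1) unfolding eventually_sequentially by (intro exI[of _ n0] allI impI; force simp: abs_le_iff)+
  have Ab: "eventually (\<lambda>n. A n \<le> (\<beta> + c) * (real n + 1)) sequentially"
    and Bb: "eventually (\<lambda>n. B n \<le> (\<beta> + c) * (real n + 1)) sequentially"
  proof -
    have "A n \<le> (\<beta> + c) * (real n + 1) \<and> B n \<le> (\<beta> + c) * (real n + 1)" if "n \<ge> n0" for n
    proof -
      have "\<beta> * real n + c \<le> (\<beta> + c) * (real n + 1)" using \<beta> c by (simp add: algebra_simps)
      thus ?thesis using AB[OF that] c by (auto simp: abs_le_iff)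
    qed
    thus "eventually (\<lambda>n. A n \<le> (\<beta> + c) * (real n + 1)) sequentially"
      "eventually (\<lambda>n. B n \<le> (\<beta> + c) * (real n + 1)) sequentially"
      unfolding eventually_sequentially by blast+
  qed
  have eq: "limsup (\<lambda>n. ereal (A n / real n)) = limsup (\<lambda>n. ereal (B n / real n))"
    "liminf (\<lambda>n. ereal (A n / real n)) = liminf (\<lambda>n. ereal (B n / real n))"
    using limsup_rate_le[OF ev(1) Bb] limsup_rate_le[OF ev(2) Ab] by (auto intro: antisym)
  have "eventually (\<lambda>n. ereal (A n / real n) \<in> periodic_dims) sequentially"
    unfolding eventually_sequentially
    by (intro exI[of _ "max n0 1"]) (use Q in \<open>auto simp: A_def Q_def\<close>)
  from limsup_in_closure[OF this]
  show "upper_local_dim \<mu> x \<in> closure periodic_dims" "lower_local_dim \<mu> x \<in> closure periodic_dims"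
    using dims eq by (simp_all add: B_def)
qed

lemma periodic_dims_props:
  assumes "interior_essential y" "positive_periodic_point y"
  shows "truly_essential y" "local_dim_exists \<mu> y"
    "local_dim \<mu> y = lower_local_dim \<mu> y" "local_dim \<mu> y = upper_local_dim \<mu> y"
proof -
  show "truly_essential y" using assms(1) by (simp add: truly_essential_def)
  have "periodic_point y" using assms(2) by (auto simp: positive_periodic_point_def periodic_point_def)
  then obtain L where L: "(dim_ratio \<mu> y \<longlongrightarrow> L) (at_right 0)" using periodic_local_dim by blast
  show "local_dim_exists \<mu> y" using L by (auto simp: local_dim_exists_def)
  have "local_dim \<mu> y = L" unfolding local_dim_def using L by (intro tendsto_Lim) auto
  thus "local_dim \<mu> y = lower_local_dim \<mu> y" "local_dim \<mu> y = upper_local_dim \<mu> y"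
    unfolding lower_local_dim_def upper_local_dim_def using L lim_imp_Liminf lim_imp_Limsup trivial_limit_at_right_real
    by metis+
qed

end

theorem theorem3p12:
  fixes m :: nat and \<rho> :: real and d p :: "nat \<Rightarrow> real" and K :: "real set" and \<mu> :: "real measure"
  assumes "self_similar_measure m \<rho> d K p \<mu>"
    and "ifs.finite_type m \<rho> d"
    and "self_similar_measure.positive_row_property m \<rho> d K p"
  defines "D \<equiv> {local_dim \<mu> y | y. ifs.interior_essential m \<rho> d K y \<and>
                    self_similar_measure.positive_periodic_point m \<rho> d K p y}"
  shows "(\<forall>y. ifs.periodic_point m \<rho> d K y \<longrightarrow> local_dim_exists \<mu> y) \<and>
    dense_subset D {local_dim \<mu> x | x. ifs.truly_essential m \<rho> d K x \<and> local_dim_exists \<mu> x} \<and>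
    dense_subset D {lower_local_dim \<mu> x | x. ifs.truly_essential m \<rho> d K x} \<and>
    dense_subset D {upper_local_dim \<mu> x | x. ifs.truly_essential m \<rho> d K x}"
proof -
  interpret self_similar_measure m \<rho> d K p \<mu> by (rule assms(1))
  obtain F0 where F0: "finite F0"
    "\<And>n \<sigma> \<sigma>'. n \<ge> 1 \<Longrightarrow> \<sigma> \<in> words n \<Longrightarrow> \<sigma>' \<in> words n \<Longrightarrow>
      \<bar>S_word \<sigma> 0 - S_word \<sigma>' 0\<bar> / \<rho> ^ n > 1 \<or> (S_word \<sigma> 0 - S_word \<sigma>' 0) / \<rho> ^ n \<in> F0"
    using assms(2) unfolding finite_type_def by blast
  \<comment> \<open>Finite type speaks of levels from 1 on; at level 0 the only difference is 0,
    which is added to the set.\<close>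
  have F: "(s - t) / \<rho> ^ n \<in> insert 0 F0" if st: "s \<in> pts n" "t \<in> pts n" "\<bar>s - t\<bar> \<le> \<rho> ^ n" for n s t
  proof (cases "n = 0")
    case False
    obtain \<sigma> \<sigma>' where w: "\<sigma> \<in> words n" "s = S_word \<sigma> 0" "\<sigma>' \<in> words n" "t = S_word \<sigma>' 0"
      using st unfolding pts_def by blast
    have "\<bar>s - t\<bar> / \<rho> ^ n \<le> 1" using st(3) by simp
    thus ?thesis using F0(2)[of n \<sigma> \<sigma>'] w False by auto
  qed (use st in simp)
  interpret positive_row_ifs m \<rho> d K p \<mu> "insert 0 F0"
    by unfold_locales (use F F0(1) assms(3) in auto)
  have D: "D = periodic_dims" by (simp add: D_def periodic_dims_def)
  have "local_dim_exists \<mu> y" if "periodic_point y" for y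
    using periodic_local_dim[OF that] by (auto simp: local_dim_exists_def)
  moreover have "dense_subset D {lower_local_dim \<mu> x | x. truly_essential x}"
    unfolding dense_subset_def D
  proof
    show "periodic_dims \<subseteq> {lower_local_dim \<mu> x | x. truly_essential x}"
      unfolding periodic_dims_def using periodic_dims_props by blast
    show "{lower_local_dim \<mu> x | x. truly_essential x} \<subseteq> closure periodic_dims"
      using local_dims_in_closure by blast
  qed
  moreover have "dense_subset D {upper_local_dim \<mu> x | x. truly_essential x}"
    unfolding dense_subset_def D
  proof
    show "periodic_dims \<subseteq> {upper_local_dim \<mu> x | x. truly_essential x}"
      unfolding periodic_dims_def using periodic_dims_props by blast
    show "{upper_local_dim \<mu> x | x. truly_essential x} \<subseteq> closure periodic_dims"
      using local_dims_in_closure by blast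
  qed
  moreover have "dense_subset D {local_dim \<mu> x | x. truly_essential x \<and> local_dim_exists \<mu> x}"
    unfolding dense_subset_def D
  proof
    show "periodic_dims \<subseteq> {local_dim \<mu> x | x. truly_essential x \<and> local_dim_exists \<mu> x}"
      unfolding periodic_dims_def using periodic_dims_props by blast
    show "{local_dim \<mu> x | x. truly_essential x \<and> local_dim_exists \<mu> x} \<subseteq> closure periodic_dims"
    proof clarify
      fix x assume x: "truly_essential x" "local_dim_exists \<mu> x"
      then obtain l where l: "(dim_ratio \<mu> x \<longlongrightarrow> l) (at_right 0)" by (auto simp: local_dim_exists_def)
      have "local_dim \<mu> x = l" unfolding local_dim_def using l by (intro tendsto_Lim) auto
      \<comment> \<open>Where the limit exists it equals the upper local dimension, so the closure
        statement for the latter applies.\<close>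
      moreover have "upper_local_dim \<mu> x = l" unfolding upper_local_dim_def
        using l by (intro lim_imp_Limsup) auto
      ultimately show "local_dim \<mu> x \<in> closure periodic_dims" using local_dims_in_closure(1)[OF x(1)] by simp
    qed
  qed
  ultimately show ?thesis by blast
qed

end
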